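(* Let $K$ be an algebraically closed field of characteristic zero. Let $Q=L\ltimes\exp(V)$ be a semi-direct product, where $Q$ is a connected affine algebraic group over $K$ and $\exp(V)$ is a normal Abelian unipotent subgroup with Lie algebra $V$. Let $\mathfrak q=\mathrm{Lie}\,Q$ and suppose that $\mathrm{ind}\,\mathfrak q=1$ and that $\gamma\in V^*$ is such that the orbit $L\gamma\subset V^*$ is open. Let $\mathfrak l_\gamma$ be the Lie algebra of the stabiliser $L_\gamma$ and $\mathfrak l_{<\gamma>}$ the Lie algebra of the normaliser $L_{<\gamma>}\subset L$ of the line $K\gamma$. Suppose that $\mathfrak l_\gamma$ is contact and $\mathrm{ind}\,\mathfrak l_{<\gamma>}=0$. Let $s\in\mathfrak l_{<\gamma>}$ be a principal element. Then $\mathfrak q$ is contact if and only if $\mathrm{ad}^*(s)\gamma\neq\gamma$.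
   Context: A finite-dimensional Lie algebra $\mathfrak h$ is called contact if $\dim\mathfrak h=2n+1$ is odd and there is $\alpha\in\mathfrak h^*$ with $(d_{\mathfrak h}\alpha)^{\wedge n}\wedge\alpha\neq 0$, where $d_{\mathfrak h}\alpha\in\wedge^2\mathfrak h^*$ is the Chevalley--Eilenberg differential, $d_{\mathfrak h}\alpha(\xi,\eta)=-\alpha([\xi,\eta])$ (up to an irrelevant sign convention). The index is $\mathrm{ind}\,\mathfrak h=\min_{\gamma\in\mathfrak h^*}\dim\mathfrak h_\gamma$, where $\mathfrak h_\gamma=\{\xi\in\mathfrak h\mid\gamma([\xi,\mathfrak h])=0\}$. In the semi-direct product, $V$ is an Abelian ideal of $\mathfrak q=\mathfrak l\ltimes V$, $\mathfrak l=\mathrm{Lie}\,L$, and $L$ acts on $V$ and on $V^*$ (dual action); $\mathrm{ad}^*(s)\gamma$ denotes the infinitesimal action of $s\in\mathfrak l$ on $\gamma\in V^*$, i.e. $(\mathrm{ad}^*(s)\gamma)(v)=-\gamma([s,v])$. Explicitly, $L_{<\gamma>}=\{g\in L\mid g\gamma\in K\gamma\}$. Principal element: let $\mathfrak h=\mathrm{Lie}\,H$ be a Lie algebra of index zero, so that $H$ has an open orbit $H\beta$ in $\mathfrak h^*$ (where $\mathfrak h_\beta=0$). For each $\eta\in H\beta$ there is a unique $s_\eta\in\mathfrak h$ with $\mathrm{ad}^*(s_\eta)\eta=\eta$, where $(\mathrm{ad}^*(\xi)\eta)(y)=-\eta([\xi,y])$; the elements $s_\eta$ are all $H$-conjugate,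 and any of them is called a principal element of $\mathfrak h$. *)

theory Defs
  imports
    "HOL-Analysis.Analysis"
    "HOL-Algebra.Coset"
    "HOL-Computational_Algebra.Polynomial"
begin

section \<open>Algebras of functions and the Zariski topology\<close>

text \<open>The algebra of scalar-valued functions generated by the coordinate functions \<open>E\<close>.\<close>

inductive_set fun_alg :: "('a \<Rightarrow> 'k::comm_ring_1) set \<Rightarrow> ('a \<Rightarrow> 'k) set"
  for E where
  gen: "f \<in> E \<Longrightarrow> f \<in> fun_alg E"
| const: "(\<lambda>_. c) \<in> fun_alg E"
| add: "f \<in> fun_alg E \<Longrightarrow> g \<in> fun_alg E \<Longrightarrow> (\<lambda>x. f x + g x) \<in> fun_alg E"
| mult: "f \<in> fun_alg E \<Longrightarrow> g \<in> fun_alg E \<Longrightarrow> (\<lambda>x. f x * g x) \<in> fun_alg E"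

text \<open>The topology on \<open>X\<close> whose basic open sets are the nonvanishing loci of functions in
  \<open>fun_alg E\<close>; its closed sets are the vanishing sets (lemma \<open>closedin_zariski\<close>).\<close>

definition zariski :: "('a \<Rightarrow> 'k::comm_ring_1) set \<Rightarrow> 'a set \<Rightarrow> 'a topology" where
  "zariski E X = topology_generated_by ((\<lambda>f. {x\<in>X. f x \<noteq> 0}) ` fun_alg E)"

lemma topspace_zariski [simp]: "topspace (zariski E X) = X"
proof -
  have "(\<lambda>_. 1) \<in> fun_alg E" by (rule fun_alg.const)
  then show ?thesis unfolding zariski_def by force
qed

lemma openin_zariski:
  fixes E :: "('a \<Rightarrow> 'k::idom) set"
  shows "openin (zariski E X) S \<longleftrightarrow>
    S \<subseteq> X \<and> (\<forall>x\<in>S. \<exists>f\<in>fun_alg E. f x \<noteq> 0 \<and> (\<forall>y\<in>X. f y \<noteq> 0 \<longrightarrow> y \<in> S))" (is "_ \<longleftrightarrow> ?R S")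
proof
  assume "openin (zariski E X) S"
  then have "generate_topology_on ((\<lambda>f. {x\<in>X. f x \<noteq> 0}) ` fun_alg E) S"
    by (simp add: zariski_def openin_topology_generated_by_iff)
  then show "?R S"
  proof induction
    case Empty
    then show ?case by simp
  next
    case (Int a b)
    show ?case
    proof (intro conjI ballI)
      show "a \<inter> b \<subseteq> X" using conjunct1[OF Int.IH(1)] by (rule le_infI1)
    next
      fix x assume x: "x \<in> a \<inter> b"
      obtain f where f: "f \<in> fun_alg E" "f x \<noteq> 0" "\<forall>y\<in>X. f y \<noteq> 0 \<longrightarrow> y \<in> a"
        using bspec[OF conjunct2[OF Int.IH(1)] IntD1[OF x]] by (elim bexE conjE)
      obtain g where g: "g \<in> fun_alg E" "g x \<noteq> 0" "\<forall>y\<in>X. g y \<noteq> 0 \<longrightarrow> y \<in> b"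
        using bspec[OF conjunct2[OF Int.IH(2)] IntD2[OF x]] by (elim bexE conjE)
      show "\<exists>f\<in>fun_alg E. f x \<noteq> 0 \<and> (\<forall>y\<in>X. f y \<noteq> 0 \<longrightarrow> y \<in> a \<inter> b)"
        using f g by (intro bexI[OF _ fun_alg.mult[OF f(1) g(1)]]) simp
    qed
  next
    case (UN K)
    show ?case
    proof (intro conjI ballI)
      show "\<Union>K \<subseteq> X" using conjunct1[OF UN.IH] by (rule Sup_least)
    next
      fix x assume "x \<in> \<Union>K"
      then obtain k where "k \<in> K" "x \<in> k" by blast
      obtain f where f: "f \<in> fun_alg E" "f x \<noteq> 0" "\<forall>y\<in>X. f y \<noteq> 0 \<longrightarrow> y \<in> k"
        using bspec[OF conjunct2[OF UN.IH[OF \<open>k \<in> K\<close>]] \<open>x \<in> k\<close>] by (elim bexE conjE)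
      then show "\<exists>f\<in>fun_alg E. f x \<noteq> 0 \<and> (\<forall>y\<in>X. f y \<noteq> 0 \<longrightarrow> y \<in> \<Union>K)"
        using \<open>k \<in> K\<close> by (intro bexI[of _ f]) auto
    qed
  next
    case (Basis s)
    then show ?case by auto
  qed
next
  assume R: "?R S"
  show "openin (zariski E X) S"
  proof (subst openin_subopen, intro ballI)
    fix x assume "x \<in> S"
    obtain f where f: "f \<in> fun_alg E" "f x \<noteq> 0" "\<forall>y\<in>X. f y \<noteq> 0 \<longrightarrow> y \<in> S"
      using bspec[OF conjunct2[OF R] \<open>x \<in> S\<close>] by (elim bexE conjE)
    have "openin (zariski E X) {y\<in>X. f y \<noteq> 0}"
      unfolding zariski_def using f(1) by (intro topology_generated_by_Basis imageI)
    moreover have "x \<in> {y\<in>X. f y \<noteq> 0}" "{y\<in>X. f y \<noteq> 0} \<subseteq> S"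
      using subsetD[OF conjunct1[OF R] \<open>x \<in> S\<close>] f(2,3) by auto
    ultimately show "\<exists>T. openin (zariski E X) T \<and> x \<in> T \<and> T \<subseteq> S" by meson
  qed
qed

lemma closedin_zariski:
  fixes E :: "('a \<Rightarrow> 'k::idom) set"
  shows "closedin (zariski E X) C \<longleftrightarrow> (\<exists>F\<subseteq>fun_alg E. C = {x\<in>X. \<forall>f\<in>F. f x = 0})"
proof
  assume C: "closedin (zariski E X) C"
  then have CX: "C \<subseteq> X" and O: "\<forall>x\<in>X - C. \<exists>f\<in>fun_alg E. f x \<noteq> 0 \<and> (\<forall>y\<in>X. f y \<noteq> 0 \<longrightarrow> y \<in> X - C)"
    by (simp_all add: closedin_def openin_zariski)
  let ?F = "{f\<in>fun_alg E. \<forall>y\<in>C. f y = 0}"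
  have "x \<in> C" if x: "x \<in> X" "\<forall>f\<in>?F. f x = 0" for x
  proof (rule ccontr)
    assume "x \<notin> C"
    obtain f where f: "f \<in> fun_alg E" "f x \<noteq> 0" "\<forall>y\<in>X. f y \<noteq> 0 \<longrightarrow> y \<in> X - C"
      using bspec[OF O DiffI[OF x(1) \<open>x \<notin> C\<close>]] by (elim bexE conjE)
    then have "f \<in> ?F" using CX by auto
    then show False using x(2) f(2) by simp
  qed
  then have "C = {x\<in>X. \<forall>f\<in>?F. f x = 0}" using CX by (intro subset_antisym subsetI) auto
  then show "\<exists>F\<subseteq>fun_alg E. C = {x\<in>X. \<forall>f\<in>F. f x = 0}"
    by (intro exI[of _ ?F] conjI) auto
next
  assume "\<exists>F\<subseteq>fun_alg E. C = {x\<in>X. \<forall>f\<in>F. f x = 0}"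
  then obtain F where F: "F \<subseteq> fun_alg E" "C = {x\<in>X. \<forall>f\<in>F. f x = 0}" by (elim exE conjE)
  then show "closedin (zariski E X) C"
    by (auto simp: closedin_def openin_zariski)
qed


section \<open>Linear algebraic groups\<close>

text \<open>An affine algebraic group is taken to be a Zariski closed subgroup of some general linear
  group; regular functions on \<open>GL\<^sub>n\<close> are polynomials in the matrix entries and \<open>1/det\<close>.\<close>

definition GL :: "('k::field ^ 'n ^ 'n) monoid" where
  "GL = \<lparr>carrier = {A. invertible A}, mult = (**), one = mat 1\<rparr>"

definition entries :: "('k::field ^ 'n ^ 'n \<Rightarrow> 'k) set" where
  "entries = {\<lambda>A. A $ i $ j | i j. True}"

definition GL_coords :: "('k::field ^ 'n ^ 'n \<Rightarrow> 'k) set" where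
  "GL_coords = insert (\<lambda>A. inverse (det A)) entries"

definition zariski_GL :: "('k::field ^ 'n ^ 'n) topology" where
  "zariski_GL = zariski GL_coords (carrier GL)"

definition algebraic_group :: "('k::field ^ 'n ^ 'n) set \<Rightarrow> bool" where
  "algebraic_group G \<longleftrightarrow> subgroup G GL \<and> closedin zariski_GL G"

definition connected_algebraic_group :: "('k::field ^ 'n ^ 'n) set \<Rightarrow> bool" where
  "connected_algebraic_group G \<longleftrightarrow>
     algebraic_group G \<and> connected_space (subtopology zariski_GL G)"

definition unipotent :: "'k::field ^ 'n ^ 'n \<Rightarrow> bool" where
  "unipotent A \<longleftrightarrow> (\<exists>m. (((**) (A - mat 1)) ^^ m) (mat 1) = 0)"

text \<open>\<open>G\<close> is the semi-direct product of its closed subgroups \<open>L\<close> and \<open>U\<close> (\<open>U\<close> normal) in the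
  category of algebraic groups: multiplication \<open>L \<times> U \<rightarrow> G\<close> is an isomorphism of varieties,
  i.e. it is bijective and the entries of both components of the inverse are regular on \<open>G\<close>.\<close>

definition algebraic_semidirect_product ::
    "('k::field ^ 'n ^ 'n) set \<Rightarrow> ('k ^ 'n ^ 'n) set \<Rightarrow> ('k ^ 'n ^ 'n) set \<Rightarrow> bool" where
  "algebraic_semidirect_product G L U \<longleftrightarrow>
     algebraic_group G \<and> algebraic_group L \<and> algebraic_group U \<and>
     L \<subseteq> G \<and> normal U (GL\<lparr>carrier := G\<rparr>) \<and>
     bij_betw (\<lambda>(l, u). l ** u) (L \<times> U) G \<and>
     (\<forall>i j. \<exists>f\<in>fun_alg GL_coords. \<forall>l\<in>L. \<forall>u\<in>U. f (l ** u) = l $ i $ j) \<and>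
     (\<forall>i j. \<exists>f\<in>fun_alg GL_coords. \<forall>l\<in>L. \<forall>u\<in>U. f (l ** u) = u $ i $ j)"


section \<open>Lie algebras of linear algebraic groups\<close>

definition mscale :: "'k::field \<Rightarrow> 'k ^ 'n ^ 'n \<Rightarrow> 'k ^ 'n ^ 'n" where
  "mscale c A = (\<chi> i j. c * A $ i $ j)"

global_interpretation mvs: vector_space "mscale :: 'k::field \<Rightarrow> 'k ^ 'n ^ 'n \<Rightarrow> 'k ^ 'n ^ 'n"
  by unfold_locales (simp_all add: mscale_def vec_eq_iff algebra_simps)

definition lie_bracket :: "'k::field ^ 'n ^ 'n \<Rightarrow> 'k ^ 'n ^ 'n \<Rightarrow> 'k ^ 'n ^ 'n" where
  "lie_bracket X Y = X ** Y - Y ** X"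

text \<open>The Zariski tangent space at the identity, inside the space of all matrices: the linear
  coefficient of \<open>t \<mapsto> f (1 + t X)\<close> vanishes for each polynomial function \<open>f\<close> vanishing
  on \<open>G\<close>. The polynomial \<open>p\<close> always exists (lemma \<open>line_restriction_poly\<close>), and it is unique
  over an infinite field.\<close>

definition Lie :: "('k::field ^ 'n ^ 'n) set \<Rightarrow> ('k ^ 'n ^ 'n) set" where
  "Lie G = {X. \<forall>f\<in>fun_alg entries. (\<forall>g\<in>G. f g = 0) \<longrightarrow>
     (\<exists>p. (\<forall>t. poly p t = f (mat 1 + mscale t X)) \<and> coeff p 1 = 0)}"

lemma line_restriction_poly:
  fixes A X :: "'k::field ^ 'n ^ 'n"
  assumes "f \<in> fun_alg entries"
  shows "\<exists>p. \<forall>t. poly p t = f (A + mscale t X)"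
  using assms
proof induction
  case (gen f)
  then obtain i j where "f = (\<lambda>A. A $ i $ j)" by (auto simp: entries_def)
  then show ?case by (intro exI[of _ "[:A $ i $ j, X $ i $ j:]"]) (simp add: mscale_def)
next
  case (const c)
  then show ?case by (intro exI[of _ "[:c:]"]) simp
next
  case (add f g)
  then show ?case by (metis poly_add)
next
  case (mult f g)
  then show ?case by (metis poly_mult)
qed


section \<open>Dual spaces, actions, index\<close>

text \<open>Linear functionals on a subspace \<open>W\<close> are represented by functions on all matrices that
  are zero outside \<open>W\<close>, so that equality of functionals on \<open>W\<close> is equality of functions.\<close>

definition dual_space :: "('k::field ^ 'n ^ 'n) set \<Rightarrow> ('k ^ 'n ^ 'n \<Rightarrow> 'k) set" where
  "dual_space W = {\<phi>. (\<forall>x\<in>W. \<forall>y\<in>W. \<phi> (x + y) = \<phi> x + \<phi> y) \<and>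
     (\<forall>c. \<forall>x\<in>W. \<phi> (mscale c x) = c * \<phi> x) \<and> (\<forall>x. x \<notin> W \<longrightarrow> \<phi> x = 0)}"

definition zariski_dual :: "('k::field ^ 'n ^ 'n) set \<Rightarrow> ('k ^ 'n ^ 'n \<Rightarrow> 'k) topology" where
  "zariski_dual W = zariski ((\<lambda>v \<phi>. \<phi> v) ` W) (dual_space W)"

text \<open>Dual of the adjoint (conjugation) action on an \<open>Ad\<close>-stable subspace \<open>W\<close>, for group elements
  and infinitesimally. The coadjoint action is the case where \<open>W\<close> is the whole Lie algebra.\<close>

definition dual_act ::
    "('k::field ^ 'n ^ 'n) set \<Rightarrow> 'k ^ 'n ^ 'n \<Rightarrow> ('k ^ 'n ^ 'n \<Rightarrow> 'k) \<Rightarrow> 'k ^ 'n ^ 'n \<Rightarrow> 'k" where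
  "dual_act W g \<phi> = (\<lambda>v. if v \<in> W then \<phi> (matrix_inv g ** v ** g) else 0)"

definition ad_star ::
    "('k::field ^ 'n ^ 'n) set \<Rightarrow> 'k ^ 'n ^ 'n \<Rightarrow> ('k ^ 'n ^ 'n \<Rightarrow> 'k) \<Rightarrow> 'k ^ 'n ^ 'n \<Rightarrow> 'k" where
  "ad_star W \<xi> \<phi> = (\<lambda>v. if v \<in> W then - \<phi> (lie_bracket \<xi> v) else 0)"

definition dual_orbit ::
    "('k::field ^ 'n ^ 'n) set \<Rightarrow> ('k ^ 'n ^ 'n) set \<Rightarrow> ('k ^ 'n ^ 'n \<Rightarrow> 'k) \<Rightarrow> ('k ^ 'n ^ 'n \<Rightarrow> 'k) set" where
  "dual_orbit W G \<phi> = (\<lambda>g. dual_act W g \<phi>) ` G"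

definition stabiliser ::
    "('k::field ^ 'n ^ 'n) set \<Rightarrow> ('k ^ 'n ^ 'n) set \<Rightarrow> ('k ^ 'n ^ 'n \<Rightarrow> 'k) \<Rightarrow> ('k ^ 'n ^ 'n) set" where
  "stabiliser W G \<phi> = {g\<in>G. dual_act W g \<phi> = \<phi>}"

definition line_normaliser ::
    "('k::field ^ 'n ^ 'n) set \<Rightarrow> ('k ^ 'n ^ 'n) set \<Rightarrow> ('k ^ 'n ^ 'n \<Rightarrow> 'k) \<Rightarrow> ('k ^ 'n ^ 'n) set" where
  "line_normaliser W G \<phi> = {g\<in>G. \<exists>c. dual_act W g \<phi> = (\<lambda>v. c * \<phi> v)}"

definition coadjoint_stabiliser ::
    "('k::field ^ 'n ^ 'n) set \<Rightarrow> ('k ^ 'n ^ 'n \<Rightarrow> 'k) \<Rightarrow> ('k ^ 'n ^ 'n) set" where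
  "coadjoint_stabiliser h \<phi> = {\<xi>\<in>h. \<forall>y\<in>h. \<phi> (lie_bracket \<xi> y) = 0}"

definition lie_index :: "('k::field ^ 'n ^ 'n) set \<Rightarrow> nat" where
  "lie_index h = (INF \<phi>\<in>dual_space h. mvs.dim (coadjoint_stabiliser h \<phi>))"

definition principal_element :: "('k::field ^ 'n ^ 'n) set \<Rightarrow> 'k ^ 'n ^ 'n \<Rightarrow> bool" where
  "principal_element H s \<longleftrightarrow>
     (\<exists>\<beta>\<in>dual_space (Lie H). coadjoint_stabiliser (Lie H) \<beta> = {0} \<and>
        openin (zariski_dual (Lie H)) (dual_orbit (Lie H) H \<beta>) \<and>
        (\<exists>\<eta>\<in>dual_orbit (Lie H) H \<beta>. s \<in> Lie H \<and> ad_star (Lie H) s \<eta> = \<eta>))"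


section \<open>Exterior forms and contact Lie algebras\<close>

text \<open>A \<open>p\<close>-form is a function of sequences that depends on the first \<open>p\<close> terms only; the wedge
  product is normalised by \<open>1/(p! q!)\<close>, which is harmless in characteristic zero.\<close>

definition wedge :: "nat \<Rightarrow> nat \<Rightarrow> ((nat \<Rightarrow> 'v) \<Rightarrow> 'k::field_char_0) \<Rightarrow> ((nat \<Rightarrow> 'v) \<Rightarrow> 'k) \<Rightarrow> (nat \<Rightarrow> 'v) \<Rightarrow> 'k" where
  "wedge p q \<omega> \<theta> = (\<lambda>x. (\<Sum>\<sigma> | \<sigma> permutes {..<p + q}.
     of_int (sign \<sigma>) * \<omega> (\<lambda>i. x (\<sigma> i)) * \<theta> (\<lambda>i. x (\<sigma> (p + i)))) / (fact p * fact q))"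

fun wedge_power :: "nat \<Rightarrow> ((nat \<Rightarrow> 'v) \<Rightarrow> 'k::field_char_0) \<Rightarrow> nat \<Rightarrow> (nat \<Rightarrow> 'v) \<Rightarrow> 'k" where
  "wedge_power p \<omega> 0 = (\<lambda>_. 1)"
| "wedge_power p \<omega> (Suc m) = wedge (p * m) p (wedge_power p \<omega> m) \<omega>"

definition CE_diff :: "('k::field_char_0 ^ 'n ^ 'n \<Rightarrow> 'k) \<Rightarrow> (nat \<Rightarrow> 'k ^ 'n ^ 'n) \<Rightarrow> 'k" where
  "CE_diff \<alpha> = (\<lambda>x. - \<alpha> (lie_bracket (x 0) (x 1)))"

definition contact :: "('k::field_char_0 ^ 'n ^ 'n) set \<Rightarrow> bool" where
  "contact h \<longleftrightarrow> (\<exists>m. mvs.dim h = 2 * m + 1 \<and> (\<exists>\<alpha>\<in>dual_space h. \<exists>x. (\<forall>i. x i \<in> h) \<and>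
     wedge (2 * m) 1 (wedge_power 2 (CE_diff \<alpha>) m) (\<lambda>x. \<alpha> (x 0)) x \<noteq> 0))"

end

theory Submission
  imports Defs "HOL-Library.Function_Algebras" "HOL-Computational_Algebra.Formal_Power_Series"
begin

text \<open>
  Openness of the orbit \<open>L \<gamma>\<close> gives \<open>ad\<^sup>*(l) \<gamma> = V\<^sup>*\<close>; in particular \<open>ad\<^sup>*(e) \<gamma> = \<gamma>\<close> for some \<open>e\<close> in the
  stabiliser \<open>a\<close> of the line of \<open>\<gamma>\<close>. Let \<open>\<alpha>\<close> be a functional on \<open>q\<close> that restricts to \<open>\<gamma>\<close> on \<open>V\<close> and to \<open>\<eta>\<close>
  on \<open>a\<close>, where \<open>ad\<^sup>*(s) \<eta> = \<eta>\<close>, and let \<open>ad\<^sup>*(s) \<gamma> = c \<gamma>\<close>. If \<open>x + v\<close> is in the radical of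
  \<open>d\<alpha>\<close>, then \<open>x\<close> fixes \<open>\<gamma>\<close> and is in the radical of the restriction of \<open>d\<alpha>\<close> to the stabiliser of \<open>\<gamma>\<close>,
  and a computation gives \<open>\<alpha> (x + v) = (1 - c) \<alpha> [e, x]\<close>. If \<open>c \<noteq> 1\<close>, the vanishing of \<open>\<alpha> (x + v)\<close>
  puts \<open>x\<close> in the radical of \<open>d\<eta>\<close>, which is zero, and \<open>v = 0\<close> follows; thus \<open>\<alpha>\<close> is a contact form.
  If \<open>c = 1\<close>, \<open>\<alpha>\<close> vanishes on the radical, which is nonzero because \<open>q\<close> has odd dimension. As contact forms
  are a Zariski open set, a contact form could be moved to such an \<open>\<alpha>\<close> by the open orbits of \<open>\<gamma>\<close> and \<open>\<eta>\<close>,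
  so \<open>q\<close> is not contact.

  The two facts about algebraic groups that this uses are instances of one extension principle:
  a specialisation of a domain \<open>R\<close> extends to \<open>R[x\<^sub>1, \<dots>, x\<^sub>n]\<close> off a proper closed set. With values in
  the dual numbers it shows that the orbit map of an open orbit is surjective on tangent spaces;
  applied to the formal group \<open>exp (t x)\<close> it shows that \<open>a\<close> is the Lie algebra of the normaliser of
  the line of \<open>\<gamma>\<close>.
\<close>

text \<open>On an algebra of dimension 2m + 1 the top form (d\<alpha>)^m \<and> \<alpha> is nonzero
  exactly when \<alpha> kills no nonzero element of the radical of d\<alpha>. The argument runs on
  this criterion (\<open>contact_form\<close>) and returns to the wedge product to see that it is an
  open condition on \<alpha>. The field is an arbitrary algebraically closed one of characteristic
  zero, so neither a convergent exponential nor a limit is at hand. Points of \<open>L\<close> are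
  produced instead as ring homomorphisms into the field, and points with a tangent vector as
  homomorphisms into the dual numbers. Characteristic zero gives separability: the derivative of a
  minimal polynomial does not vanish at its root. Principal elements are never identified by
  uniqueness. Conjugation by the normaliser of the line carries a principal element for one
  functional to one for another, and it keeps the scalar c because \<gamma> is merely rescaled;
  hence any point of the open orbit is as good as \<eta>.\<close>

section \<open>Specialisations in the dual numbers\<close>

text \<open>\<open>Dual a b\<close> stands for a + b \<epsilon> with \<epsilon>^2 = 0. A
  homomorphism from a ring of functions to these numbers is a point together with a tangent
  vector.\<close>

datatype 'a dual = Dual (dual_re: 'a) (dual_eps: 'a)

instantiation dual :: (comm_ring_1) comm_ring_1
begin
definition "0 = Dual 0 0"
definition "1 = Dual 1 0"
definition "x + y = Dual (dual_re x + dual_re y) (dual_eps x + dual_eps y)"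
definition "x - y = Dual (dual_re x - dual_re y) (dual_eps x - dual_eps y)"
definition "- x = Dual (- dual_re x) (- dual_eps x)"
definition "x * y = Dual (dual_re x * dual_re y) (dual_re x * dual_eps y + dual_eps x * dual_re y)"
instance
  by standard (auto simp: zero_dual_def one_dual_def plus_dual_def minus_dual_def
      uminus_dual_def times_dual_def algebra_simps intro: dual.expand)
end

lemma dual_sel [simp]:
  "dual_re 0 = 0" "dual_eps 0 = 0" "dual_re 1 = 1" "dual_eps 1 = 0"
  "dual_re (x + y) = dual_re x + dual_re y" "dual_eps (x + y) = dual_eps x + dual_eps y"
  "dual_re (x - y) = dual_re x - dual_re y" "dual_eps (x - y) = dual_eps x - dual_eps y"
  "dual_re (- x) = - dual_re x" "dual_eps (- x) = - dual_eps x"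
  "dual_re (x * y) = dual_re x * dual_re y"
  "dual_eps (x * y) = dual_re x * dual_eps y + dual_eps x * dual_re y"
  by (simp_all add: zero_dual_def one_dual_def plus_dual_def minus_dual_def
      uminus_dual_def times_dual_def)

text \<open>Elements with nonzero real part are units. This cancels the powers of leading
  coefficients that pseudo-division leaves behind.\<close>

lemma dual_mult_eq_0:
  fixes x y :: "'a::field dual"
  assumes "x * y = 0" "dual_re x \<noteq> 0"
  shows "y = 0"
proof -
  have "dual_re x * dual_re y = 0" "dual_re x * dual_eps y + dual_eps x * dual_re y = 0"
    using assms(1) by (metis dual_sel(1,11), metis dual_sel(2,12))
  then show ?thesis using assms(2) by (auto intro: dual.expand)
qed

text \<open>Taylor expansion to first order: besides the derivative term, the \<epsilon> parts of
  the coefficients of \<open>P\<close> contribute.\<close>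

lemma poly_dual:
  fixes P :: "'a::field dual poly"
  shows "poly P (Dual a b) = Dual (poly (map_poly dual_re P) a)
    (poly (map_poly dual_eps P) a + b * poly (pderiv (map_poly dual_re P)) a)"
proof (induction P)
  case 0
  then show ?case by (simp add: zero_dual_def)
next
  case (pCons c P)
  then show ?case
    by (auto simp: map_poly_pCons pderiv_pCons algebra_simps intro: dual.expand)
qed

section \<open>Subrings modulo a prime ideal, and pseudo-division over them\<close>

definition poly_over :: "'r::comm_ring_1 set \<Rightarrow> 'r poly \<Rightarrow> bool" where
  "poly_over R p \<longleftrightarrow> (\<forall>i. coeff p i \<in> R)"

definition adjoin :: "'r::comm_ring_1 set \<Rightarrow> 'r \<Rightarrow> 'r set" where
  "adjoin R x = {poly p x | p. poly_over R p}"

text \<open>A homomorphism on \<open>R\<close> that factors through the quotient by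
  \<open>R \<inter> Z\<close>. As a function on the whole ring it is unconstrained outside
  \<open>R\<close>.\<close>

definition hom_mod :: "'r::comm_ring_1 set \<Rightarrow> 'r set \<Rightarrow> ('r \<Rightarrow> 'd::comm_ring_1) \<Rightarrow> bool" where
  "hom_mod R Z \<phi> \<longleftrightarrow> \<phi> 1 = 1 \<and> (\<forall>a\<in>R. \<forall>b\<in>R. \<phi> (a + b) = \<phi> a + \<phi> b \<and> \<phi> (a * b) = \<phi> a * \<phi> b)
     \<and> (\<forall>a\<in>R \<inter> Z. \<phi> a = 0)"

text \<open>The formal derivative; \<open>pderiv\<close> is only available in the absence of zero divisors.\<close>

definition formal_deriv :: "'r::comm_ring_1 poly \<Rightarrow> 'r poly" where
  "formal_deriv p = (\<Sum>i<degree p. monom (of_nat (Suc i) * coeff p (Suc i)) i)"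

lemma coeff_formal_deriv: "coeff (formal_deriv p) n = of_nat (Suc n) * coeff p (Suc n)"
proof -
  have "coeff (formal_deriv p) n = (\<Sum>i<degree p. if i = n then of_nat (Suc i) * coeff p (Suc i) else 0)"
    unfolding formal_deriv_def coeff_sum coeff_monom ..
  also have "\<dots> = of_nat (Suc n) * coeff p (Suc n)"
    by (cases "n < degree p") (auto simp: sum.delta coeff_eq_0 simp del: of_nat_Suc)
  finally show ?thesis .
qed

text \<open>\<open>Z\<close> is a prime ideal of the whole ring, not a subset of the subring \<open>R\<close>; the domain that is
  specialised is \<open>R / (R \<inter> Z)\<close>. Thus \<open>Z\<close> stays the same when elements are adjoined to \<open>R\<close>.\<close>

locale ring_mod_prime =
  fixes R Z :: "'r::comm_ring_1 set"
  assumes one: "1 \<in> R" and neg1: "-1 \<in> R"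
    and add: "a \<in> R \<Longrightarrow> b \<in> R \<Longrightarrow> a + b \<in> R"
    and mult: "a \<in> R \<Longrightarrow> b \<in> R \<Longrightarrow> a * b \<in> R"
    and Z0: "0 \<in> Z" and Zadd: "a \<in> Z \<Longrightarrow> b \<in> Z \<Longrightarrow> a + b \<in> Z"
    and Zmult: "b \<in> Z \<Longrightarrow> a * b \<in> Z"
    and Zprime: "a * b \<in> Z \<Longrightarrow> a \<in> Z \<or> b \<in> Z"
    and Zchar: "n > 0 \<Longrightarrow> of_nat n \<notin> Z"
begin

lemma Z1: "1 \<notin> Z" using Zchar[of 1] by simp
lemma zero: "0 \<in> R" using add[OF one neg1] by simp
lemma minus: "a \<in> R \<Longrightarrow> - a \<in> R" using mult[OF neg1] by fastforce
lemma diff: "a \<in> R \<Longrightarrow> b \<in> R \<Longrightarrow> a - b \<in> R" using add[OF _ minus] by fastforce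
lemma power: "a \<in> R \<Longrightarrow> a ^ n \<in> R" by (induction n) (auto intro: one mult)
lemma sum: "(\<And>i. i \<in> I \<Longrightarrow> f i \<in> R) \<Longrightarrow> sum f I \<in> R"
  by (induction I rule: infinite_finite_induct) (auto intro: zero add)
lemma of_nat: "of_nat n \<in> R" by (induction n) (auto intro: zero add one)
lemma Zmult': "b \<in> Z \<Longrightarrow> b * a \<in> Z" using Zmult[of b a] by (simp add: mult.commute)
lemma Zminus: "a \<in> Z \<Longrightarrow> - a \<in> Z" using Zmult[of a "-1"] by simp
lemma Zdiff: "a \<in> Z \<Longrightarrow> b \<in> Z \<Longrightarrow> a - b \<in> Z" using Zadd[OF _ Zminus] by fastforce
lemma Zsum: "(\<And>i. i \<in> I \<Longrightarrow> f i \<in> Z) \<Longrightarrow> sum f I \<in> Z"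
  by (induction I rule: infinite_finite_induct) (auto intro: Z0 Zadd)
lemma Zpower: "a ^ n \<in> Z \<Longrightarrow> a \<in> Z"
  by (induction n) (use Z1 Zprime in auto)
lemma Zdiff_iff: "a - b \<in> Z \<Longrightarrow> a \<in> Z \<longleftrightarrow> b \<in> Z"
  using Zadd[of "a - b" b] Zdiff[of a "a - b"] by auto

lemma poly_over_0: "poly_over R 0" by (simp add: poly_over_def zero)
lemma poly_over_const: "a \<in> R \<Longrightarrow> poly_over R [:a:]"
  by (auto simp: poly_over_def coeff_pCons zero split: nat.split)
lemma poly_over_monom: "a \<in> R \<Longrightarrow> poly_over R (monom a n)" by (simp add: poly_over_def zero)
lemma poly_over_add: "poly_over R p \<Longrightarrow> poly_over R q \<Longrightarrow> poly_over R (p + q)"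
  by (simp add: poly_over_def add)
lemma poly_over_diff: "poly_over R p \<Longrightarrow> poly_over R q \<Longrightarrow> poly_over R (p - q)"
  by (simp add: poly_over_def diff)
lemma poly_over_mult: "poly_over R p \<Longrightarrow> poly_over R q \<Longrightarrow> poly_over R (p * q)"
  by (auto simp: poly_over_def coeff_mult intro!: sum mult)
lemma poly_over_smult: "a \<in> R \<Longrightarrow> poly_over R p \<Longrightarrow> poly_over R (smult a p)"
  by (simp add: poly_over_def mult)
lemma poly_over_deriv: "poly_over R p \<Longrightarrow> poly_over R (formal_deriv p)"
  by (auto simp: poly_over_def coeff_formal_deriv simp del: of_nat_Suc intro!: mult of_nat)
lemma poly_over_lead: "poly_over R p \<Longrightarrow> lead_coeff p \<in> R" by (simp add: poly_over_def)

lemma poly_over_Z_add: "poly_over Z p \<Longrightarrow> poly_over Z q \<Longrightarrow> poly_over Z (p + q)"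
  by (simp add: poly_over_def Zadd)
lemma poly_over_Z_mult: "poly_over Z q \<Longrightarrow> poly_over Z (p * q)"
  by (auto simp: poly_over_def coeff_mult intro!: Zsum Zmult)
lemma poly_over_Z_poly: "poly_over Z p \<Longrightarrow> poly p x \<in> Z"
  unfolding poly_over_def poly_altdef by (auto intro!: Zsum Zmult')

text \<open>Each elimination of a leading term costs a factor \<open>lead_coeff g\<close>, as
  \<open>R\<close> is not a field. The bound on the degree of \<open>s\<close> is what later keeps a
  cofactor of the minimal polynomial below its degree.\<close>

lemma pseudo_division:
  assumes "poly_over R f" "poly_over R g" "degree g > 0"
  shows "\<exists>k s r. poly_over R s \<and> poly_over R r \<and> smult (lead_coeff g ^ k) f = g * s + r \<and>
    degree r < degree g \<and> degree s \<le> degree f - degree g"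
  using assms(1)
proof (induction "degree f" arbitrary: f rule: less_induct)
  case less
  show ?case
  proof (cases "degree f < degree g")
    case True
    then show ?thesis using less.prems poly_over_0
      by (intro exI[of _ 0] exI[of _ "0::'r poly"] exI[of _ f]) auto
  next
    case False
    define m where "m = monom (lead_coeff f) (degree f - degree g)"
    define f1 where "f1 = smult (lead_coeff g) f - m * g"
    have m: "poly_over R m" unfolding m_def by (intro poly_over_monom poly_over_lead less.prems)
    have f1: "poly_over R f1" unfolding f1_def
      by (intro poly_over_diff poly_over_smult poly_over_mult poly_over_lead m less.prems assms)
    have "degree (m * g) \<le> degree f"
      using degree_mult_le[of m g] degree_monom_le[of "lead_coeff f" "degree f - degree g"] False
      unfolding m_def by linarith
    then have "degree f1 \<le> degree f"
      unfolding f1_def by (intro degree_diff_le) (auto intro: order_trans[OF degree_smult_le])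
    moreover have "coeff f1 (degree f) = 0"
      using False by (simp add: f1_def m_def coeff_monom_mult)
    ultimately have d: "degree f1 < degree f"
      using False assms(3)
      by (metis coeff_0 degree_0 leading_coeff_0_iff le_neq_implies_less not_less neq0_conv)
    from less.hyps[OF d f1] obtain k s r where IH: "poly_over R s" "poly_over R r"
      "smult (lead_coeff g ^ k) f1 = g * s + r" "degree r < degree g" "degree s \<le> degree f1 - degree g"
      by blast
    let ?s = "s + smult (lead_coeff g ^ k) m"
    have "smult (lead_coeff g ^ Suc k) f = smult (lead_coeff g ^ k) (f1 + m * g)"
      by (simp add: f1_def mult.commute)
    also have "\<dots> = g * ?s + r"
      using IH(3) by (simp add: smult_add_right algebra_simps)
    finally have 1: "smult (lead_coeff g ^ Suc k) f = g * ?s + r" .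
    have "degree (smult (lead_coeff g ^ k) m) \<le> degree f - degree g"
      unfolding m_def by (meson degree_monom_le degree_smult_le order_trans)
    then have 2: "degree ?s \<le> degree f - degree g"
      using IH(5) d by (intro degree_add_le) auto
    have 3: "poly_over R ?s" by (intro poly_over_add IH poly_over_smult power poly_over_lead m assms)
    show ?thesis using 1 2 3 IH by blast
  qed
qed

end

lemma hom_mod_zero: "hom_mod R Z \<phi> \<Longrightarrow> 0 \<in> R \<Longrightarrow> \<phi> 0 = 0"
  unfolding hom_mod_def by (metis add_cancel_right_right)

context ring_mod_prime
begin

lemma hom_0: "hom_mod R Z \<phi> \<Longrightarrow> \<phi> 0 = 0" using hom_mod_zero zero by blast
lemma hom_1: "hom_mod R Z \<phi> \<Longrightarrow> \<phi> 1 = 1" by (simp add: hom_mod_def)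
lemma hom_add: "hom_mod R Z \<phi> \<Longrightarrow> a \<in> R \<Longrightarrow> b \<in> R \<Longrightarrow> \<phi> (a + b) = \<phi> a + \<phi> b"
  by (simp add: hom_mod_def)
lemma hom_mult: "hom_mod R Z \<phi> \<Longrightarrow> a \<in> R \<Longrightarrow> b \<in> R \<Longrightarrow> \<phi> (a * b) = \<phi> a * \<phi> b"
  by (simp add: hom_mod_def)
lemma hom_diff: "hom_mod R Z \<phi> \<Longrightarrow> a \<in> R \<Longrightarrow> b \<in> R \<Longrightarrow> \<phi> (a - b) = \<phi> a - \<phi> b"
  using hom_add[of \<phi> "a - b" b] diff[of a b] by (simp add: eq_diff_eq)
lemma hom_Z: "hom_mod R Z \<phi> \<Longrightarrow> a \<in> R \<Longrightarrow> a \<in> Z \<Longrightarrow> \<phi> a = 0"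
  by (simp add: hom_mod_def)
lemma hom_power: "hom_mod R Z \<phi> \<Longrightarrow> a \<in> R \<Longrightarrow> \<phi> (a ^ n) = \<phi> a ^ n"
  by (induction n) (auto simp: hom_1 hom_mult power)
lemma hom_sum: "hom_mod R Z \<phi> \<Longrightarrow> (\<And>i. i \<in> I \<Longrightarrow> f i \<in> R) \<Longrightarrow> \<phi> (sum f I) = (\<Sum>i\<in>I. \<phi> (f i))"
  by (induction I rule: infinite_finite_induct) (auto simp: hom_0 hom_add sum)
lemma hom_of_nat: "hom_mod R Z \<phi> \<Longrightarrow> \<phi> (of_nat n) = of_nat n"
  by (induction n) (auto simp: hom_0 hom_1 hom_add one of_nat)

lemma map_add: "hom_mod R Z \<phi> \<Longrightarrow> poly_over R p \<Longrightarrow> poly_over R q \<Longrightarrow>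
    map_poly \<phi> (p + q) = map_poly \<phi> p + map_poly \<phi> q"
  by (rule poly_eqI) (simp add: coeff_map_poly hom_0 hom_add poly_over_def)
lemma map_diff: "hom_mod R Z \<phi> \<Longrightarrow> poly_over R p \<Longrightarrow> poly_over R q \<Longrightarrow>
    map_poly \<phi> (p - q) = map_poly \<phi> p - map_poly \<phi> q"
  by (rule poly_eqI) (simp add: coeff_map_poly hom_0 hom_diff poly_over_def)
lemma map_mult: "hom_mod R Z \<phi> \<Longrightarrow> poly_over R p \<Longrightarrow> poly_over R q \<Longrightarrow>
    map_poly \<phi> (p * q) = map_poly \<phi> p * map_poly \<phi> q"
  by (rule poly_eqI) (simp add: coeff_map_poly hom_0 coeff_mult hom_sum hom_mult poly_over_def mult)
lemma map_smult: "hom_mod R Z \<phi> \<Longrightarrow> a \<in> R \<Longrightarrow> poly_over R q \<Longrightarrow>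
    map_poly \<phi> (smult a q) = smult (\<phi> a) (map_poly \<phi> q)"
  by (rule poly_eqI) (simp add: coeff_map_poly hom_0 hom_mult poly_over_def)
lemma map_deriv: "hom_mod R Z \<phi> \<Longrightarrow> poly_over R q \<Longrightarrow>
    map_poly \<phi> (formal_deriv q) = pderiv (map_poly \<phi> q)"
  by (rule poly_eqI) (simp add: coeff_map_poly hom_0 coeff_pderiv coeff_formal_deriv hom_mult hom_of_nat
       poly_over_def of_nat del: of_nat_Suc)
lemma map_const: "hom_mod R Z \<phi> \<Longrightarrow> map_poly \<phi> [:a:] = [:\<phi> a:]"
  by (simp add: map_poly_pCons hom_0)

lemma map_Z: "hom_mod R Z \<phi> \<Longrightarrow> poly_over R q \<Longrightarrow> poly_over Z q \<Longrightarrow> map_poly \<phi> q = 0"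
  by (rule poly_eqI) (simp add: coeff_map_poly hom_0 hom_Z poly_over_def)

lemma adjoin_base: "a \<in> R \<Longrightarrow> a \<in> adjoin R x"
  unfolding adjoin_def by (intro CollectI exI[of _ "[:a:]"]) (simp add: poly_over_const)

lemma adjoin_gen: "x \<in> adjoin R x"
  unfolding adjoin_def by (intro CollectI exI[of _ "monom 1 1"]) (simp add: poly_over_monom one poly_monom)

lemma ring_mod_prime_adjoin: "ring_mod_prime (adjoin R x) Z"
proof
  fix a b assume "a \<in> adjoin R x" "b \<in> adjoin R x"
  then obtain p q where *: "a = poly p x" "b = poly q x" "poly_over R p" "poly_over R q"
    by (auto simp: adjoin_def)
  show "a + b \<in> adjoin R x" using * poly_over_add[of p q] unfolding adjoin_def
    by (intro CollectI exI[of _ "p + q"]) simp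
  show "a * b \<in> adjoin R x" using * poly_over_mult[of p q] unfolding adjoin_def
    by (intro CollectI exI[of _ "p * q"]) simp
qed (use Z0 Zadd Zmult Zprime Zchar adjoin_base one neg1 in auto)

text \<open>The universal property of R[x] modulo \<open>Z\<close>: \<open>x\<close> may be sent to
  \<open>t\<close> if \<open>t\<close> satisfies the image of every relation that \<open>x\<close>
  satisfies modulo \<open>Z\<close>. The value at an element is read off from a chosen polynomial,
  and two choices differ by such a relation.\<close>

lemma extend_hom:
  assumes \<phi>: "hom_mod R Z \<phi>"
    and t: "\<And>q. poly_over R q \<Longrightarrow> poly q x \<in> Z \<Longrightarrow> poly (map_poly \<phi> q) t = 0"
  shows "\<exists>\<psi>. hom_mod (adjoin R x) Z \<psi> \<and> (\<forall>a\<in>R. \<psi> a = \<phi> a) \<and>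
    (\<forall>q. poly_over R q \<longrightarrow> \<psi> (poly q x) = poly (map_poly \<phi> q) t)"
proof -
  define \<psi> where "\<psi> y = poly (map_poly \<phi> (SOME p. poly_over R p \<and> poly p x = y)) t" for y
  have *: "\<psi> (poly q x) = poly (map_poly \<phi> q) t" if q: "poly_over R q" for q
  proof -
    define p where "p = (SOME p. poly_over R p \<and> poly p x = poly q x)"
    have p: "poly_over R p \<and> poly p x = poly q x"
      unfolding p_def by (rule someI[of _ q]) (simp add: q)
    have "poly (map_poly \<phi> (p - q)) t = 0"
      using p q by (intro t poly_over_diff) (auto simp: Z0)
    then show ?thesis using p q \<phi> by (simp add: map_diff \<psi>_def flip: p_def)
  qed
  have base: "\<psi> a = \<phi> a" if "a \<in> R" for a
    using *[OF poly_over_const[OF that]] \<phi> by (simp add: map_const)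
  moreover have "hom_mod (adjoin R x) Z \<psi>"
    unfolding hom_mod_def
  proof (intro conjI ballI)
    show "\<psi> 1 = 1" using base[OF one] hom_1[OF \<phi>] by simp
  next
    fix a b assume "a \<in> adjoin R x" "b \<in> adjoin R x"
    then obtain p q where pq: "a = poly p x" "b = poly q x" "poly_over R p" "poly_over R q"
      by (auto simp: adjoin_def)
    show "\<psi> (a + b) = \<psi> a + \<psi> b"
      using *[OF poly_over_add[OF pq(3,4)]] * pq \<phi> by (simp add: map_add)
    show "\<psi> (a * b) = \<psi> a * \<psi> b"
      using *[OF poly_over_mult[OF pq(3,4)]] * pq \<phi> by (simp add: map_mult)
  next
    fix a assume "a \<in> adjoin R x \<inter> Z"
    then show "\<psi> a = 0" using * t by (auto simp: adjoin_def)
  qed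
  ultimately show ?thesis using * by blast
qed

end

lemma hom_mod_re: "hom_mod R Z \<phi> \<Longrightarrow> hom_mod R Z (\<lambda>a. dual_re (\<phi> a))"
  by (simp add: hom_mod_def)

lemma exists_nonroot:
  fixes p :: "'k::{idom,ring_char_0} poly"
  assumes "p \<noteq> 0" obtains t where "poly p t \<noteq> 0"
  using poly_all_0_iff_0 assms by blast

context ring_mod_prime
begin

text \<open>A specialisation of \<open>R\<close> modulo \<open>Z\<close> to the dual numbers extends to one of \<open>R[x]\<close> off a
  proper closed set. If \<open>x\<close> is algebraic, the image of \<open>x\<close> is a root modulo \<open>\<epsilon>\<close> of the minimal
  polynomial \<open>p\<close>, corrected by one Newton step; this is possible because \<open>p'(x)\<close> is not in \<open>Z\<close>.\<close>

lemma extend_specialisation: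
  fixes x b :: 'r
  assumes b: "b \<in> adjoin R x" "b \<notin> Z"
  shows "\<exists>a\<in>R - Z. \<forall>\<phi> :: 'r \<Rightarrow> 'k::{alg_closed_field, field_char_0} dual.
    hom_mod R Z \<phi> \<and> dual_re (\<phi> a) \<noteq> 0 \<longrightarrow>
    (\<exists>\<psi>. hom_mod (adjoin R x) Z \<psi> \<and> (\<forall>a\<in>R. \<psi> a = \<phi> a) \<and> dual_re (\<psi> b) \<noteq> 0)"
proof (cases "\<exists>p. poly_over R p \<and> \<not> poly_over Z p \<and> poly p x \<in> Z")
  case False
  \<comment> \<open>Here \<open>x\<close> is transcendental modulo \<open>Z\<close> and may be sent
    to any value. A coefficient of \<open>q\<close> outside \<open>Z\<close> serves as
    \<open>a\<close>: if it survives, the image of \<open>q\<close> is a nonzero polynomial and has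
    a non-root.\<close>
  obtain q where q: "poly_over R q" "b = poly q x" using b by (auto simp: adjoin_def)
  then have "\<not> poly_over Z q" using b poly_over_Z_poly by blast
  then obtain i where i: "coeff q i \<notin> Z" by (auto simp: poly_over_def)
  show ?thesis
  proof (intro bexI[of _ "coeff q i"] allI impI)
    show "coeff q i \<in> R - Z" using i q by (simp add: poly_over_def)
    fix \<phi> :: "'r \<Rightarrow> 'k dual" assume "hom_mod R Z \<phi> \<and> dual_re (\<phi> (coeff q i)) \<noteq> 0"
    then have \<phi>: "hom_mod R Z \<phi>" and i: "dual_re (\<phi> (coeff q i)) \<noteq> 0" by auto
    have "coeff (map_poly dual_re (map_poly \<phi> q)) i \<noteq> 0"
      using i by (simp add: coeff_map_poly hom_0[OF \<phi>])
    then obtain t where t: "poly (map_poly dual_re (map_poly \<phi> q)) t \<noteq> 0"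
      by (metis coeff_0 exists_nonroot)
    obtain \<psi> where \<psi>: "hom_mod (adjoin R x) Z \<psi>" "\<forall>a\<in>R. \<psi> a = \<phi> a"
        "\<forall>q. poly_over R q \<longrightarrow> \<psi> (poly q x) = poly (map_poly \<phi> q) (Dual t 0)"
      using extend_hom[OF \<phi>, of x "Dual t 0"] map_Z[OF \<phi>] False by force
    then have "dual_re (\<psi> b) \<noteq> 0" using t q by (simp add: poly_dual)
    with \<psi> show "\<exists>\<psi>. hom_mod (adjoin R x) Z \<psi> \<and> (\<forall>a\<in>R. \<psi> a = \<phi> a) \<and> dual_re (\<psi> b) \<noteq> 0"
      by blast
  qed
next
  case True
  define P where "P p \<longleftrightarrow> poly_over R p \<and> \<not> poly_over Z p \<and> poly p x \<in> Z" for p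
  obtain p where p: "P p" and min: "\<And>q. P q \<Longrightarrow> degree p \<le> degree q"
    using True ex_has_least_nat[of P _ degree] unfolding P_def by blast
  have pR: "poly_over R p" and pZ: "\<not> poly_over Z p" and px: "poly p x \<in> Z"
    using p by (auto simp: P_def)
  have small: "poly_over Z q" if "poly_over R q" "poly q x \<in> Z" "degree q < degree p" for q
    using min[of q] that by (auto simp: P_def)
  define c where "c = lead_coeff p"
  have drop_lead: "\<exists>q'. poly_over R q' \<and> poly q' x - poly q x \<in> Z \<and> degree q' < degree q"
    if q: "poly_over R q" "lead_coeff q \<in> Z" "degree q > 0" for q
  proof (intro exI conjI)
    let ?q = "q - monom (lead_coeff q) (degree q)"
    show "poly_over R ?q" by (intro poly_over_diff poly_over_monom poly_over_lead q)
    show "poly ?q x - poly q x \<in> Z" using q by (simp add: poly_monom Zmult' Zminus)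
    have "degree ?q \<le> degree q" by (intro degree_diff_le) (auto simp: degree_monom_le)
    moreover have "coeff ?q (degree q) = 0" by simp
    ultimately show "degree ?q < degree q"
      using q(3) by (metis degree_0 le_neq_implies_less leading_coeff_0_iff)
  qed
  have cR: "c \<in> R" unfolding c_def by (rule poly_over_lead[OF pR])
  have dp: "degree p > 0"
  proof (rule ccontr)
    assume "\<not> degree p > 0"
    then obtain a where "p = [:a:]" by (metis degree_eq_zeroE not_gr_zero)
    moreover from this have "coeff p i \<in> Z" for i using px by (cases i) (auto simp: Z0)
    ultimately show False using pZ by (simp add: poly_over_def)
  qed
  \<comment> \<open>Otherwise dropping the leading term leaves a relation of smaller degree, which
    has all coefficients in \<open>Z\<close>; then so has \<open>p\<close>.\<close>
  have cZ: "c \<notin> Z"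
  proof
    assume "c \<in> Z"
    let ?q = "p - monom c (degree p)"
    have q: "poly_over R ?q" by (intro poly_over_diff poly_over_monom pR cR)
    have "degree ?q \<le> degree p" by (intro degree_diff_le) (auto simp: degree_monom_le)
    moreover have "coeff ?q (degree p) = 0" by (simp add: c_def)
    ultimately have "degree ?q < degree p"
      using dp by (metis degree_0 le_neq_implies_less leading_coeff_0_iff)
    moreover have "poly ?q x \<in> Z" using px \<open>c \<in> Z\<close> by (simp add: poly_monom Zmult' Zdiff)
    ultimately have "poly_over Z ?q" using small q by blast
    moreover have "poly_over Z (monom c (degree p))" using \<open>c \<in> Z\<close> by (simp add: poly_over_def Z0)
    ultimately have "poly_over Z (?q + monom c (degree p))" by (rule poly_over_Z_add)
    then show False using pZ by simp
  qed
  \<comment> \<open>Up to a power of \<open>c\<close>, every relation of \<open>x\<close> is a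
    multiple of \<open>p\<close> modulo \<open>Z\<close>. So a root of the image of \<open>p\<close>
    satisfies the images of all relations once the image of \<open>c\<close> is a unit.\<close>
  have divis: "\<exists>k s. poly_over R s \<and> poly_over R (smult (c ^ k) q - p * s) \<and> poly_over Z (smult (c ^ k) q - p * s)"
    if q: "poly_over R q" "poly q x \<in> Z" for q
  proof -
    obtain k s r where *: "poly_over R s" "poly_over R r" "smult (c ^ k) q = p * s + r"
        "degree r < degree p"
      using pseudo_division[OF q(1) pR dp] unfolding c_def by blast
    have "poly r x = c ^ k * poly q x - poly p x * poly s x"
      using arg_cong[OF *(3), of "\<lambda>p. poly p x"] by (simp add: algebra_simps)
    then have "poly r x \<in> Z" using q px by (auto intro: Zdiff Zmult Zmult')
    then have "poly_over Z r" using small * by blast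
    moreover have "smult (c ^ k) q - p * s = r" using *(3) by simp
    ultimately show ?thesis using * by metis
  qed
  \<comment> \<open>The target ring is left general because this is applied over the field, to find
    the root, and over the dual numbers, to lift it.\<close>
  have ev_Z: "dd ^ k * poly (map_poly \<phi> q) t = 0"
    if "hom_mod R Z \<phi>" "poly_over R q" "poly_over R s"
      "poly_over R (smult (c ^ k) q - p * s)" "poly_over Z (smult (c ^ k) q - p * s)"
      "poly (map_poly \<phi> p) t = 0" "dd = \<phi> c"
    for \<phi> :: "'r \<Rightarrow> 'd::comm_ring_1" and t k s q dd
  proof -
    have "map_poly \<phi> (smult (c ^ k) q - p * s) = 0" using that by (intro map_Z)
    then have "smult (\<phi> c ^ k) (map_poly \<phi> q) = map_poly \<phi> p * map_poly \<phi> s"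
      using that cR pR by (simp add: map_diff map_mult map_smult poly_over_smult poly_over_mult power hom_power)
    from arg_cong[OF this, of "\<lambda>p. poly p t"] show ?thesis using that by simp
  qed
  \<comment> \<open>The derivative has smaller degree than \<open>p\<close>, and its top
    coefficient, \<open>degree p\<close> times \<open>c\<close>, is not in \<open>Z\<close> by
    \<open>Zchar\<close>.\<close>
  have p': "poly (formal_deriv p) x \<notin> Z"
  proof
    assume *: "poly (formal_deriv p) x \<in> Z"
    have "degree (formal_deriv p) < degree p"
    proof -
      have "degree (formal_deriv p) \<le> degree p - 1"
        by (rule degree_le) (auto simp: coeff_formal_deriv coeff_eq_0)
      then show ?thesis using dp by simp
    qed
    then have "poly_over Z (formal_deriv p)" using small * poly_over_deriv[OF pR] by blast
    then have "coeff (formal_deriv p) (degree p - 1) \<in> Z" by (simp add: poly_over_def)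
    moreover have "coeff (formal_deriv p) (degree p - 1) = of_nat (degree p) * c"
      using dp by (simp add: coeff_formal_deriv c_def)
    ultimately show False using Zprime[of "of_nat (degree p)" c] Zchar[OF dp] cZ by auto
  qed
  obtain q where q: "poly_over R q" "b = poly q x" using b by (auto simp: adjoin_def)
  define y where "y = b * poly (formal_deriv p) x"
  have yZ: "y \<notin> Z" unfolding y_def using Zprime b p' by blast
  text \<open>Since \<open>p\<close> is irreducible over the field of fractions, \<open>y\<close> divides some \<open>a \<in> R - Z\<close>.\<close>
  define H where "H h \<longleftrightarrow> poly_over R h \<and> poly h x \<notin> Z \<and> degree h < degree p \<and>
      (\<exists>u. poly_over R u \<and> poly h x - poly u x * y \<in> Z)" for h
  have "\<exists>h. H h"
  proof -
    have yR: "poly_over R (q * formal_deriv p)" by (intro poly_over_mult q poly_over_deriv pR)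
    obtain k s r where *: "poly_over R s" "poly_over R r" "smult (c ^ k) (q * formal_deriv p) = p * s + r"
        "degree r < degree p"
      using pseudo_division[OF yR pR dp] unfolding c_def by blast
    have r: "poly r x = c ^ k * y - poly p x * poly s x"
      using arg_cong[OF *(3), of "\<lambda>p. poly p x"] by (simp add: algebra_simps y_def q)
    then have r': "poly r x - c ^ k * y \<in> Z" using px by (auto intro: Zminus Zmult')
    have "c ^ k * y \<notin> Z" using Zprime Zpower cZ yZ by blast
    then have "poly r x \<notin> Z" using Zdiff_iff[OF r'] by simp
    moreover have "poly r x - poly [:c ^ k:] x * y \<in> Z" using r' by simp
    ultimately show ?thesis unfolding H_def using * poly_over_const[OF power[OF cR]] by blast
  qed
  then obtain h where h: "H h" and hmin: "\<And>g. H g \<Longrightarrow> degree h \<le> degree g"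
    using ex_has_least_nat[of H _ degree] by blast
  have hR: "poly_over R h" and hZ: "poly h x \<notin> Z" and hp: "degree h < degree p"
    using h by (auto simp: H_def)
  obtain u where u: "poly_over R u" "poly h x - poly u x * y \<in> Z" using h by (auto simp: H_def)
  \<comment> \<open>Euclid's algorithm: the remainder of \<open>p\<close> by \<open>h\<close> is
    again a multiple of \<open>y\<close> modulo \<open>Z\<close>, so by minimality it has
    coefficients in \<open>Z\<close>. Then \<open>h\<close> times \<open>s\<close> vanishes at
    \<open>x\<close> modulo \<open>Z\<close>, which forces the coefficients of \<open>s\<close>, and
    finally a power of \<open>d\<close> times \<open>c\<close>, into \<open>Z\<close>.\<close>
  have dh: "degree h = 0"
  proof (rule ccontr)
    assume "degree h \<noteq> 0"
    then have dh: "degree h > 0" by simp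
    define d where "d = lead_coeff h"
    have dZ: "d \<notin> Z"
    proof
      assume "d \<in> Z"
      then obtain h' where h': "poly_over R h'" "poly h' x - poly h x \<in> Z" "degree h' < degree h"
        using drop_lead[OF hR] dh unfolding d_def by blast
      have "poly h' x - poly u x * y \<in> Z" using Zadd[OF h'(2) u(2)] by simp
      then have "H h'" unfolding H_def using h' hp hZ u Zdiff_iff[OF h'(2)] by auto
      then show False using hmin[of h'] h' by simp
    qed
    obtain k s r where *: "poly_over R s" "poly_over R r" "smult (d ^ k) p = h * s + r"
        "degree r < degree h" "degree s \<le> degree p - degree h"
      using pseudo_division[OF pR hR dh] unfolding d_def by blast
    have r: "poly r x = d ^ k * poly p x - poly h x * poly s x"
      using arg_cong[OF *(3), of "\<lambda>p. poly p x"] by (simp add: algebra_simps)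
    have rZ: "poly r x \<in> Z"
    proof (rule ccontr)
      assume "poly r x \<notin> Z"
      moreover have "poly r x - poly (- u * s) x * y \<in> Z"
      proof -
        have "poly r x - poly (- u * s) x * y = d ^ k * poly p x - (poly h x - poly u x * y) * poly s x"
          by (simp add: r algebra_simps)
        then show ?thesis using px u by (auto intro: Zdiff Zmult Zmult')
      qed
      moreover have "poly_over R (- u * s)"
        using poly_over_mult[OF poly_over_diff[OF poly_over_0 u(1)] *(1)] by simp
      ultimately have "H r" unfolding H_def using * hp by (metis less_trans)
      then show False using hmin[of r] * by simp
    qed
    then have r0: "poly_over Z r" using small[OF *(2)] * hp by simp
    have "poly h x * poly s x = d ^ k * poly p x - poly r x" using r by simp
    then have "poly h x * poly s x \<in> Z" using rZ px by (auto intro: Zdiff Zmult)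
    then have "poly s x \<in> Z" using Zprime hZ by blast
    then have "poly_over Z s" using small[OF *(1)] * dh hp by simp
    then have "poly_over Z (smult (d ^ k) p)" unfolding *(3) using r0 by (intro poly_over_Z_add poly_over_Z_mult)
    then have "coeff (smult (d ^ k) p) (degree p) \<in> Z" by (simp add: poly_over_def)
    then have "d ^ k * c \<in> Z" by (simp add: c_def)
    then show False using Zprime Zpower dZ cZ by blast
  qed
  then obtain a where a: "h = [:a:]" by (metis degree_eq_zeroE)
  have aR: "a \<in> R" using poly_over_lead[OF hR] dh a by simp
  have aZ: "a \<notin> Z" using hZ a by simp
  \<comment> \<open>The relation a = u(x) q(x) p'(x), read as a polynomial relation of
    \<open>x\<close>. At a root of the image of \<open>p\<close> it shows that the images of
    \<open>q\<close> and of the derivative are nonzero there.\<close>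
  define Q where "Q = [:a:] - u * (q * formal_deriv p)"
  have QR: "poly_over R Q" unfolding Q_def
    by (intro poly_over_diff poly_over_const aR poly_over_mult poly_over_deriv u q pR)
  have "poly Q x \<in> Z" using u(2) by (simp add: Q_def a y_def q algebra_simps)
  then obtain k s where ks: "poly_over R s" "poly_over R (smult (c ^ k) Q - p * s)"
      "poly_over Z (smult (c ^ k) Q - p * s)"
    using divis[OF QR] by blast
  \<comment> \<open>The factor \<open>c\<close> keeps the image of \<open>p\<close> nonconstant, so
    that it has a root; the factor \<open>a\<close> keeps \<open>b\<close> and the derivative of
    \<open>p\<close> nonzero at this root.\<close>
  show ?thesis
  proof (intro bexI[of _ "a * c"] allI impI)
    show "a * c \<in> R - Z" using aR aZ cR cZ mult Zprime by blast
    fix \<phi> :: "'r \<Rightarrow> 'k dual" assume as: "hom_mod R Z \<phi> \<and> dual_re (\<phi> (a * c)) \<noteq> 0"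
    then have \<phi>: "hom_mod R Z \<phi>" by simp
    have ac: "dual_re (\<phi> a) \<noteq> 0" "dual_re (\<phi> c) \<noteq> 0"
      using as hom_mult[OF \<phi> aR cR] by auto
    define \<rho> where "\<rho> a = dual_re (\<phi> a)" for a
    have \<rho>: "hom_mod R Z \<rho>" unfolding \<rho>_def by (rule hom_mod_re[OF \<phi>])
    have map_\<rho>: "map_poly dual_re (map_poly \<phi> f) = map_poly \<rho> f" for f
      by (rule poly_eqI) (simp add: coeff_map_poly hom_0[OF \<phi>] hom_0[OF \<rho>] \<rho>_def)
    have "coeff (map_poly \<rho> p) (degree p) \<noteq> 0"
      using ac(2) by (simp add: coeff_map_poly hom_0[OF \<phi>] \<rho>_def c_def)
    then have "degree (map_poly \<rho> p) > 0" using dp le_degree by (metis le_zero_eq not_gr_zero)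
    then obtain t where t: "poly (map_poly \<rho> p) t = 0"
      using alg_closed_imp_poly_has_root by blast
    have "\<rho> c ^ k * poly (map_poly \<rho> Q) t = 0"
      using ev_Z[OF \<rho> QR ks t] by simp
    then have "poly (map_poly \<rho> Q) t = 0" using ac by (simp add: \<rho>_def)
    moreover have "map_poly \<rho> Q = [:\<rho> a:] - map_poly \<rho> u * (map_poly \<rho> q * pderiv (map_poly \<rho> p))"
      unfolding Q_def using u q aR pR
      by (simp add: map_diff[OF \<rho>] map_mult[OF \<rho>] map_const[OF \<rho>] map_deriv[OF \<rho>]
          poly_over_const poly_over_mult poly_over_deriv)
    ultimately have eq: "\<rho> a = poly (map_poly \<rho> u) t * (poly (map_poly \<rho> q) t * poly (pderiv (map_poly \<rho> p)) t)"
      by simp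
    have nz: "poly (map_poly \<rho> q) t \<noteq> 0" "poly (pderiv (map_poly \<rho> p)) t \<noteq> 0"
      using eq ac(1) by (auto simp: \<rho>_def)
    define \<tau> where "\<tau> = Dual t (- poly (map_poly dual_eps (map_poly \<phi> p)) t / poly (pderiv (map_poly \<rho> p)) t)"
    have root: "poly (map_poly \<phi> p) \<tau> = 0"
      unfolding \<tau>_def poly_dual map_\<rho> using t nz by (simp add: zero_dual_def)
    have "poly (map_poly \<phi> q) \<tau> = 0" if q: "poly_over R q" "poly q x \<in> Z" for q
    proof -
      obtain k s where ks: "poly_over R s" "poly_over R (smult (c ^ k) q - p * s)"
          "poly_over Z (smult (c ^ k) q - p * s)"
        using divis[OF q] by blast
      have "\<phi> (c ^ k) * poly (map_poly \<phi> q) \<tau> = 0"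
        using ev_Z[OF \<phi> q(1) ks root] hom_power[OF \<phi> cR] by simp
      moreover have "dual_re (\<phi> (c ^ k)) \<noteq> 0"
        using hom_power[OF \<rho> cR, of k] ac(2) by (simp add: \<rho>_def)
      ultimately show ?thesis by (rule dual_mult_eq_0)
    qed
    from extend_hom[OF \<phi> this] obtain \<psi> where \<psi>: "hom_mod (adjoin R x) Z \<psi>" "\<forall>a\<in>R. \<psi> a = \<phi> a"
        "\<forall>q. poly_over R q \<longrightarrow> \<psi> (poly q x) = poly (map_poly \<phi> q) \<tau>" by blast
    then have "dual_re (\<psi> b) \<noteq> 0" using q nz by (simp add: \<tau>_def poly_dual map_\<rho>)
    then show "\<exists>\<psi>. hom_mod (adjoin R x) Z \<psi> \<and> (\<forall>a\<in>R. \<psi> a = \<phi> a) \<and> dual_re (\<psi> b) \<noteq> 0"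
      using \<psi> by blast
  qed
qed

end

text \<open>The element \<open>a\<close> obtained for the later generators takes the place of
  \<open>b\<close> when the first one is adjoined.\<close>

lemma extend_specialisation_list:
  fixes R Z :: "'r::comm_ring_1 set"
  assumes "ring_mod_prime R Z" "b \<in> fold (\<lambda>x R. adjoin R x) xs R" "b \<notin> Z"
  shows "\<exists>a\<in>R - Z. \<forall>\<phi> :: 'r \<Rightarrow> 'k::{alg_closed_field, field_char_0} dual.
    hom_mod R Z \<phi> \<and> dual_re (\<phi> a) \<noteq> 0 \<longrightarrow>
    (\<exists>\<psi>. hom_mod (fold (\<lambda>x R. adjoin R x) xs R) Z \<psi> \<and> (\<forall>a\<in>R. \<psi> a = \<phi> a) \<and> dual_re (\<psi> b) \<noteq> 0)"
  using assms
proof (induction xs arbitrary: R)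
  case Nil
  then show ?case by force
next
  case (Cons x xs)
  interpret ring_mod_prime R Z by fact
  from Cons.IH[OF ring_mod_prime_adjoin] Cons.prems obtain a where a: "a \<in> adjoin R x - Z"
    "\<forall>\<phi> :: 'r \<Rightarrow> 'k dual. hom_mod (adjoin R x) Z \<phi> \<and> dual_re (\<phi> a) \<noteq> 0 \<longrightarrow>
    (\<exists>\<psi>. hom_mod (fold (\<lambda>x R. adjoin R x) xs (adjoin R x)) Z \<psi> \<and> (\<forall>a\<in>adjoin R x. \<psi> a = \<phi> a) \<and> dual_re (\<psi> b) \<noteq> 0)"
    by (metis fold_simps(2))
  obtain a' where a': "a' \<in> R - Z" "\<forall>\<phi> :: 'r \<Rightarrow> 'k dual.
    hom_mod R Z \<phi> \<and> dual_re (\<phi> a') \<noteq> 0 \<longrightarrow>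
    (\<exists>\<psi>. hom_mod (adjoin R x) Z \<psi> \<and> (\<forall>a\<in>R. \<psi> a = \<phi> a) \<and> dual_re (\<psi> a) \<noteq> 0)"
    using extend_specialisation[of a x] a(1) by blast
  show ?case
  proof (intro bexI[OF _ a'(1)] allI impI)
    fix \<phi> :: "'r \<Rightarrow> 'k dual" assume "hom_mod R Z \<phi> \<and> dual_re (\<phi> a') \<noteq> 0"
    then obtain \<psi> where \<psi>: "hom_mod (adjoin R x) Z \<psi>" "\<forall>a\<in>R. \<psi> a = \<phi> a" "dual_re (\<psi> a) \<noteq> 0"
      using a'(2) by blast
    then obtain \<theta> where "hom_mod (fold (\<lambda>x R. adjoin R x) xs (adjoin R x)) Z \<theta>"
      "\<forall>a\<in>adjoin R x. \<theta> a = \<psi> a" "dual_re (\<theta> b) \<noteq> 0"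
      using a(2) by blast
    then show "\<exists>\<psi>. hom_mod (fold (\<lambda>x R. adjoin R x) (x # xs) R) Z \<psi> \<and> (\<forall>a\<in>R. \<psi> a = \<phi> a) \<and> dual_re (\<psi> b) \<noteq> 0"
      using \<psi> adjoin_base by (intro exI[of _ \<theta>]) auto
  qed
qed

lemma fold_adjoin:
  assumes "ring_mod_prime R Z"
  shows "ring_mod_prime (fold (\<lambda>x R. adjoin R x) xs R) Z \<and> R \<subseteq> fold (\<lambda>x R. adjoin R x) xs R \<and>
    set xs \<subseteq> fold (\<lambda>x R. adjoin R x) xs R"
  using assms
proof (induction xs arbitrary: R)
  case (Cons x xs)
  interpret ring_mod_prime R Z by fact
  show ?case using Cons.IH[OF ring_mod_prime_adjoin[of x]] adjoin_base adjoin_gen[of x] by auto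
qed simp

section \<open>Alternating forms\<close>

text \<open>The symplectic basis is ordered as \<open>e\<^sub>0, f\<^sub>0, e\<^sub>1, f\<^sub>1, \<dots>\<close>.\<close>

definition symplectic_gram :: "nat \<Rightarrow> nat \<Rightarrow> int" where
  "symplectic_gram i j = (if i div 2 = j div 2 then int (j mod 2) - int (i mod 2) else 0)"

text \<open>A nonzero product means that \<sigma> maps each pair of positions onto a pair e, f of
  the basis. Such a \<sigma> arises from permuting the pairs, which is even, and from exchanging the
  members of a pair, which reverses both the sign of \<sigma> and one factor. The induction undoes
  this for the last pair.\<close>

lemma symplectic_gram_term:
  assumes "\<sigma> permutes {..<2 * m}"
    and "(\<Prod>i<m. symplectic_gram (\<sigma> (2 * i)) (\<sigma> (Suc (2 * i)))) \<noteq> 0"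
  shows "sign \<sigma> * (\<Prod>i<m. symplectic_gram (\<sigma> (2 * i)) (\<sigma> (Suc (2 * i)))) = 1"
  using assms
proof (induction m arbitrary: \<sigma>)
  case 0
  then show ?case by simp
next
  case (Suc m)
  let ?G = symplectic_gram
  let ?N = "{..<2 * Suc m}"
  have perm: "permutation p" if "p permutes ?N" for p using that permutes_imp_permutation by blast
  define j where "j = \<sigma> (2 * m) div 2"
  have nz: "?G (\<sigma> (2 * m)) (\<sigma> (Suc (2 * m))) \<noteq> 0" using Suc.prems(2) by simp
  then have div: "\<sigma> (Suc (2 * m)) div 2 = j"
    by (auto simp: symplectic_gram_def j_def split: if_splits)
  have "\<sigma> (2 * m) \<in> ?N" using permutes_in_image[OF Suc.prems(1)] by simp
  then have jm: "j \<le> m" by (simp add: j_def)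
  \<comment> \<open>Interchanges the pairs number \<open>j\<close> and \<open>m\<close>. It is a
    product of two transpositions, hence even, and it preserves the Gram matrix.\<close>
  define t where "t u = 2 * Transposition.transpose j m (u div 2) + u mod 2" for u
  have t_eq: "t = Transposition.transpose (2 * j) (2 * m) \<circ> Transposition.transpose (Suc (2 * j)) (Suc (2 * m))"
  proof
    fix u
    have ne: "2 * a \<noteq> Suc (2 * b)" "Suc (2 * b) \<noteq> 2 * a" for a b :: nat by presburger+
    have "\<exists>v. u = 2 * v \<or> u = Suc (2 * v)" by presburger
    then obtain v where "u = 2 * v \<or> u = Suc (2 * v)" ..
    then show "t u = (Transposition.transpose (2 * j) (2 * m) \<circ> Transposition.transpose (Suc (2 * j)) (Suc (2 * m))) u"
      by (elim disjE) (simp_all add: t_def Transposition.transpose_def ne)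
  qed
  have t_perm: "t permutes ?N"
    unfolding t_eq using jm by (intro permutes_compose permutes_swap_id) auto
  have t_sign: "sign t = 1"
    unfolding t_eq by (subst sign_compose) (auto simp: sign_swap_id permutation_swap_id)
  have t_G: "?G (t u) (t v) = ?G u v" for u v
  proof -
    have "t u div 2 = Transposition.transpose j m (u div 2)" "t u mod 2 = u mod 2" for u
      by (simp_all add: t_def)
    moreover have "Transposition.transpose j m a = Transposition.transpose j m b \<longleftrightarrow> a = b" for a b
      by (metis transpose_involutory)
    ultimately show ?thesis by (simp add: symplectic_gram_def)
  qed
  define \<sigma>1 where "\<sigma>1 = t \<circ> \<sigma>"
  have \<sigma>1: "\<sigma>1 permutes ?N" unfolding \<sigma>1_def by (intro permutes_compose Suc.prems t_perm)
  have s1: "sign \<sigma>1 = sign \<sigma>"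
    unfolding \<sigma>1_def by (subst sign_compose) (auto intro: perm t_perm Suc.prems simp: t_sign)
  have G1: "?G (\<sigma>1 u) (\<sigma>1 v) = ?G (\<sigma> u) (\<sigma> v)" for u v by (simp add: \<sigma>1_def t_G)
  have half: "a = 2 * m \<or> a = Suc (2 * m)" if "a div 2 = m" for a :: nat
    using that by presburger
  have "\<sigma>1 (2 * m) div 2 = m" by (simp add: \<sigma>1_def t_def flip: j_def)
  note 1 = half[OF this]
  have "\<sigma>1 (Suc (2 * m)) div 2 = m" by (simp add: \<sigma>1_def t_def div)
  note 2 = half[OF this]
  have "\<sigma>1 (2 * m) \<noteq> \<sigma>1 (Suc (2 * m))"
    using permutes_inj[OF \<sigma>1] by (simp add: inj_eq)
  with 1 2 have "\<sigma>1 (2 * m) = 2 * m \<and> \<sigma>1 (Suc (2 * m)) = Suc (2 * m) \<or>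
      \<sigma>1 (2 * m) = Suc (2 * m) \<and> \<sigma>1 (Suc (2 * m)) = 2 * m"
    by (elim disjE) simp_all
  then consider "\<sigma>1 (2 * m) = 2 * m" "\<sigma>1 (Suc (2 * m)) = Suc (2 * m)"
    | "\<sigma>1 (2 * m) = Suc (2 * m)" "\<sigma>1 (Suc (2 * m)) = 2 * m"
    by (elim disjE conjE)
  then show ?case
  proof cases
    case 1
    have p: "\<sigma>1 permutes {..<2 * m}"
    proof (rule permutes_superset[OF \<sigma>1])
      fix x assume "x \<in> ?N - {..<2 * m}"
      then have "x = 2 * m \<or> x = Suc (2 * m)" by auto
      then show "\<sigma>1 x = x" using 1 by (elim disjE) simp_all
    qed
    have "?G (\<sigma>1 (2 * m)) (\<sigma>1 (Suc (2 * m))) = 1" unfolding 1 by (simp add: symplectic_gram_def)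
    then show ?thesis using Suc.IH[OF p] Suc.prems(2) by (simp add: G1 s1)
  next
    case 2
    define \<sigma>2 where "\<sigma>2 = \<sigma>1 \<circ> Transposition.transpose (2 * m) (Suc (2 * m))"
    have tp: "Transposition.transpose (2 * m) (Suc (2 * m)) permutes ?N" by (intro permutes_swap_id) auto
    have \<sigma>2: "\<sigma>2 permutes ?N" unfolding \<sigma>2_def by (intro permutes_compose \<sigma>1 tp)
    have p: "\<sigma>2 permutes {..<2 * m}"
    proof (rule permutes_superset[OF \<sigma>2])
      fix x assume "x \<in> ?N - {..<2 * m}"
      then have "x = 2 * m \<or> x = Suc (2 * m)" by auto
      then show "\<sigma>2 x = x" using 2 by (elim disjE) (simp_all add: \<sigma>2_def)
    qed
    have s2: "sign \<sigma>2 = - sign \<sigma>"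
      unfolding \<sigma>2_def by (subst sign_compose) (auto simp: sign_swap_id s1 intro: perm \<sigma>1 tp)
    have "Transposition.transpose (2 * m) (Suc (2 * m)) i = i" if "i < 2 * m" for i
      using that by (auto simp: Transposition.transpose_def)
    then have "(\<Prod>i<m. ?G (\<sigma>2 (2 * i)) (\<sigma>2 (Suc (2 * i)))) = (\<Prod>i<m. ?G (\<sigma> (2 * i)) (\<sigma> (Suc (2 * i))))"
      by (intro prod.cong) (auto simp: \<sigma>2_def G1)
    moreover have "?G (\<sigma>1 (2 * m)) (\<sigma>1 (Suc (2 * m))) = -1"
      unfolding 2 by (simp add: symplectic_gram_def)
    ultimately show ?thesis using Suc.IH[OF p] Suc.prems(2) by (simp add: G1 s2)
  qed
qed

text \<open>No cancellation can occur: every nonzero term is 1, and the identity gives one.\<close>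

lemma symplectic_gram_sum:
  "(\<Sum>\<sigma> | \<sigma> permutes {..<2 * m}. sign \<sigma> * (\<Prod>i<m. symplectic_gram (\<sigma> (2 * i)) (\<sigma> (Suc (2 * i))))) > 0"
proof (rule sum_pos2[of _ id])
  show "finite {\<sigma>. \<sigma> permutes {..<2 * m}}" by (intro finite_permutations) simp
  show "id \<in> {\<sigma>. \<sigma> permutes {..<2 * m}}" by (simp add: permutes_id)
  show "0 < sign id * (\<Prod>i<m. symplectic_gram (id (2 * i)) (id (Suc (2 * i))))"
    by (simp add: symplectic_gram_def)
  show "0 \<le> sign \<sigma> * (\<Prod>i<m. symplectic_gram (\<sigma> (2 * i)) (\<sigma> (Suc (2 * i))))"
    if "\<sigma> \<in> {\<sigma>. \<sigma> permutes {..<2 * m}}" for \<sigma>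
  proof (cases "(\<Prod>i<m. symplectic_gram (\<sigma> (2 * i)) (\<sigma> (Suc (2 * i)))) = 0")
    case True
    then show ?thesis by (simp only: mult_zero_right)
  next
    case False
    then have "sign \<sigma> * (\<Prod>i<m. symplectic_gram (\<sigma> (2 * i)) (\<sigma> (Suc (2 * i)))) = 1"
      using that by (intro symplectic_gram_term) auto
    then show ?thesis by (simp only: zero_le_one)
  qed
qed

text \<open>The inner antisymmetrisation is absorbed by the outer one: after replacing \<sigma> by
  the composition of \<sigma> and \<tau>, each \<tau> contributes the same sum, and the p! copies
  cancel the denominator.\<close>

lemma wedge_alternating_sum:
  fixes \<theta> :: "(nat \<Rightarrow> 'v) \<Rightarrow> 'k::field_char_0"
  shows "wedge p q (\<lambda>x. c * (\<Sum>\<tau> | \<tau> permutes {..<p}. of_int (sign \<tau>) * F (\<lambda>i. x (\<tau> i)))) \<theta> x =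
    c / fact q * (\<Sum>\<sigma> | \<sigma> permutes {..<p + q}. of_int (sign \<sigma>) * F (\<lambda>i. x (\<sigma> i)) * \<theta> (\<lambda>i. x (\<sigma> (p + i))))"
proof -
  let ?P = "{\<sigma>. \<sigma> permutes {..<p + q}}" and ?T = "{\<tau>. \<tau> permutes {..<p}}"
  let ?S = "\<Sum>\<sigma>\<in>?P. of_int (sign \<sigma>) * F (\<lambda>i. x (\<sigma> i)) * \<theta> (\<lambda>i. x (\<sigma> (p + i)))"
  have "(\<Sum>\<sigma>\<in>?P. of_int (sign \<sigma>) * (c * (\<Sum>\<tau>\<in>?T. of_int (sign \<tau>) * F (\<lambda>i. x (\<sigma> (\<tau> i))))) * \<theta> (\<lambda>i. x (\<sigma> (p + i))))
      = (\<Sum>\<sigma>\<in>?P. \<Sum>\<tau>\<in>?T. c * (of_int (sign \<sigma>) * of_int (sign \<tau>) * F (\<lambda>i. x (\<sigma> (\<tau> i))) * \<theta> (\<lambda>i. x (\<sigma> (p + i)))))"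
    by (simp add: sum_distrib_left sum_distrib_right mult_ac)
  also have "\<dots> = (\<Sum>\<tau>\<in>?T. \<Sum>\<sigma>\<in>?P. c * (of_int (sign \<sigma>) * of_int (sign \<tau>) * F (\<lambda>i. x (\<sigma> (\<tau> i))) * \<theta> (\<lambda>i. x (\<sigma> (p + i)))))"
    by (rule sum.swap)
  also have "\<dots> = (\<Sum>\<tau>\<in>?T. c * ?S)"
  proof (rule sum.cong[OF refl])
    fix \<tau> assume "\<tau> \<in> ?T"
    then have \<tau>: "\<tau> permutes {..<p}" by simp
    then have \<tau>': "\<tau> permutes {..<p + q}" by (rule permutes_subset) auto
    have fix_\<tau>: "\<tau> (p + i) = p + i" for i using permutes_not_in[OF \<tau>] by simp
    have "?S = (\<Sum>\<sigma>\<in>?P. of_int (sign (\<sigma> \<circ> \<tau>)) * F (\<lambda>i. x ((\<sigma> \<circ> \<tau>) i)) * \<theta> (\<lambda>i. x ((\<sigma> \<circ> \<tau>) (p + i))))"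
      by (rule sum_permutations_compose_right[OF \<tau>'])
    also have "\<dots> = (\<Sum>\<sigma>\<in>?P. of_int (sign \<sigma>) * of_int (sign \<tau>) * F (\<lambda>i. x (\<sigma> (\<tau> i))) * \<theta> (\<lambda>i. x (\<sigma> (p + i))))"
    proof (rule sum.cong[OF refl])
      fix \<sigma> assume "\<sigma> \<in> ?P"
      then have "sign (\<sigma> \<circ> \<tau>) = sign \<sigma> * sign \<tau>"
        using \<tau>' by (intro sign_compose permutes_imp_permutation[of "{..<p + q}"]) auto
      then show "of_int (sign (\<sigma> \<circ> \<tau>)) * F (\<lambda>i. x ((\<sigma> \<circ> \<tau>) i)) * \<theta> (\<lambda>i. x ((\<sigma> \<circ> \<tau>) (p + i))) =
        of_int (sign \<sigma>) * of_int (sign \<tau>) * F (\<lambda>i. x (\<sigma> (\<tau> i))) * \<theta> (\<lambda>i. x (\<sigma> (p + i)))"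
        by (simp add: fix_\<tau>)
    qed
    finally show "(\<Sum>\<sigma>\<in>?P. c * (of_int (sign \<sigma>) * of_int (sign \<tau>) * F (\<lambda>i. x (\<sigma> (\<tau> i))) * \<theta> (\<lambda>i. x (\<sigma> (p + i))))) = c * ?S"
      by (simp add: sum_distrib_left)
  qed
  also have "\<dots> = fact p * (c * ?S)"
    by (simp add: card_permutations[of "{..<p}" p])
  finally show ?thesis unfolding wedge_def by simp
qed

definition alternating_sum :: "nat \<Rightarrow> ('v \<Rightarrow> 'v \<Rightarrow> 'k::field_char_0) \<Rightarrow> ('v \<Rightarrow> 'k) \<Rightarrow> (nat \<Rightarrow> 'v) \<Rightarrow> 'k" where
  "alternating_sum m \<omega> \<alpha> x = (\<Sum>\<sigma> | \<sigma> permutes {..<2 * m + 1}. of_int (sign \<sigma>) *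
     ((\<Prod>i<m. \<omega> (x (\<sigma> (2 * i))) (x (\<sigma> (Suc (2 * i))))) * \<alpha> (x (\<sigma> (2 * m)))))"

lemma wedge_power_eq:
  "wedge_power 2 (\<lambda>x. \<omega> (x 0) (x 1)) m = (\<lambda>x. 1 / 2 ^ m * (\<Sum>\<tau> | \<tau> permutes {..<2 * m}. of_int (sign \<tau>) *
     (\<Prod>i<m. \<omega> (x (\<tau> (2 * i))) (x (\<tau> (Suc (2 * i)))))))"
proof (induction m)
  case 0
  have "{\<tau>. \<tau> permutes ({} :: nat set)} = {id}" by auto
  then show ?case by (simp add: fun_eq_iff)
next
  case (Suc m)
  show ?case
    unfolding wedge_power.simps Suc
    by (subst wedge_alternating_sum[where F = "\<lambda>x. \<Prod>i<m. \<omega> (x (2 * i)) (x (Suc (2 * i)))"])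
      (simp add: fun_eq_iff mult_ac)
qed

lemma wedge_contact_eq:
  "wedge (2 * m) 1 (wedge_power 2 (\<lambda>x. \<omega> (x 0) (x 1)) m) (\<lambda>x. \<alpha> (x 0)) x = 1 / 2 ^ m * alternating_sum m \<omega> \<alpha> x"
  unfolding wedge_power_eq
  by (subst wedge_alternating_sum[where F = "\<lambda>x. \<Prod>i<m. \<omega> (x (2 * i)) (x (Suc (2 * i)))"])
    (simp add: alternating_sum_def mult_ac)

text \<open>Composition with the transposition of \<open>i\<close> and \<open>j\<close> leaves every
  product unchanged and reverses every sign, so the sum equals its negative.\<close>

lemma alternating_sum_swap:
  assumes "i < 2 * m + 1" "j < 2 * m + 1" "i \<noteq> j" "x i = x j"
  shows "alternating_sum m \<omega> \<alpha> x = 0"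
proof -
  let ?t = "Transposition.transpose i j" and ?P = "{\<sigma>. \<sigma> permutes {..<2 * m + 1}}"
  let ?f = "\<lambda>\<sigma>. (\<Prod>i<m. \<omega> (x (\<sigma> (2 * i))) (x (\<sigma> (Suc (2 * i))))) * \<alpha> (x (\<sigma> (2 * m)))"
  have t: "?t permutes {..<2 * m + 1}" using assms by (intro permutes_swap_id) auto
  have xt: "x (?t u) = x u" for u using assms by (auto simp: Transposition.transpose_def)
  have "alternating_sum m \<omega> \<alpha> x = (\<Sum>\<sigma>\<in>?P. of_int (sign (?t \<circ> \<sigma>)) * ?f (?t \<circ> \<sigma>))"
    unfolding alternating_sum_def
    by (rule sum.reindex_bij_witness[of _ "\<lambda>p. ?t \<circ> p" "\<lambda>p. ?t \<circ> p"])
      (use t in \<open>auto intro: permutes_compose simp flip: comp_assoc\<close>)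
  also have "\<dots> = (\<Sum>\<sigma>\<in>?P. - (of_int (sign \<sigma>) * ?f \<sigma>))"
  proof (rule sum.cong[OF refl])
    fix \<sigma> assume "\<sigma> \<in> ?P"
    then have "sign (?t \<circ> \<sigma>) = sign ?t * sign \<sigma>"
      using t by (intro sign_compose permutes_imp_permutation[of "{..<2 * m + 1}"]) auto
    then have "sign (?t \<circ> \<sigma>) = - sign \<sigma>" using assms by (simp add: sign_swap_id)
    then show "of_int (sign (?t \<circ> \<sigma>)) * ?f (?t \<circ> \<sigma>) = - (of_int (sign \<sigma>) * ?f \<sigma>)"
      by (simp add: xt)
  qed
  also have "\<dots> = - alternating_sum m \<omega> \<alpha> x"
    by (simp add: alternating_sum_def sum_negf)
  finally show ?thesis by (simp add: eq_neg_iff_add_eq_0)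
qed

section \<open>Alternating forms on subspaces and their radicals\<close>

locale fin_dim_char_0 = finite_dimensional_vector_space scale Basis
  for scale :: "'k::field_char_0 \<Rightarrow> 'b::ab_group_add \<Rightarrow> 'b" and Basis
begin

definition linear_on :: "'b set \<Rightarrow> ('b \<Rightarrow> 'k) \<Rightarrow> bool" where
  "linear_on W f \<longleftrightarrow> (\<forall>x\<in>W. \<forall>y\<in>W. f (x + y) = f x + f y) \<and> (\<forall>c. \<forall>x\<in>W. f (scale c x) = c * f x)"

definition alternating_on :: "'b set \<Rightarrow> ('b \<Rightarrow> 'b \<Rightarrow> 'k) \<Rightarrow> bool" where
  "alternating_on W \<omega> \<longleftrightarrow> (\<forall>x\<in>W. linear_on W (\<omega> x) \<and> linear_on W (\<lambda>y. \<omega> y x) \<and> \<omega> x x = 0)"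

definition radical :: "'b set \<Rightarrow> ('b \<Rightarrow> 'b \<Rightarrow> 'k) \<Rightarrow> 'b set" where
  "radical W \<omega> = {z\<in>W. \<forall>y\<in>W. \<omega> z y = 0}"

lemma linear_on_add: "linear_on W f \<Longrightarrow> x \<in> W \<Longrightarrow> y \<in> W \<Longrightarrow> f (x + y) = f x + f y"
  by (simp add: linear_on_def)

lemma linear_on_scale: "linear_on W f \<Longrightarrow> x \<in> W \<Longrightarrow> f (scale c x) = c * f x"
  by (simp add: linear_on_def)

lemma linear_on_0: "linear_on W f \<Longrightarrow> subspace W \<Longrightarrow> f 0 = 0"
  using linear_on_scale[of W f 0 0] subspace_0 by simp

lemma linear_on_diff:
  assumes "linear_on W f" "subspace W" "x \<in> W" "y \<in> W" shows "f (x - y) = f x - f y"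
  using linear_on_add[OF assms(1) subspace_diff[OF assms(2-4)] assms(4)] by simp

lemma subspace_kernel_on:
  assumes f: "linear_on W f" and W: "subspace W" shows "subspace {w\<in>W. f w = 0}"
proof (rule subspaceI)
  show "0 \<in> {w\<in>W. f w = 0}" using subspace_0[OF W] linear_on_0[OF f W] by simp
  show "x + y \<in> {w\<in>W. f w = 0}" if "x \<in> {w\<in>W. f w = 0}" "y \<in> {w\<in>W. f w = 0}" for x y
    using that subspace_add[OF W] linear_on_add[OF f] by simp
  show "scale c x \<in> {w\<in>W. f w = 0}" if "x \<in> {w\<in>W. f w = 0}" for c x
    using that subspace_scale[OF W] linear_on_scale[OF f] by simp
qed

lemma linear_on_mono: "linear_on W f \<Longrightarrow> W' \<subseteq> W \<Longrightarrow> linear_on W' f"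
  by (simp add: linear_on_def subset_iff)

lemma alternating_on_mono: "alternating_on W \<omega> \<Longrightarrow> W' \<subseteq> W \<Longrightarrow> alternating_on W' \<omega>"
  unfolding alternating_on_def by (intro ballI conjI linear_on_mono[of W _ W']) auto

lemma alternating_linear:
  assumes "alternating_on W \<omega>" "x \<in> W"
  shows "linear_on W (\<omega> x)" "linear_on W (\<lambda>y. \<omega> y x)" "\<omega> x x = 0"
  using assms by (simp_all add: alternating_on_def)

lemma alternating_skew:
  assumes \<omega>: "alternating_on W \<omega>" and W: "subspace W" and x: "x \<in> W" and y: "y \<in> W"
  shows "\<omega> y x = - \<omega> x y"
proof -
  have xy: "x + y \<in> W" by (rule subspace_add[OF W x y])
  have "\<omega> (x + y) (x + y) = \<omega> x (x + y) + \<omega> y (x + y)"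
    by (rule linear_on_add[OF alternating_linear(2)[OF \<omega> xy] x y])
  also have "\<omega> x (x + y) = \<omega> x x + \<omega> x y"
    by (rule linear_on_add[OF alternating_linear(1)[OF \<omega> x] x y])
  also have "\<omega> y (x + y) = \<omega> y x + \<omega> y y"
    by (rule linear_on_add[OF alternating_linear(1)[OF \<omega> y] x y])
  finally show ?thesis
    using alternating_linear(3)[OF \<omega>] x y xy by (simp add: eq_neg_iff_add_eq_0 add.commute)
qed

lemma subspace_radical:
  assumes \<omega>: "alternating_on W \<omega>" and W: "subspace W" shows "subspace (radical W \<omega>)"
proof -
  note lin = alternating_linear(2)[OF \<omega>]
  show ?thesis
    unfolding radical_def
    by (rule subspaceI) (simp_all add: subspace_0 subspace_add subspace_scale W
        linear_on_0[OF lin W] linear_on_add[OF lin] linear_on_scale[OF lin])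
qed

text \<open>A symplectic basis of a complement of the radical. Splitting off a hyperbolic plane
  spanned by \<open>e\<close> and \<open>f\<close> lowers the dimension by two and leaves the
  radical unchanged.\<close>

lemma symplectic_sequence:
  assumes "subspace W" "alternating_on W \<omega>"
  shows "\<exists>m x. (\<forall>i<2 * m. x i \<in> W) \<and>
    (\<forall>i<2 * m. \<forall>j<2 * m. \<omega> (x i) (x j) = of_int (symplectic_gram i j)) \<and>
    dim W = 2 * m + dim (radical W \<omega>)"
  using assms
proof (induction "dim W" arbitrary: W rule: less_induct)
  case less
  have W: "subspace W" and \<omega>: "alternating_on W \<omega>" by fact+
  show ?case
  proof (cases "\<exists>e\<in>W. \<exists>f\<in>W. \<omega> e f \<noteq> 0")
    case False
    then have "radical W \<omega> = W" by (auto simp: radical_def)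
    then show ?thesis by (intro exI[of _ 0]) auto
  next
    case True
    then obtain e f0 where e: "e \<in> W" and f0: "f0 \<in> W" "\<omega> e f0 \<noteq> 0" by blast
    define f where "f = scale (1 / \<omega> e f0) f0"
    have f: "f \<in> W" unfolding f_def by (intro subspace_scale W f0)
    have ef: "\<omega> e f = 1"
      using linear_on_scale[OF alternating_linear(1)[OF \<omega> e] f0(1)] f0(2) by (simp add: f_def)
    have fe: "\<omega> f e = -1" using alternating_skew[OF \<omega> W e f] ef by simp
    have ee: "\<omega> e e = 0" and ff: "\<omega> f f = 0" using alternating_linear(3)[OF \<omega>] e f by auto
    note lin = alternating_linear(1,2)[OF \<omega>]
    note ladd = linear_on_add[OF lin(2)] and lscale = linear_on_scale[OF lin(2)]
      and ldiff = linear_on_diff[OF lin(2) W]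
    define W' where "W' = {w\<in>{w\<in>W. \<omega> w e = 0}. \<omega> w f = 0}"
    have sub1: "subspace {w\<in>W. \<omega> w e = 0}" using subspace_kernel_on[OF lin(2)[OF e] W] .
    have "linear_on {w\<in>W. \<omega> w e = 0} (\<lambda>y. \<omega> y f)"
      by (rule linear_on_mono[OF lin(2)[OF f]]) auto
    then have W': "subspace W'" unfolding W'_def by (rule subspace_kernel_on[OF _ sub1])
    have W'W: "W' \<subseteq> W" by (auto simp: W'_def)
    have \<omega>': "alternating_on W' \<omega>"
      by (rule alternating_on_mono[OF \<omega> W'W])
    have eW': "\<omega> e y = 0" and fW': "\<omega> f y = 0" if "y \<in> W'" for y
      using alternating_skew[OF \<omega> W _ e, of y] alternating_skew[OF \<omega> W _ f, of y] that by (auto simp: W'_def)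
    have rad: "radical W' \<omega> = radical W \<omega>"
    proof (rule subset_antisym; rule subsetI)
      fix z assume z: "z \<in> radical W' \<omega>"
      then have zW: "z \<in> W'" "z \<in> W" using W'W by (auto simp: radical_def)
      have "\<omega> z w = 0" if w: "w \<in> W" for w
      proof -
        \<comment> \<open>The projection of \<open>w\<close> to the orthogonal complement
          \<open>W'\<close> of the plane spanned by \<open>e\<close> and \<open>f\<close>.\<close>
        define w' where "w' = w - scale (\<omega> w f) e + scale (\<omega> w e) f"
        have w'W: "w' \<in> W" unfolding w'_def by (intro subspace_add subspace_diff subspace_scale W e f w)
        have "w' \<in> W'" unfolding W'_def using w'W
          by (simp add: w'_def ladd ldiff lscale W e f w subspace_diff subspace_scale ef fe ee ff)
        then have "\<omega> z w' = 0" using z by (simp add: radical_def)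
        moreover have "\<omega> z w' = \<omega> z w - \<omega> w f * \<omega> z e + \<omega> w e * \<omega> z f"
          using w e f by (simp add: w'_def linear_on_add[OF lin(1)[OF zW(2)]]
              linear_on_diff[OF lin(1)[OF zW(2)] W] linear_on_scale[OF lin(1)[OF zW(2)]]
              W subspace_diff subspace_scale)
        ultimately show ?thesis using zW by (simp add: W'_def)
      qed
      then show "z \<in> radical W \<omega>" using zW by (simp add: radical_def)
    next
      fix z assume "z \<in> radical W \<omega>"
      then show "z \<in> radical W' \<omega>" using W'W e f by (auto simp: radical_def W'_def)
    qed
    obtain B where B: "B \<subseteq> W'" "independent B" "W' \<subseteq> span B" "card B = dim W'"
      using basis_exists[of W'] by blast
    have spanB: "span B = W'" using B W' by (simp add: span_subspace)
    have finB: "finite B" using B finiteI_independent by blast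
    have fB: "f \<notin> span B" using spanB fe by (auto simp: W'_def)
    have eB: "e \<notin> span (insert f B)"
    proof
      assume "e \<in> span (insert f B)"
      then obtain k where k: "e - scale k f \<in> W'" using span_breakdown_eq spanB by blast
      then have "\<omega> (e - scale k f) f = 0" by (simp add: W'_def)
      then show False using e f by (simp add: ldiff lscale W subspace_scale ef ff)
    qed
    have ind: "independent (insert e (insert f B))"
      using eB fB B by (intro independent_insertI)
    have "insert e (insert f B) \<subseteq> W" using e f B W'W by auto
    moreover have "W \<subseteq> span (insert e (insert f B))"
    proof
      fix w assume w: "w \<in> W"
      define w' where "w' = w - scale (\<omega> w f) e + scale (\<omega> w e) f"
      have w'W: "w' \<in> W" unfolding w'_def by (intro subspace_add subspace_diff subspace_scale W e f w)
      have "w' \<in> W'" unfolding W'_def using w'W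
        by (simp add: w'_def ladd ldiff lscale W e f w subspace_diff subspace_scale ef fe ee ff)
      then have "w' \<in> span (insert e (insert f B))"
        using spanB span_mono[of B "insert e (insert f B)"] by auto
      then have "w' + scale (\<omega> w f) e - scale (\<omega> w e) f \<in> span (insert e (insert f B))"
        by (intro span_add span_diff span_scale) (auto intro: span_base)
      then show "w \<in> span (insert e (insert f B))" by (simp add: w'_def)
    qed
    ultimately have "card (insert e (insert f B)) = dim W" using ind basis_card_eq_dim by blast
    moreover have "f \<notin> B" "e \<notin> insert f B" using fB eB span_base by blast+
    ultimately have dimW: "dim W = dim W' + 2" using finB B(4) by simp
    obtain m x where IH: "\<forall>i<2 * m. x i \<in> W'"
      "\<forall>i<2 * m. \<forall>j<2 * m. \<omega> (x i) (x j) = of_int (symplectic_gram i j)"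
      "dim W' = 2 * m + dim (radical W' \<omega>)"
      using less.hyps[OF _ W' \<omega>'] dimW by auto
    define y where "y i = (if i < 2 * m then x i else if i = 2 * m then e else f)" for i
    have G: "symplectic_gram i (2 * m) = 0" "symplectic_gram i (Suc (2 * m)) = 0"
      "symplectic_gram (2 * m) i = 0" "symplectic_gram (Suc (2 * m)) i = 0" if "i < 2 * m" for i
      using that by (auto simp: symplectic_gram_def)
    have G': "symplectic_gram (2 * m) (2 * m) = 0" "symplectic_gram (Suc (2 * m)) (Suc (2 * m)) = 0"
      "symplectic_gram (2 * m) (Suc (2 * m)) = 1" "symplectic_gram (Suc (2 * m)) (2 * m) = -1"
      by (auto simp: symplectic_gram_def)
    have xe: "\<omega> (x i) e = 0" "\<omega> (x i) f = 0" if "i < 2 * m" for i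
      using IH(1) that by (auto simp: W'_def)
    have cases: "i < 2 * m \<or> i = 2 * m \<or> i = Suc (2 * m)" if "i < 2 * Suc m" for i using that by auto
    show ?thesis
    proof (intro exI conjI allI impI)
      show "dim W = 2 * Suc m + dim (radical W \<omega>)" using dimW IH(3) rad by simp
      show "y i \<in> W" if "i < 2 * Suc m" for i using IH(1) W'W e f by (auto simp: y_def)
      show "\<omega> (y i) (y j) = of_int (symplectic_gram i j)" if "i < 2 * Suc m" "j < 2 * Suc m" for i j
        using cases[OF that(1)] cases[OF that(2)] IH(1,2)
        by (auto simp: y_def G G' ef fe ee ff xe eW' fW')
    qed
  qed
qed

lemma radical_nonzero:
  assumes "subspace W" "alternating_on W \<omega>" "odd (dim W)"
  shows "\<exists>z\<in>radical W \<omega>. z \<noteq> 0"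
proof (rule ccontr)
  assume "\<not> ?thesis"
  then have "dim (radical W \<omega>) = 0" unfolding dim_eq_0 by blast
  moreover obtain m where "dim W = 2 * m + dim (radical W \<omega>)"
    using symplectic_sequence[OF assms(1,2)] by blast
  ultimately have "dim W = 2 * m" by linarith
  then show False using assms(3) by simp
qed

text \<open>The radical is a line, spanned by some \<open>z\<close> with \<alpha> z nonzero.
  Evaluated at a symplectic sequence on which \<alpha> vanishes, followed by \<open>z\<close>, the
  sum reduces to permutations that fix the last position, and its value is the number from
  \<open>symplectic_gram_sum\<close> times \<alpha> z.\<close>

lemma alternating_sum_nonzero:
  assumes W: "subspace W" and \<omega>: "alternating_on W \<omega>" and \<alpha>: "linear_on W \<alpha>"
    and dim: "dim W = 2 * m + 1" and triv: "\<And>z. z \<in> radical W \<omega> \<Longrightarrow> \<alpha> z = 0 \<Longrightarrow> z = 0"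
  shows "\<exists>x. (\<forall>i. x i \<in> W) \<and> alternating_sum m \<omega> \<alpha> x \<noteq> 0"
proof -
  obtain z where z: "z \<in> radical W \<omega>" "z \<noteq> 0" using radical_nonzero[OF W \<omega>] dim by auto
  have zW: "z \<in> W" using z by (simp add: radical_def)
  have az: "\<alpha> z \<noteq> 0" using triv z by blast
  have R: "subspace (radical W \<omega>)" by (rule subspace_radical[OF \<omega> W])
  have "radical W \<omega> \<subseteq> span {z}"
  proof
    fix r assume r: "r \<in> radical W \<omega>"
    then have rW: "r \<in> W" by (simp add: radical_def)
    let ?c = "\<alpha> r / \<alpha> z"
    have "r - scale ?c z \<in> radical W \<omega>" by (intro subspace_diff subspace_scale R r z)
    moreover have "\<alpha> (r - scale ?c z) = 0"
      using linear_on_diff[OF \<alpha> W rW subspace_scale[OF W zW]] linear_on_scale[OF \<alpha> zW] az by simp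
    ultimately have "r - scale ?c z = 0" by (rule triv)
    then show "r \<in> span {z}" by (auto simp: span_singleton)
  qed
  then have "dim (radical W \<omega>) \<le> 1" using dim_mono[of "radical W \<omega>" "{z}"] z(2) by simp
  moreover obtain m' x where x: "\<forall>i<2 * m'. x i \<in> W"
      "\<forall>i<2 * m'. \<forall>j<2 * m'. \<omega> (x i) (x j) = of_int (symplectic_gram i j)"
      "dim W = 2 * m' + dim (radical W \<omega>)"
    using symplectic_sequence[OF W \<omega>] by blast
  ultimately have m': "m' = m" using dim by presburger
  have wz: "\<omega> z w = 0" "\<omega> w z = 0" if "w \<in> W" for w
    using z that alternating_skew[OF \<omega> W, of z w] by (auto simp: radical_def)
  \<comment> \<open>Multiples of \<open>z\<close> are invisible to \<omega>; they are used to put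
    the symplectic sequence into the kernel of \<alpha>.\<close>
  define y where "y i = (if i < 2 * m then x i - scale (\<alpha> (x i) / \<alpha> z) z else z)" for i
  have yW: "y i \<in> W" for i using x m' zW W by (auto simp: y_def subspace_diff subspace_scale)
  have ay: "\<alpha> (y i) = 0" if "i < 2 * m" for i
    using linear_on_diff[OF \<alpha> W, of "x i" "scale (\<alpha> (x i) / \<alpha> z) z"] linear_on_scale[OF \<alpha> zW]
      x(1) m' zW that az by (simp add: y_def W subspace_scale)
  have wy: "\<omega> (y i) (y j) = of_int (symplectic_gram i j)" if ij: "i < 2 * m" "j < 2 * m" for i j
  proof -
    have xW: "x i \<in> W" "x j \<in> W" using x ij m' by auto
    have s: "scale c z \<in> W" for c using W zW by (rule subspace_scale)
    note lin = alternating_linear[OF \<omega>]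
    have "\<omega> (y i) (y j) = \<omega> (y i) (x j) - \<omega> (y i) (scale (\<alpha> (x j) / \<alpha> z) z)"
      using linear_on_diff[OF lin(1)[OF yW] W xW(2) s] ij(2) by (simp add: y_def[of j])
    also have "\<omega> (y i) (scale (\<alpha> (x j) / \<alpha> z) z) = 0"
      using linear_on_scale[OF lin(1)[OF yW] zW] wz(2)[OF yW] by simp
    also have "\<omega> (y i) (x j) = \<omega> (x i) (x j) - \<omega> (scale (\<alpha> (x i) / \<alpha> z) z) (x j)"
      using linear_on_diff[OF lin(2)[OF xW(2)] W xW(1) s] ij(1) by (simp add: y_def[of i])
    also have "\<omega> (scale (\<alpha> (x i) / \<alpha> z) z) (x j) = 0"
      using linear_on_scale[OF lin(2)[OF xW(2)] zW] wz(1)[OF xW(2)] by simp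
    finally show ?thesis using x(2) ij m' by simp
  qed
  have "alternating_sum m \<omega> \<alpha> y = (\<Sum>\<sigma> | \<sigma> permutes {..<2 * m}. of_int (sign \<sigma>) *
     ((\<Prod>i<m. \<omega> (y (\<sigma> (2 * i))) (y (\<sigma> (Suc (2 * i))))) * \<alpha> (y (\<sigma> (2 * m)))))"
    unfolding alternating_sum_def
  proof (rule sum.mono_neutral_right)
    show "finite {\<sigma>. \<sigma> permutes {..<2 * m + 1}}" by (intro finite_permutations) simp
    show "{\<sigma>. \<sigma> permutes {..<2 * m}} \<subseteq> {\<sigma>. \<sigma> permutes {..<2 * m + 1}}"
      by (auto elim: permutes_subset)
    show "\<forall>\<sigma>\<in>{\<sigma>. \<sigma> permutes {..<2 * m + 1}} - {\<sigma>. \<sigma> permutes {..<2 * m}}. of_int (sign \<sigma>) *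
     ((\<Prod>i<m. \<omega> (y (\<sigma> (2 * i))) (y (\<sigma> (Suc (2 * i))))) * \<alpha> (y (\<sigma> (2 * m)))) = 0"
    proof
      fix \<sigma> assume "\<sigma> \<in> {\<sigma>. \<sigma> permutes {..<2 * m + 1}} - {\<sigma>. \<sigma> permutes {..<2 * m}}"
      then have \<sigma>: "\<sigma> permutes {..<2 * m + 1}" and n: "\<not> \<sigma> permutes {..<2 * m}" by auto
      have "\<sigma> (2 * m) \<noteq> 2 * m"
      proof
        assume *: "\<sigma> (2 * m) = 2 * m"
        have "\<sigma> permutes {..<2 * m}"
        proof (rule permutes_superset[OF \<sigma>])
          fix x assume "x \<in> {..<2 * m + 1} - {..<2 * m}"
          then have "x = 2 * m" by auto
          then show "\<sigma> x = x" using * by simp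
        qed
        then show False using n by blast
      qed
      moreover have "\<sigma> (2 * m) < 2 * m + 1" using permutes_in_image[OF \<sigma>, of "2 * m"] by simp
      ultimately have "\<alpha> (y (\<sigma> (2 * m))) = 0" by (intro ay) simp
      then show "of_int (sign \<sigma>) *
     ((\<Prod>i<m. \<omega> (y (\<sigma> (2 * i))) (y (\<sigma> (Suc (2 * i))))) * \<alpha> (y (\<sigma> (2 * m)))) = 0" by simp
    qed
  qed
  also have "\<dots> = (\<Sum>\<sigma> | \<sigma> permutes {..<2 * m}.
      of_int (sign \<sigma> * (\<Prod>i<m. symplectic_gram (\<sigma> (2 * i)) (\<sigma> (Suc (2 * i))))) * \<alpha> z)"
  proof (rule sum.cong[OF refl])
    fix \<sigma> assume "\<sigma> \<in> {\<sigma>. \<sigma> permutes {..<2 * m}}"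
    then have \<sigma>: "\<sigma> permutes {..<2 * m}" by simp
    have "\<sigma> (2 * m) = 2 * m" using permutes_not_in[OF \<sigma>] by simp
    moreover have "\<sigma> i < 2 * m" if "i < 2 * m" for i using permutes_in_image[OF \<sigma>, of i] that by simp
    ultimately show "of_int (sign \<sigma>) *
     ((\<Prod>i<m. \<omega> (y (\<sigma> (2 * i))) (y (\<sigma> (Suc (2 * i))))) * \<alpha> (y (\<sigma> (2 * m)))) =
      of_int (sign \<sigma> * (\<Prod>i<m. symplectic_gram (\<sigma> (2 * i)) (\<sigma> (Suc (2 * i))))) * \<alpha> z"
      by (simp add: wy y_def[of "2 * m"])
  qed
  also have "\<dots> = of_int (\<Sum>\<sigma> | \<sigma> permutes {..<2 * m}.
      sign \<sigma> * (\<Prod>i<m. symplectic_gram (\<sigma> (2 * i)) (\<sigma> (Suc (2 * i))))) * \<alpha> z"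
    by (simp add: sum_distrib_right)
  also have "\<dots> \<noteq> 0" using symplectic_gram_sum[of m] az by (simp del: of_int_sum of_int_mult)
  finally show ?thesis using yW by blast
qed

text \<open>As a function of each argument, the alternating sum is of this kind.\<close>

definition vanishing_functional :: "'b set \<Rightarrow> ('b \<Rightarrow> 'b \<Rightarrow> 'k) \<Rightarrow> ('b \<Rightarrow> 'k) \<Rightarrow> ('b \<Rightarrow> 'k) \<Rightarrow> bool" where
  "vanishing_functional W \<omega> \<alpha> f \<longleftrightarrow> linear_on W f \<and> (\<forall>z\<in>radical W \<omega>. \<alpha> z = 0 \<longrightarrow> f z = 0)"

lemma vanishing_functional_scale:
  "vanishing_functional W \<omega> \<alpha> f \<Longrightarrow> vanishing_functional W \<omega> \<alpha> (\<lambda>y. c * f y)"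
  by (simp add: vanishing_functional_def linear_on_def algebra_simps)

lemma vanishing_functional_sum:
  "(\<And>i. i \<in> I \<Longrightarrow> vanishing_functional W \<omega> \<alpha> (f i)) \<Longrightarrow> vanishing_functional W \<omega> \<alpha> (\<lambda>y. \<Sum>i\<in>I. f i y)"
  by (simp add: vanishing_functional_def linear_on_def sum.distrib sum_distrib_left)

text \<open>In each term the argument number \<open>j\<close> enters exactly one factor, which is
  \<alpha> or one side of \<omega>; the other factors form a constant.\<close>

lemma alternating_sum_slot:
  assumes W: "subspace W" and \<omega>: "alternating_on W \<omega>" and \<alpha>: "linear_on W \<alpha>"
    and x: "\<And>i. x i \<in> W" and j: "j < 2 * m + 1"
  shows "vanishing_functional W \<omega> \<alpha> (\<lambda>y. alternating_sum m \<omega> \<alpha> (x(j := y)))"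
  unfolding alternating_sum_def
proof (intro vanishing_functional_sum vanishing_functional_scale)
  fix \<sigma> assume "\<sigma> \<in> {\<sigma>. \<sigma> permutes {..<2 * m + 1}}"
  then have \<sigma>: "\<sigma> permutes {..<2 * m + 1}" by simp
  have left: "vanishing_functional W \<omega> \<alpha> (\<lambda>y. \<omega> y w)" if "w \<in> W" for w
    using alternating_linear(2)[OF \<omega> that] that by (simp add: vanishing_functional_def radical_def)
  have "\<omega> w z = 0" if "w \<in> W" "z \<in> radical W \<omega>" for w z
    using alternating_skew[OF \<omega> W, of z w] that by (simp add: radical_def)
  then have right: "vanishing_functional W \<omega> \<alpha> (\<omega> w)" if "w \<in> W" for w
    using alternating_linear(1)[OF \<omega> that] that by (simp add: vanishing_functional_def)
  have \<alpha>': "vanishing_functional W \<omega> \<alpha> \<alpha>" using \<alpha> by (simp add: vanishing_functional_def)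
  have inj: "\<sigma> a = \<sigma> b \<longleftrightarrow> a = b" for a b using permutes_inj[OF \<sigma>] by (auto dest: injD)
  obtain k where k: "\<sigma> k = j" using permutes_surj[OF \<sigma>] by (metis surjD)
  then have km: "k < 2 * m + 1" using permutes_in_image[OF \<sigma>, of k] j by simp
  have upd: "(x(j := y)) (\<sigma> i) = (if i = k then y else x (\<sigma> i))" for i y
    using inj[of i k] k by auto
  show "vanishing_functional W \<omega> \<alpha> (\<lambda>y. (\<Prod>i<m. \<omega> ((x(j := y)) (\<sigma> (2 * i))) ((x(j := y)) (\<sigma> (Suc (2 * i))))) *
    \<alpha> ((x(j := y)) (\<sigma> (2 * m))))"
  proof (cases "k = 2 * m")
    case True
    have ne: "2 * i \<noteq> k" "Suc (2 * i) \<noteq> k" if "i < m" for i using True that by presburger+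
    have "(\<Prod>i<m. \<omega> ((x(j := y)) (\<sigma> (2 * i))) ((x(j := y)) (\<sigma> (Suc (2 * i))))) =
        (\<Prod>i<m. \<omega> (x (\<sigma> (2 * i))) (x (\<sigma> (Suc (2 * i)))))" for y
      unfolding upd by (rule prod.cong[OF refl]) (simp add: ne)
    then have "(\<lambda>y. (\<Prod>i<m. \<omega> ((x(j := y)) (\<sigma> (2 * i))) ((x(j := y)) (\<sigma> (Suc (2 * i))))) * \<alpha> ((x(j := y)) (\<sigma> (2 * m))))
      = (\<lambda>y. (\<Prod>i<m. \<omega> (x (\<sigma> (2 * i))) (x (\<sigma> (Suc (2 * i))))) * \<alpha> y)"
      using upd True by simp
    then show ?thesis using vanishing_functional_scale[OF \<alpha>'] by simp
  next
    case False
    define i0 where "i0 = k div 2"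
    have i0: "i0 < m" using km False by (simp add: i0_def)
    define c where "c = (\<Prod>i\<in>{..<m} - {i0}. \<omega> (x (\<sigma> (2 * i))) (x (\<sigma> (Suc (2 * i))))) * \<alpha> (x (\<sigma> (2 * m)))"
    have ne: "2 * i \<noteq> k" "Suc (2 * i) \<noteq> k" if "i \<noteq> i0" for i using that by (auto simp: i0_def)
    have "(\<Prod>i\<in>{..<m} - {i0}. \<omega> ((x(j := y)) (\<sigma> (2 * i))) ((x(j := y)) (\<sigma> (Suc (2 * i))))) =
        (\<Prod>i\<in>{..<m} - {i0}. \<omega> (x (\<sigma> (2 * i))) (x (\<sigma> (Suc (2 * i)))))" for y
      unfolding upd by (rule prod.cong[OF refl]) (simp add: ne)
    moreover have "(x(j := y)) (\<sigma> (2 * m)) = x (\<sigma> (2 * m))" for y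
      unfolding upd using False by simp
    ultimately have rest: "(\<Prod>i\<in>{..<m} - {i0}. \<omega> ((x(j := y)) (\<sigma> (2 * i))) ((x(j := y)) (\<sigma> (Suc (2 * i))))) *
        \<alpha> ((x(j := y)) (\<sigma> (2 * m))) = c" for y
      unfolding c_def by (simp only:)
    have "(\<Prod>i<m. \<omega> ((x(j := y)) (\<sigma> (2 * i))) ((x(j := y)) (\<sigma> (Suc (2 * i))))) * \<alpha> ((x(j := y)) (\<sigma> (2 * m)))
      = c * \<omega> ((x(j := y)) (\<sigma> (2 * i0))) ((x(j := y)) (\<sigma> (Suc (2 * i0))))" for y
      unfolding rest[of y, symmetric] by (subst prod.remove[of _ i0]) (use i0 in \<open>simp_all only: finite_lessThan lessThan_iff mult_ac\<close>)
    moreover have "vanishing_functional W \<omega> \<alpha> (\<lambda>y. \<omega> ((x(j := y)) (\<sigma> (2 * i0))) ((x(j := y)) (\<sigma> (Suc (2 * i0)))))"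
    proof (cases "even k")
      case True
      then have "k = 2 * i0" by (simp add: i0_def)
      then show ?thesis unfolding upd using left[OF x] by simp
    next
      case False
      then have "k = Suc (2 * i0)" by (simp add: i0_def)
      then show ?thesis unfolding upd using right[OF x] by simp
    qed
    ultimately show ?thesis using vanishing_functional_scale by simp
  qed
qed

text \<open>As a function of its argument number \<open>j\<close>, the sum vanishes at
  \<open>z\<close> and at the other arguments. So no argument is in the span of \<open>z\<close> and
  the others, and a nonzero \<open>z\<close> would give one linearly independent vector too many for
  \<open>W\<close>.\<close>

lemma alternating_sum_nonzeroD:
  assumes W: "subspace W" and \<omega>: "alternating_on W \<omega>" and \<alpha>: "linear_on W \<alpha>"
    and dim: "dim W = 2 * m + 1" and x: "\<And>i. x i \<in> W" and nz: "alternating_sum m \<omega> \<alpha> x \<noteq> 0"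
    and z: "z \<in> radical W \<omega>" "\<alpha> z = 0"
  shows "z = 0"
proof (rule ccontr)
  assume z0: "z \<noteq> 0"
  let ?d = "2 * m + 1"
  have zW: "z \<in> W" using z by (simp add: radical_def)
  have K: "x j \<notin> span (insert z (x ` ({..<?d} - {j})))" if j: "j < ?d" for j
  proof
    let ?f = "\<lambda>y. alternating_sum m \<omega> \<alpha> (x(j := y))"
    have f: "vanishing_functional W \<omega> \<alpha> ?f" by (rule alternating_sum_slot[OF W \<omega> \<alpha> x j])
    assume "x j \<in> span (insert z (x ` ({..<?d} - {j})))"
    moreover have "span (insert z (x ` ({..<?d} - {j}))) \<subseteq> {w\<in>W. ?f w = 0}"
    proof (rule span_minimal)
      show "subspace {w\<in>W. ?f w = 0}"
        by (rule subspace_kernel_on[OF conjunct1[OF f[unfolded vanishing_functional_def]] W])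
      have "?f z = 0" using f z by (simp add: vanishing_functional_def)
      moreover have "?f (x i) = 0" if "i < ?d" "i \<noteq> j" for i
        by (rule alternating_sum_swap[OF that(1) j that(2)]) (simp add: that)
      ultimately show "insert z (x ` ({..<?d} - {j})) \<subseteq> {w\<in>W. ?f w = 0}"
        using zW x by (intro insert_subsetI image_subsetI CollectI conjI) simp_all
    qed
    ultimately have "?f (x j) = 0" by blast
    then show False using nz by simp
  qed
  have "independent (insert z (x ` {..<k})) \<and> card (insert z (x ` {..<k})) = Suc k" if "k \<le> ?d" for k
    using that
  proof (induction k)
    case 0
    then show ?case using z0 by simp
  next
    case (Suc k)
    then have k: "k < ?d" by simp
    let ?X = "insert z (x ` {..<k})"
    have X: "independent ?X" "card ?X = Suc k" using Suc.IH[OF less_imp_le[OF k]] by (rule conjunct1, rule conjunct2)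
    have "?X \<subseteq> insert z (x ` ({..<?d} - {k}))" using k by (intro insert_mono image_mono) auto
    from contra_subsetD[OF span_mono[OF this] K[OF k]] have n: "x k \<notin> span ?X" .
    from contra_subsetD[OF span_superset this] have "card (insert (x k) ?X) = Suc (Suc k)"
      unfolding X(2)[symmetric] by (intro card_insert_disjoint) simp_all
    moreover have "insert z (x ` {..<Suc k}) = insert (x k) ?X"
      by (simp only: lessThan_Suc image_insert insert_commute)
    ultimately show ?case using independent_insertI[OF n X(1)] by (simp only: simp_thms)
  qed
  from this[OF order_refl] have *: "independent (insert z (x ` {..<?d}))" "card (insert z (x ` {..<?d})) = Suc ?d"
    by (rule conjunct1, rule conjunct2)
  have "insert z (x ` {..<?d}) \<subseteq> W" using zW x by (intro insert_subsetI image_subsetI)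
  from independent_card_le_dim[OF this *(1)] show False using *(2) dim by linarith
qed

end

section \<open>The Lie algebra of a linear algebraic group\<close>

lemma fun_alg_sum: "(\<And>i. i \<in> I \<Longrightarrow> f i \<in> fun_alg E) \<Longrightarrow> (\<lambda>x. \<Sum>i\<in>I. f i x) \<in> fun_alg E"
  by (induction I rule: infinite_finite_induct) (auto intro: fun_alg.const fun_alg.add)

lemma fun_alg_prod: "(\<And>i. i \<in> I \<Longrightarrow> f i \<in> fun_alg E) \<Longrightarrow> (\<lambda>x. \<Prod>i\<in>I. f i x) \<in> fun_alg E"
  by (induction I rule: infinite_finite_induct) (auto intro: fun_alg.const fun_alg.mult)

lemma fun_alg_power: "f \<in> fun_alg E \<Longrightarrow> (\<lambda>x. f x ^ n) \<in> fun_alg E"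
  by (induction n) (auto intro: fun_alg.const fun_alg.mult)

lemma fun_alg_scale: "f \<in> fun_alg E \<Longrightarrow> (\<lambda>x. c * f x) \<in> fun_alg E"
  by (rule fun_alg.mult[OF fun_alg.const])

lemma fun_alg_minus: "f \<in> fun_alg E \<Longrightarrow> (\<lambda>x. - f x) \<in> fun_alg E"
  using fun_alg_scale[of f E "-1"] by simp

lemma fun_alg_comp:
  assumes "f \<in> fun_alg E" "\<And>e. e \<in> E \<Longrightarrow> (\<lambda>x. e (h x)) \<in> fun_alg E'"
  shows "(\<lambda>x. f (h x)) \<in> fun_alg E'"
  using assms by induction (auto intro: fun_alg.intros)

lemma fun_alg_mono: "f \<in> fun_alg E \<Longrightarrow> E \<subseteq> E' \<Longrightarrow> f \<in> fun_alg E'"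
  using fun_alg_comp[of f E "\<lambda>x. x" E'] by (auto intro: fun_alg.gen)

lemma entry_fun_alg: "(\<lambda>A. A $ i $ j) \<in> fun_alg entries"
  by (rule fun_alg.gen) (auto simp: entries_def)

lemma det_fun_alg:
  assumes "\<And>i j. (\<lambda>x. M x $ i $ j) \<in> fun_alg E"
  shows "(\<lambda>x. det (M x)) \<in> fun_alg E"
  unfolding det_def by (intro fun_alg_sum fun_alg.mult fun_alg.const fun_alg_prod assms)

lemma matrix_mult_fun_alg:
  assumes "\<And>i j. (\<lambda>x. M x $ i $ j) \<in> fun_alg E" "\<And>i j. (\<lambda>x. N x $ i $ j) \<in> fun_alg E"
  shows "(\<lambda>x. (M x ** N x) $ i $ j) \<in> fun_alg E"
  unfolding matrix_matrix_mult_def by (simp add: fun_alg_sum fun_alg.mult assms)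

lemma fun_alg_entries_comp:
  assumes "f \<in> fun_alg entries" "\<And>i j. (\<lambda>x. M x $ i $ j) \<in> fun_alg E"
  shows "(\<lambda>x. f (M x)) \<in> fun_alg E"
  by (rule fun_alg_comp[OF assms(1)]) (auto simp: entries_def assms(2))

lemma entries_GL_coords: "f \<in> fun_alg entries \<Longrightarrow> f \<in> fun_alg GL_coords"
  by (rule fun_alg_mono) (auto simp: GL_coords_def)

lemma mscale_nth [simp]: "mscale c A $ i $ j = c * A $ i $ j"
  by (simp add: mscale_def)

lemma mscale_mult_left: "mscale c A ** B = mscale c (A ** B)"
  and mscale_mult_right: "A ** mscale c B = mscale c (A ** B)"
  by (simp_all add: vec_eq_iff matrix_matrix_mult_def sum_distrib_left mult_ac)

lemma matrix_add_mult: "(A + B) ** C = A ** C + B ** (C :: 'k::field^'n^'n)"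
  and matrix_diff_mult: "(A - B) ** C = A ** C - B ** (C :: 'k::field^'n^'n)"
  and matrix_mult_diff: "C ** (A - B) = C ** A - C ** (B :: 'k::field^'n^'n)"
  by (simp_all add: vec_eq_iff matrix_matrix_mult_def sum.distrib sum_subtractf algebra_simps)

lemma lie_bracket_linear:
  "lie_bracket (X + Y) Z = lie_bracket X Z + lie_bracket Y Z"
  "lie_bracket Z (X + Y) = lie_bracket Z X + lie_bracket Z Y"
  "lie_bracket (X - Y) Z = lie_bracket X Z - lie_bracket Y Z"
  "lie_bracket Z (X - Y) = lie_bracket Z X - lie_bracket Z Y"
  "lie_bracket (mscale c X) Z = mscale c (lie_bracket X Z)"
  "lie_bracket Z (mscale c X) = mscale c (lie_bracket Z X)"
  by (simp_all add: lie_bracket_def matrix_add_mult matrix_add_ldistrib matrix_diff_mult matrix_mult_diff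
      mscale_mult_left mscale_mult_right mvs.scale_right_diff_distrib)

lemma lie_bracket_skew: "lie_bracket X Y = - lie_bracket Y X"
  by (simp add: lie_bracket_def)

lemma lie_bracket_self: "lie_bracket X X = 0"
  by (simp add: lie_bracket_def)

lemma matrix_inv_works:
  assumes "invertible (A :: 'k::field^'n^'n)"
  shows "A ** matrix_inv A = mat 1" "matrix_inv A ** A = mat 1"
  using someI_ex[of "\<lambda>B. A ** B = mat 1 \<and> B ** A = mat 1"] assms
  unfolding invertible_def matrix_inv_def by auto

lemma matrix_inv_unique:
  assumes "A ** B = mat 1" "B ** A = mat 1" shows "matrix_inv (A :: 'k::field^'n^'n) = B"
  using matrix_inv_works[of A] assms unfolding invertible_def
  by (metis matrix_mul_assoc matrix_mul_lid matrix_mul_rid)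

lemma group_GL: "group (GL :: ('k::field^'n^'n) monoid)"
proof (rule groupI)
  fix x y z :: "'k^'n^'n"
  assume "x \<in> carrier GL" "y \<in> carrier GL"
  then show "x \<otimes>\<^bsub>GL\<^esub> y \<in> carrier GL" by (simp add: GL_def invertible_mult)
next
  fix x :: "'k^'n^'n" assume "x \<in> carrier GL"
  then show "\<exists>y\<in>carrier GL. y \<otimes>\<^bsub>GL\<^esub> x = \<one>\<^bsub>GL\<^esub>"
    by (auto simp: GL_def invertible_def)
qed (auto simp: GL_def matrix_mul_assoc invertible_def intro: exI[of _ "mat 1"])

lemma subgroup_GL_D:
  assumes "subgroup G (GL :: ('k::field^'n^'n) monoid)"
  shows "mat 1 \<in> G" "A \<in> G \<Longrightarrow> invertible A" "A \<in> G \<Longrightarrow> B \<in> G \<Longrightarrow> A ** B \<in> G"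
    "A \<in> G \<Longrightarrow> matrix_inv A \<in> G"
proof -
  show "mat 1 \<in> G" using subgroup.one_closed[OF assms] by (simp add: GL_def)
  show inv: "A \<in> G \<Longrightarrow> invertible A" for A using subgroup.subset[OF assms] by (auto simp: GL_def)
  show "A \<in> G \<Longrightarrow> B \<in> G \<Longrightarrow> A ** B \<in> G"
    using subgroup.m_closed[OF assms] by (simp add: GL_def)
  assume A: "A \<in> G"
  then have "inv\<^bsub>GL\<^esub> A \<in> G" by (rule subgroup.m_inv_closed[OF assms])
  moreover have "inv\<^bsub>GL\<^esub> A = matrix_inv A"
    using matrix_inv_works[OF inv[OF A]] inv[OF A]
    by (intro group.inv_equality[OF group_GL]) (auto simp: GL_def invertible_def)
  ultimately show "matrix_inv A \<in> G" by simp
qed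

section \<open>Directional derivatives of polynomial functions\<close>

text \<open>Read off from the restriction to a line, as in the definition of \<open>Lie\<close>; in
  characteristic zero the polynomial is unique.\<close>

definition dir_deriv :: "('k::field^'n^'n \<Rightarrow> 'k) \<Rightarrow> 'k^'n^'n \<Rightarrow> 'k^'n^'n \<Rightarrow> 'k" where
  "dir_deriv f A X = coeff (THE p. \<forall>t. poly p t = f (A + mscale t X)) 1"

lemma dir_derivI:
  fixes f :: "'k::field_char_0^'n^'n \<Rightarrow> 'k"
  assumes "\<And>t. poly p t = f (A + mscale t X)"
  shows "dir_deriv f A X = coeff p 1"
proof -
  have "(THE p. \<forall>t. poly p t = f (A + mscale t X)) = p"
    using assms by (intro the_equality) (auto simp: poly_eq_poly_eq_iff[symmetric] fun_eq_iff)
  then show ?thesis by (simp add: dir_deriv_def)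
qed

lemma dir_deriv_poly:
  fixes f :: "'k::field_char_0^'n^'n \<Rightarrow> 'k"
  assumes "f \<in> fun_alg entries"
  obtains p where "\<And>t. poly p t = f (A + mscale t X)" "coeff p 0 = f A" "coeff p 1 = dir_deriv f A X"
proof -
  obtain p where p: "\<And>t. poly p t = f (A + mscale t X)"
    using line_restriction_poly[OF assms] by blast
  show ?thesis using p[of 0] by (intro that[of p] p) (simp_all add: poly_0_coeff_0 dir_derivI[OF p])
qed

context
  fixes f g :: "'k::field_char_0^'n^'n \<Rightarrow> 'k"
  assumes f: "f \<in> fun_alg entries"
begin

lemma dir_deriv_add:
  assumes g: "g \<in> fun_alg entries"
  shows "dir_deriv (\<lambda>A. f A + g A) A X = dir_deriv f A X + dir_deriv g A X"
proof -
  obtain p where p: "\<And>t. poly p t = f (A + mscale t X)" "coeff p 1 = dir_deriv f A X"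
    using dir_deriv_poly[OF f] by metis
  obtain q where q: "\<And>t. poly q t = g (A + mscale t X)" "coeff q 1 = dir_deriv g A X"
    using dir_deriv_poly[OF g] by metis
  show ?thesis using p q by (subst dir_derivI[of "p + q"]) auto
qed

lemma dir_deriv_mult:
  assumes g: "g \<in> fun_alg entries"
  shows "dir_deriv (\<lambda>A. f A * g A) A X = dir_deriv f A X * g A + f A * dir_deriv g A X"
proof -
  obtain p where p: "\<And>t. poly p t = f (A + mscale t X)" "coeff p 0 = f A" "coeff p 1 = dir_deriv f A X"
    using dir_deriv_poly[OF f] by metis
  obtain q where q: "\<And>t. poly q t = g (A + mscale t X)" "coeff q 0 = g A" "coeff q 1 = dir_deriv g A X"
    using dir_deriv_poly[OF g] by metis
  show ?thesis using p q by (subst dir_derivI[of "p * q"]) (auto simp: coeff_mult algebra_simps)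
qed

lemma dir_deriv_comp_affine:
  assumes "\<And>t. M (A + mscale t X) = B + mscale t Y"
  shows "dir_deriv (\<lambda>A. f (M A)) A X = dir_deriv f B Y"
proof -
  obtain p where p: "\<And>t. poly p t = f (B + mscale t Y)" "coeff p 1 = dir_deriv f B Y"
    using dir_deriv_poly[OF f] by metis
  show ?thesis using p assms by (subst dir_derivI[of p]) auto
qed

end

lemma dir_deriv_const [simp]: "dir_deriv (\<lambda>_. c :: 'k::field_char_0) A X = 0"
  by (subst dir_derivI[of "[:c:]"]) auto

lemma dir_deriv_entry [simp]: "dir_deriv (\<lambda>A. A $ i $ j) A (X :: 'k::field_char_0^'n^'n) = X $ i $ j"
  by (subst dir_derivI[of "[:A $ i $ j, X $ i $ j:]"]) auto

lemma dir_deriv_linear: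
  fixes f :: "'k::field_char_0^'n^'n \<Rightarrow> 'k"
  assumes "f \<in> fun_alg entries"
  shows "dir_deriv f A (X + Y) = dir_deriv f A X + dir_deriv f A Y" (is ?add)
    and "dir_deriv f A (mscale c X) = c * dir_deriv f A X" (is ?scale)
proof -
  have "?add \<and> ?scale"
    using assms
  proof induction
    case (gen f)
    then show ?case by (auto simp: entries_def)
  qed (simp_all add: dir_deriv_add dir_deriv_mult algebra_simps)
  then show ?add ?scale by blast+
qed

lemma dir_deriv_power:
  fixes f :: "'k::field_char_0^'n^'n \<Rightarrow> 'k"
  assumes f: "f \<in> fun_alg entries" and 1: "f A = 1"
  shows "dir_deriv (\<lambda>A. f A ^ k) A X = of_nat k * dir_deriv f A X"
proof (induction k)
  case (Suc k)
  then show ?case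
    using dir_deriv_mult[OF f fun_alg_power[OF f, of k], of A X] by (simp add: 1 algebra_simps)
qed simp

lemma matrix_unit_sum:
  fixes X :: "'k::field^'n^'n"
  shows "X = (\<Sum>i\<in>UNIV. \<Sum>j\<in>UNIV. mscale (X $ i $ j) (\<chi> k l. if k = i \<and> l = j then 1 else 0))"
  unfolding vec_eq_iff
proof (intro allI)
  fix k l
  let ?E = "\<lambda>i j. (\<chi> k l. if k = i \<and> l = j then 1 else 0) :: 'k^'n^'n"
  have "(\<Sum>i\<in>UNIV. \<Sum>j\<in>UNIV. mscale (X $ i $ j) (?E i j)) $ k $ l =
    (\<Sum>i\<in>UNIV. \<Sum>j\<in>UNIV. X $ i $ j * (if k = i \<and> l = j then 1 else 0))"
    by simp
  also have "\<dots> = (\<Sum>i\<in>UNIV. if i = k then (\<Sum>j\<in>UNIV. if j = l then X $ i $ j else 0) else 0)"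
    by (rule sum.cong) (auto simp: mult_delta_right)
  also have "\<dots> = X $ k $ l" by simp
  finally show "X $ k $ l = (\<Sum>i\<in>UNIV. \<Sum>j\<in>UNIV. mscale (X $ i $ j) (?E i j)) $ k $ l" ..
qed

lemma linear_coefficients:
  fixes \<Gamma> :: "'k::field^'n^'n \<Rightarrow> 'k"
  assumes add: "\<And>X Y. \<Gamma> (X + Y) = \<Gamma> X + \<Gamma> Y" and scale: "\<And>c X. \<Gamma> (mscale c X) = c * \<Gamma> X"
  shows "\<exists>G. \<forall>X. \<Gamma> X = (\<Sum>i\<in>UNIV. \<Sum>j\<in>UNIV. G i j * X $ i $ j)"
proof (intro exI allI)
  fix X
  let ?E = "\<lambda>i j. (\<chi> k l. if k = i \<and> l = j then 1 else 0) :: 'k^'n^'n"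
  have "\<Gamma> 0 = 0" using scale[of 0 0] by simp
  then have "\<Gamma> (sum F I) = (\<Sum>i\<in>I. \<Gamma> (F i))" for F :: "'n \<Rightarrow> _" and I
    by (induction I rule: infinite_finite_induct) (auto simp: add)
  then show "\<Gamma> X = (\<Sum>i\<in>UNIV. \<Sum>j\<in>UNIV. \<Gamma> (?E i j) * X $ i $ j)"
    using arg_cong[OF matrix_unit_sum[of X], of \<Gamma>] by (simp add: scale mult.commute)
qed

lemma linear_fun_alg:
  fixes \<Gamma> :: "'k::field_char_0^'n^'n \<Rightarrow> 'k"
  assumes add: "\<And>X Y. \<Gamma> (X + Y) = \<Gamma> X + \<Gamma> Y" and scale: "\<And>c X. \<Gamma> (mscale c X) = c * \<Gamma> X"
  shows "\<Gamma> \<in> fun_alg entries" and "dir_deriv \<Gamma> A X = \<Gamma> X"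
proof -
  obtain G where "\<forall>X. \<Gamma> X = (\<Sum>i\<in>UNIV. \<Sum>j\<in>UNIV. G i j * X $ i $ j)"
    using linear_coefficients[of \<Gamma>, OF add scale] ..
  then have "\<Gamma> = (\<lambda>X. \<Sum>i\<in>UNIV. \<Sum>j\<in>UNIV. G i j * X $ i $ j)" by (simp add: fun_eq_iff)
  moreover have "(\<lambda>X. \<Sum>i\<in>UNIV. \<Sum>j\<in>UNIV. G i j * X $ i $ j) \<in> fun_alg entries"
    by (intro fun_alg_sum fun_alg_scale entry_fun_alg)
  ultimately show "\<Gamma> \<in> fun_alg entries" by simp
  show "dir_deriv \<Gamma> A X = \<Gamma> X"
    by (subst dir_derivI[of "[:\<Gamma> A, \<Gamma> X:]"]) (auto simp: add scale)
qed

lemma Lie_iff: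
  fixes G :: "('k::field_char_0^'n^'n) set"
  shows "X \<in> Lie G \<longleftrightarrow> (\<forall>f\<in>fun_alg entries. (\<forall>g\<in>G. f g = 0) \<longrightarrow> dir_deriv f (mat 1) X = 0)"
  unfolding Lie_def mem_Collect_eq by (metis dir_derivI dir_deriv_poly)

lemma LieD:
  fixes G :: "('k::field_char_0^'n^'n) set"
  assumes "X \<in> Lie G" "f \<in> fun_alg entries" "\<And>g. g \<in> G \<Longrightarrow> f g = 0"
  shows "dir_deriv f (mat 1) X = 0"
  using assms unfolding Lie_iff by blast

lemma subspace_Lie: "mvs.subspace (Lie (G :: ('k::field_char_0^'n^'n) set))"
proof (rule mvs.subspaceI)
  show "0 \<in> Lie G"
    unfolding Lie_iff
  proof (intro ballI impI)
    fix f :: "'k^'n^'n \<Rightarrow> 'k" assume "f \<in> fun_alg entries"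
    from dir_deriv_linear(2)[OF this, of "mat 1" 0 0] show "dir_deriv f (mat 1) 0 = 0" by simp
  qed
qed (simp_all add: Lie_iff dir_deriv_linear)

lemma Lie_mono: "G \<subseteq> H \<Longrightarrow> Lie G \<subseteq> Lie (H :: ('k::field_char_0^'n^'n) set)"
  unfolding Lie_iff subset_iff by blast

text \<open>Derivative at the identity of a function that is regular on \<open>GL\<close>, that is, of the form
  \<open>P / det\<^sup>k\<close> with \<open>P\<close> a polynomial function; the quotient rule gives the formula below.\<close>

definition regular_deriv :: "'k::field_char_0^'n^'n \<Rightarrow> ('k^'n^'n \<Rightarrow> 'k) \<Rightarrow> 'k \<Rightarrow> bool" where
  "regular_deriv X f c \<longleftrightarrow> (\<exists>k. \<exists>P\<in>fun_alg entries. (\<forall>A. invertible A \<longrightarrow> P A = det A ^ k * f A) \<and>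
     c = dir_deriv P (mat 1) X - of_nat k * dir_deriv det (mat 1) X * f (mat 1))"

lemma det_entries: "det \<in> fun_alg (entries :: ('k::field^'n^'n \<Rightarrow> 'k) set)"
  using det_fun_alg[of "\<lambda>x. x" entries, OF entry_fun_alg] .

lemma invertible_1: "invertible (mat 1 :: 'k::field^'n^'n)"
  by (auto simp: invertible_def intro: exI[of _ "mat 1"])

lemma regular_deriv_poly:
  "P \<in> fun_alg entries \<Longrightarrow> regular_deriv X P (dir_deriv P (mat 1) X)"
  unfolding regular_deriv_def by (intro exI[of _ 0] bexI[of _ P]) auto

lemma regular_deriv_const: "regular_deriv X (\<lambda>_. c) 0"
  using regular_deriv_poly[OF fun_alg.const, of X c] by simp

lemma regular_deriv_entry: "regular_deriv X (\<lambda>A. A $ i $ j) (X $ i $ j)"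
  using regular_deriv_poly[OF entry_fun_alg, of X i j] by simp

lemma regular_deriv_inverse_det: "\<exists>c. regular_deriv X (\<lambda>A. inverse (det A)) c"
  unfolding regular_deriv_def
  by (intro exI bexI[of _ "\<lambda>_. 1"] conjI[rotated, OF refl] exI[of _ 1] fun_alg.const)
    (simp add: invertible_det_nz)

lemma regular_deriv_add:
  assumes "regular_deriv X f c" "regular_deriv X g d"
  shows "regular_deriv X (\<lambda>A. f A + g A) (c + d)"
proof -
  obtain k P where P: "P \<in> fun_alg entries" "\<forall>A. invertible A \<longrightarrow> P A = det A ^ k * f A"
      "c = dir_deriv P (mat 1) X - of_nat k * dir_deriv det (mat 1) X * f (mat 1)"
    using assms unfolding regular_deriv_def by blast
  obtain l Q where Q: "Q \<in> fun_alg entries" "\<forall>A. invertible A \<longrightarrow> Q A = det A ^ l * g A"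
      "d = dir_deriv Q (mat 1) X - of_nat l * dir_deriv det (mat 1) X * g (mat 1)"
    using assms unfolding regular_deriv_def by blast
  have 1: "P (mat 1) = f (mat 1)" "Q (mat 1) = g (mat 1)"
    using P(2) Q(2) invertible_1 by auto
  let ?R = "\<lambda>A. det A ^ l * P A + det A ^ k * Q A"
  note dp = fun_alg_power[OF det_entries]
  note R = fun_alg.mult[OF dp P(1), of l] fun_alg.mult[OF dp Q(1), of k]
  show ?thesis
    unfolding regular_deriv_def
  proof (intro exI[of _ "k + l"] bexI[of _ ?R] conjI allI impI)
    show "?R \<in> fun_alg entries" using R by (rule fun_alg.add)
    show "?R A = det A ^ (k + l) * (f A + g A)" if "invertible A" for A
      using that P(2) Q(2) by (simp add: power_add algebra_simps)
    have "dir_deriv ?R (mat 1) X = of_nat l * dir_deriv det (mat 1) X * f (mat 1) + dir_deriv P (mat 1) X +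
        (of_nat k * dir_deriv det (mat 1) X * g (mat 1) + dir_deriv Q (mat 1) X)"
      by (simp add: dir_deriv_add[OF R] dir_deriv_mult[OF dp P(1)] dir_deriv_mult[OF dp Q(1)]
          dir_deriv_power[OF det_entries] 1)
    then show "c + d = dir_deriv ?R (mat 1) X - of_nat (k + l) * dir_deriv det (mat 1) X * (f (mat 1) + g (mat 1))"
      by (simp add: P(3) Q(3) algebra_simps)
  qed
qed

lemma regular_deriv_mult:
  assumes "regular_deriv X f c" "regular_deriv X g d"
  shows "regular_deriv X (\<lambda>A. f A * g A) (c * g (mat 1) + f (mat 1) * d)"
proof -
  obtain k P where P: "P \<in> fun_alg entries" "\<forall>A. invertible A \<longrightarrow> P A = det A ^ k * f A"
      "c = dir_deriv P (mat 1) X - of_nat k * dir_deriv det (mat 1) X * f (mat 1)"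
    using assms unfolding regular_deriv_def by blast
  obtain l Q where Q: "Q \<in> fun_alg entries" "\<forall>A. invertible A \<longrightarrow> Q A = det A ^ l * g A"
      "d = dir_deriv Q (mat 1) X - of_nat l * dir_deriv det (mat 1) X * g (mat 1)"
    using assms unfolding regular_deriv_def by blast
  have 1: "P (mat 1) = f (mat 1)" "Q (mat 1) = g (mat 1)"
    using P(2) Q(2) invertible_1 by auto
  show ?thesis
    unfolding regular_deriv_def
  proof (intro exI[of _ "k + l"] bexI[of _ "\<lambda>A. P A * Q A"] conjI allI impI)
    show "(\<lambda>A. P A * Q A) \<in> fun_alg entries" using P(1) Q(1) by (rule fun_alg.mult)
    show "P A * Q A = det A ^ (k + l) * (f A * g A)" if "invertible A" for A
      using that P(2) Q(2) by (simp add: power_add algebra_simps)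
    show "c * g (mat 1) + f (mat 1) * d = dir_deriv (\<lambda>A. P A * Q A) (mat 1) X -
        of_nat (k + l) * dir_deriv det (mat 1) X * (f (mat 1) * g (mat 1))"
      by (simp add: dir_deriv_mult[OF P(1) Q(1)] P(3) Q(3) 1 algebra_simps)
  qed
qed

lemma regular_deriv_sum:
  "(\<And>i. i \<in> I \<Longrightarrow> regular_deriv X (f i) (c i)) \<Longrightarrow> regular_deriv X (\<lambda>A. \<Sum>i\<in>I. f i A) (\<Sum>i\<in>I. c i)"
  by (induction I rule: infinite_finite_induct) (auto intro: regular_deriv_const regular_deriv_add)

lemma regular_deriv_minus: "regular_deriv X f c \<Longrightarrow> regular_deriv X (\<lambda>A. - f A) (- c)"
  using regular_deriv_mult[OF regular_deriv_const[of X "-1"], of f c] by simp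

lemma regular_deriv_diff:
  "regular_deriv X f c \<Longrightarrow> regular_deriv X g d \<Longrightarrow> regular_deriv X (\<lambda>A. f A - g A) (c - d)"
  using regular_deriv_add[OF _ regular_deriv_minus, of X f c g d] by simp

lemma regular_deriv_exists:
  assumes "f \<in> fun_alg GL_coords" shows "\<exists>c. regular_deriv X f c"
  using assms
proof induction
  case (gen f)
  then show ?case
    using regular_deriv_entry regular_deriv_inverse_det by (auto simp: GL_coords_def entries_def)
qed (blast intro: regular_deriv_const regular_deriv_add regular_deriv_mult)+

lemma regular_deriv_matrix_mult:
  assumes "\<And>i j. regular_deriv X (\<lambda>A. M A $ i $ j) (M' $ i $ j)"
    "\<And>i j. regular_deriv X (\<lambda>A. N A $ i $ j) (N' $ i $ j)"
  shows "regular_deriv X (\<lambda>A. (M A ** N A) $ i $ j) ((M' ** N (mat 1) + M (mat 1) ** N') $ i $ j)"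
  using regular_deriv_sum[of UNIV X "\<lambda>k A. M A $ i $ k * N A $ k $ j", OF regular_deriv_mult[OF assms]]
  by (simp add: matrix_matrix_mult_def sum.distrib)

lemma regular_deriv_comp:
  assumes F: "F \<in> fun_alg entries"
    and M: "\<And>i j. regular_deriv X (\<lambda>A. M A $ i $ j) (M' $ i $ j)"
  shows "regular_deriv X (\<lambda>A. F (M A)) (dir_deriv F (M (mat 1)) M')"
  using F
proof induction
  case (gen f)
  then show ?case using M by (auto simp: entries_def)
next
  case (const c)
  then show ?case by (simp add: regular_deriv_const)
next
  case (add f g)
  then show ?case using regular_deriv_add[OF add.IH] by (simp add: dir_deriv_add)
next
  case (mult f g)
  then show ?case using regular_deriv_mult[OF mult.IH] by (simp add: dir_deriv_mult)
qed

text \<open>The device by which identities on a group are differentiated to identities on its Lie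
  algebra. The numerator \<open>P\<close> vanishes on \<open>G\<close>, so its derivative is zero by
  the definition of \<open>Lie\<close>, and the correction term contains the value of
  \<open>f\<close> at the identity.\<close>

lemma regular_deriv_vanish:
  assumes X: "X \<in> Lie G" and 1: "mat 1 \<in> G" and inv: "\<And>A. A \<in> G \<Longrightarrow> invertible A"
    and f: "regular_deriv X f c" and 0: "\<And>A. A \<in> G \<Longrightarrow> f A = 0"
  shows "c = 0"
proof -
  obtain k P where P: "P \<in> fun_alg entries" "\<forall>A. invertible A \<longrightarrow> P A = det A ^ k * f A"
      "c = dir_deriv P (mat 1) X - of_nat k * dir_deriv det (mat 1) X * f (mat 1)"
    using f unfolding regular_deriv_def by blast
  have "\<forall>A\<in>G. P A = 0" using P(2) inv 0 by auto
  then have "dir_deriv P (mat 1) X = 0" using X P(1) unfolding Lie_iff by blast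
  then show ?thesis using P(3) 0[OF 1] by simp
qed

text \<open>Multiplied by \<open>det\<close>, a polynomial function that vanishes on the invertible
  matrices is zero everywhere, and the product rule at the identity gives the claim. So identities
  between invertible matrices can be differentiated in every direction.\<close>

lemma Lie_GL: "X \<in> Lie {A :: 'k::field_char_0^'n^'n. invertible A}"
  unfolding Lie_iff
proof (intro ballI impI)
  fix f :: "'k^'n^'n \<Rightarrow> 'k"
  assume f: "f \<in> fun_alg entries" and 0: "\<forall>g\<in>{A. invertible A}. f g = 0"
  have "(\<lambda>A. det A * f A) = (\<lambda>_. 0)" using 0 by (auto simp: invertible_det_nz fun_eq_iff)
  then have "dir_deriv det (mat 1) X * f (mat 1) + det (mat 1 :: 'k^'n^'n) * dir_deriv f (mat 1) X = 0"
    using dir_deriv_mult[OF det_entries f, of "mat 1" X] by simp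
  moreover have "f (mat 1) = 0" using 0 invertible_1 by blast
  ultimately show "dir_deriv f (mat 1) X = 0" by simp
qed

text \<open>Cramer's rule for the column number \<open>j\<close> of the inverse.\<close>

lemma matrix_inv_regular:
  fixes i j :: "'n::finite"
  shows "\<exists>f\<in>fun_alg (GL_coords :: ('k::field^'n^'n \<Rightarrow> 'k) set). \<forall>A. invertible A \<longrightarrow> f A = matrix_inv A $ i $ j"
proof (intro bexI[of _ "\<lambda>A. inverse (det A) * det (\<chi> k l. if l = i then (if k = j then 1 else 0) else A $ k $ l)"] allI impI)
  show "(\<lambda>A. inverse (det A) * det (\<chi> k l. if l = i then (if k = j then 1 else 0) else A $ k $ l) :: 'k) \<in> fun_alg GL_coords"
  proof (intro fun_alg.mult det_fun_alg)
    show "(\<lambda>A. inverse (det A)) \<in> fun_alg GL_coords" by (rule fun_alg.gen) (simp add: GL_coords_def)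
    show "(\<lambda>A. (\<chi> k l. if l = i then (if k = j then 1 else 0) else A $ k $ l) $ k $ l :: 'k) \<in> fun_alg GL_coords" for k l
      by (cases "l = i") (simp_all add: fun_alg.const entries_GL_coords entry_fun_alg)
  qed
  fix A :: "'k^'n^'n" assume A: "invertible A"
  let ?b = "axis j 1 :: 'k^'n"
  have "A *v (matrix_inv A *v ?b) = ?b"
    by (simp add: matrix_vector_mul_assoc matrix_inv_works[OF A])
  then have "matrix_inv A *v ?b = (\<chi> k. det (\<chi> i j. if j = k then ?b $ i else A $ i $ j) / det A)"
    using A by (subst (asm) cramer) (simp_all add: invertible_det_nz)
  moreover have "(matrix_inv A *v ?b) $ i = matrix_inv A $ i $ j"
    by (simp add: matrix_vector_mult_def axis_def if_distrib cong: if_cong)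
  ultimately have "matrix_inv A $ i $ j = det (\<chi> k l. if l = i then ?b $ k else A $ k $ l) / det A"
    by simp
  moreover have "?b $ k = (if k = j then 1 else 0)" for k by (simp add: axis_def)
  ultimately have "matrix_inv A $ i $ j = det (\<chi> k l. if l = i then (if k = j then 1 else 0) else A $ k $ l) / det A"
    by (simp only:)
  then show "inverse (det A) * det (\<chi> k l. if l = i then (if k = j then 1 else 0) else A $ k $ l) = matrix_inv A $ i $ j"
    by (simp add: divide_inverse mult.commute)
qed

lemma regular_deriv_cong:
  assumes "regular_deriv X f c" "\<And>A. invertible A \<Longrightarrow> f A = g A"
  shows "regular_deriv X g c"
proof -
  have "f (mat 1) = g (mat 1)" using assms(2)[OF invertible_1] .
  then show ?thesis using assms unfolding regular_deriv_def by simp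
qed

lemma matrix_inv_1 [simp]: "matrix_inv (mat 1 :: 'k::field^'n^'n) = mat 1"
  by (rule matrix_inv_unique) auto

text \<open>Regularity of the inverse provides some derivative \<open>C\<close>; differentiating the
  identity \<open>matrix_inv A ** A = mat 1\<close> then determines it.\<close>

lemma regular_deriv_matrix_inv:
  fixes X :: "'k::field_char_0^'n^'n"
  shows "regular_deriv X (\<lambda>A. matrix_inv A $ i $ j) ((- X) $ i $ j)"
proof -
  have ex: "\<exists>c. regular_deriv X (\<lambda>A. matrix_inv A $ i $ j) c" for i j
  proof -
    obtain f where f: "f \<in> fun_alg GL_coords" "\<And>A :: 'k^'n^'n. invertible A \<Longrightarrow> f A = matrix_inv A $ i $ j"
      using matrix_inv_regular[of i j] by blast
    from regular_deriv_exists[OF f(1)] obtain c where "regular_deriv X f c" ..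
    from regular_deriv_cong[OF this f(2)] show ?thesis by blast
  qed
  define C where "C = (\<chi> i j. SOME c. regular_deriv X (\<lambda>A. matrix_inv A $ i $ j) c)"
  have C: "regular_deriv X (\<lambda>A. matrix_inv A $ i $ j) (C $ i $ j)" for i j
    using someI_ex[OF ex[of i j]] by (simp add: C_def)
  have "(C ** mat 1 + mat 1 ** X) $ i $ j - 0 = 0" for i j
  proof (rule regular_deriv_vanish[OF Lie_GL])
    show "regular_deriv X (\<lambda>A. (matrix_inv A ** A) $ i $ j - (mat 1 :: 'k^'n^'n) $ i $ j) ((C ** mat 1 + mat 1 ** X) $ i $ j - 0)"
      using regular_deriv_matrix_mult[OF C, of "\<lambda>A. A" X] regular_deriv_entry[of X]
      by (intro regular_deriv_diff regular_deriv_const) simp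
  qed (auto simp: invertible_1 matrix_inv_works)
  then have "C + X = 0" by (simp add: vec_eq_iff)
  then have "C = - X" by (simp add: eq_neg_iff_add_eq_0)
  with C show ?thesis by simp
qed

lemma regular_deriv_conj:
  fixes X :: "'k::field_char_0^'n^'n"
  assumes "F \<in> fun_alg entries"
  shows "regular_deriv X (\<lambda>A. F (A ** v ** matrix_inv A)) (dir_deriv F v (lie_bracket X v))"
    and "regular_deriv X (\<lambda>A. F (matrix_inv A ** v ** A)) (dir_deriv F v (lie_bracket v X))"
proof -
  have v: "regular_deriv X (\<lambda>A. v $ i $ j) ((0 :: 'k^'n^'n) $ i $ j)" for i j
    using regular_deriv_const[of X "v $ i $ j"] by simp
  have 0: "v ** (0 :: 'k^'n^'n) = 0" "(0 :: 'k^'n^'n) ** v = 0" for v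
    by (simp_all add: vec_eq_iff matrix_matrix_mult_def)
  have m: "A ** - B = - (A ** B)" "- A ** B = - (A ** B)" for A B :: "'k^'n^'n"
    by (simp_all add: vec_eq_iff matrix_matrix_mult_def sum_negf)
  have *: "regular_deriv X (\<lambda>A. (A ** v) $ i $ j) ((X ** v) $ i $ j)" for i j
    using regular_deriv_matrix_mult[of X "\<lambda>A. A" X "\<lambda>A. v" 0, OF regular_deriv_entry v] by (simp add: 0)
  have "regular_deriv X (\<lambda>A. (A ** v ** matrix_inv A) $ i $ j) (lie_bracket X v $ i $ j)" for i j
    using regular_deriv_matrix_mult[of X "\<lambda>A. A ** v" "X ** v" matrix_inv "- X", OF * regular_deriv_matrix_inv]
    by (simp add: lie_bracket_def m)
  from regular_deriv_comp[of F X "\<lambda>A. A ** v ** matrix_inv A", OF assms this]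
  show "regular_deriv X (\<lambda>A. F (A ** v ** matrix_inv A)) (dir_deriv F v (lie_bracket X v))" by simp
  have *: "regular_deriv X (\<lambda>A. (matrix_inv A ** v) $ i $ j) ((- (X ** v)) $ i $ j)" for i j
    using regular_deriv_matrix_mult[of X matrix_inv "- X" "\<lambda>A. v" 0, OF regular_deriv_matrix_inv v] by (simp add: 0 m)
  have "regular_deriv X (\<lambda>A. (matrix_inv A ** v ** A) $ i $ j) (lie_bracket v X $ i $ j)" for i j
    using regular_deriv_matrix_mult[of X "\<lambda>A. matrix_inv A ** v" "- (X ** v)" "\<lambda>A. A" X, OF * regular_deriv_entry]
    by (simp add: lie_bracket_def)
  from regular_deriv_comp[of F X "\<lambda>A. matrix_inv A ** v ** A", OF assms this]
  show "regular_deriv X (\<lambda>A. F (matrix_inv A ** v ** A)) (dir_deriv F v (lie_bracket v X))" by simp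
qed

lemma conj_Lie:
  fixes H :: "('k::field_char_0^'n^'n) set"
  assumes g: "invertible g" and H: "\<And>h. h \<in> H \<Longrightarrow> g ** h ** matrix_inv g \<in> H" and v: "v \<in> Lie H"
  shows "g ** v ** matrix_inv g \<in> Lie H"
  unfolding Lie_iff
proof (intro ballI impI)
  fix f assume f: "f \<in> fun_alg entries" "\<forall>h\<in>H. f h = 0"
  let ?c = "\<lambda>A. g ** A ** matrix_inv g"
  have "?c (mat 1 + mscale t v) = mat 1 + mscale t (?c v)" for t
    by (simp add: matrix_add_mult matrix_add_ldistrib mscale_mult_left mscale_mult_right matrix_inv_works g)
  from dir_deriv_comp_affine[of f ?c "mat 1" v "mat 1" "?c v", OF f(1) this, symmetric]
  have "dir_deriv f (mat 1) (?c v) = dir_deriv (\<lambda>A. f (?c A)) (mat 1) v" .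
  also have "\<dots> = 0"
  proof (rule v[unfolded Lie_iff, rule_format])
    show "(\<lambda>A. f (?c A)) \<in> fun_alg entries"
      by (intro fun_alg_entries_comp[OF f(1)] matrix_mult_fun_alg entry_fun_alg fun_alg.const)
    show "f (?c h) = 0" if "h \<in> H" for h using f(2) H[OF that] by simp
  qed
  finally show "dir_deriv f (mat 1) (?c v) = 0" .
qed

text \<open>The differential \<Gamma> of an equation of \<open>H\<close> vanishes on all conjugates
  of \<open>v\<close> by elements of \<open>G\<close>; differentiating in the direction
  \<open>X\<close> gives \<Gamma> [X, v] = 0. The case \<open>G = H\<close> makes
  \<open>Lie H\<close> a subalgebra, and a normalised subgroup \<open>H\<close> gives a stable
  subspace.\<close>

lemma lie_bracket_Lie:
  fixes G H :: "('k::field_char_0^'n^'n) set"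
  assumes G: "mat 1 \<in> G" "\<And>A. A \<in> G \<Longrightarrow> invertible A"
    and H: "\<And>g h. g \<in> G \<Longrightarrow> h \<in> H \<Longrightarrow> g ** h ** matrix_inv g \<in> H"
    and X: "X \<in> Lie G" and v: "v \<in> Lie H"
  shows "lie_bracket X v \<in> Lie H"
  unfolding Lie_iff
proof (intro ballI impI)
  fix f assume f: "f \<in> fun_alg entries" "\<forall>h\<in>H. f h = 0"
  let ?\<Gamma> = "dir_deriv f (mat 1)"
  note lin = linear_fun_alg[of ?\<Gamma>, OF dir_deriv_linear[OF f(1)]]
  have "?\<Gamma> (A ** v ** matrix_inv A) = 0" if "A \<in> G" for A
  proof -
    have "A ** v ** matrix_inv A \<in> Lie H" by (rule conj_Lie[OF G(2)[OF that] H[OF that] v])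
    from LieD[OF this f(1)] f(2) show ?thesis by blast
  qed
  from regular_deriv_vanish[OF X G regular_deriv_conj(1)[OF lin(1)] this]
  show "?\<Gamma> (lie_bracket X v) = 0" by (simp add: lin(2))
qed

text \<open>Commuting with a fixed matrix is a linear condition and passes from \<open>U\<close> to
  \<open>Lie U\<close>. This is applied twice, first to an element of \<open>U\<close>, then to an
  element of \<open>Lie U\<close>.\<close>

lemma lie_bracket_Lie_commute:
  fixes U :: "('k::field_char_0^'n^'n) set"
  assumes U: "\<And>u v. u \<in> U \<Longrightarrow> v \<in> U \<Longrightarrow> u ** v = v ** u" and XY: "X \<in> Lie U" "Y \<in> Lie U"
  shows "lie_bracket X Y = 0"
proof -
  have *: "B ** X = X ** B" if B: "\<And>u. u \<in> U \<Longrightarrow> B ** u = u ** B" and X: "X \<in> Lie U" for B X :: "'k^'n^'n"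
  proof -
    have "(B ** X - X ** B) $ i $ j = 0" for i j
    proof -
      define f where "f A = (B ** A - A ** B) $ i $ j" for A
      have "f (X + Y) = f X + f Y" "f (mscale c X) = c * f X" for X Y c
        unfolding f_def matrix_add_mult matrix_add_ldistrib mscale_mult_left mscale_mult_right
        by (simp_all add: algebra_simps)
      note f = linear_fun_alg[of f, OF this]
      have "\<forall>u\<in>U. f u = 0" unfolding f_def using B by (metis diff_self zero_index)
      then have "dir_deriv f (mat 1) X = 0" using X f(1) unfolding Lie_iff by blast
      then show ?thesis unfolding f(2) unfolding f_def .
    qed
    then show ?thesis by (simp add: vec_eq_iff)
  qed
  have "u ** X = X ** u" if "u \<in> U" for u by (rule *[OF U[OF that] XY(1)])
  from *[OF this[symmetric] XY(2)] have "X ** Y = Y ** X" .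
  then show ?thesis by (simp add: lie_bracket_def)
qed

text \<open>The equations of \<open>L\<close> may involve the inverse of \<open>det\<close>; a power
  of \<open>det\<close> clears it, so points of \<open>L\<close> are recognised by polynomial
  equations.\<close>

lemma algebraic_group_closed:
  fixes L :: "('k::field_char_0^'n^'n) set"
  assumes L: "algebraic_group L" and h: "invertible h"
    and van: "\<And>P. P \<in> fun_alg entries \<Longrightarrow> (\<And>g. g \<in> L \<Longrightarrow> P g = 0) \<Longrightarrow> P h = 0"
  shows "h \<in> L"
proof -
  obtain F where F: "F \<subseteq> fun_alg GL_coords" "L = {x\<in>carrier GL. \<forall>f\<in>F. f x = 0}"
    using L unfolding algebraic_group_def zariski_GL_def closedin_zariski by blast
  have "f h = 0" if "f \<in> F" for f
  proof -
    \<comment> \<open>\<open>regular_deriv\<close> is invoked for the polynomial numerator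
      \<open>P\<close> that it provides.\<close>
    obtain c where "regular_deriv 0 f c" using regular_deriv_exists F(1) \<open>f \<in> F\<close> by blast
    then obtain k P where P: "P \<in> fun_alg entries" "\<And>A. invertible A \<Longrightarrow> P A = det A ^ k * f A"
      unfolding regular_deriv_def by blast
    have "P g = 0" if "g \<in> L" for g
      using that \<open>f \<in> F\<close> P(2)[of g] unfolding F(2) by (simp add: GL_def)
    then have "P h = 0" using van P(1) by blast
    then show ?thesis using P(2)[OF h] h by (simp add: invertible_det_nz)
  qed
  then show ?thesis using F(2) h by (simp add: GL_def)
qed

section \<open>The formal exponential\<close>

text \<open>The left-invariant vector field of \<open>x\<close>. Because left translations preserve
  the ideal of a group \<open>L\<close>, this derivation maps the ideal to itself if
  \<open>x\<close> is in \<open>Lie L\<close>.\<close>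

definition invariant_deriv :: "'k::field_char_0^'n^'n \<Rightarrow> ('k^'n^'n \<Rightarrow> 'k) \<Rightarrow> 'k^'n^'n \<Rightarrow> 'k" where
  "invariant_deriv x F = (\<lambda>g. dir_deriv F g (g ** x))"

lemma invariant_deriv_simps:
  fixes x :: "'k::field_char_0^'n^'n"
  shows "invariant_deriv x (\<lambda>_. c) = (\<lambda>_. 0)"
    and "f \<in> fun_alg entries \<Longrightarrow> g \<in> fun_alg entries \<Longrightarrow>
      invariant_deriv x (\<lambda>A. f A + g A) = (\<lambda>A. invariant_deriv x f A + invariant_deriv x g A)"
    and "f \<in> fun_alg entries \<Longrightarrow> g \<in> fun_alg entries \<Longrightarrow>
      invariant_deriv x (\<lambda>A. f A * g A) = (\<lambda>A. invariant_deriv x f A * g A + f A * invariant_deriv x g A)"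
    and "invariant_deriv x (\<lambda>A. A $ i $ j) = (\<lambda>A. (A ** x) $ i $ j)"
  by (simp_all add: invariant_deriv_def dir_deriv_add dir_deriv_mult)

lemma invariant_deriv_fun_alg:
  fixes x :: "'k::field_char_0^'n^'n"
  assumes "f \<in> fun_alg entries" shows "invariant_deriv x f \<in> fun_alg entries"
  using assms
proof induction
  case (gen f)
  then obtain i j where "f = (\<lambda>A. A $ i $ j)" by (auto simp: entries_def)
  then show ?case
    by (simp add: invariant_deriv_simps matrix_mult_fun_alg entry_fun_alg fun_alg.const)
qed (auto simp: invariant_deriv_simps intro: fun_alg.intros)

lemma invariant_deriv_vanish:
  fixes x :: "'k::field_char_0^'n^'n"
  assumes L: "subgroup L GL" and x: "x \<in> Lie L"
    and f: "f \<in> fun_alg entries" "\<And>g. g \<in> L \<Longrightarrow> f g = 0" and g: "g \<in> L"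
  shows "invariant_deriv x f g = 0"
proof -
  have "dir_deriv (\<lambda>A. f (g ** A)) (mat 1) x = 0"
  proof (rule LieD[OF x])
    show "(\<lambda>A. f (g ** A)) \<in> fun_alg entries"
      by (intro fun_alg_entries_comp[OF f(1)] matrix_mult_fun_alg entry_fun_alg fun_alg.const)
    show "f (g ** h) = 0" if "h \<in> L" for h using f(2) subgroup_GL_D(3)[OF L g that] by blast
  qed
  moreover have "dir_deriv (\<lambda>A. f (g ** A)) (mat 1) x = dir_deriv f g (g ** x)"
    by (rule dir_deriv_comp_affine[OF f(1)]) (simp add: matrix_add_ldistrib mscale_mult_right)
  ultimately show ?thesis by (simp add: invariant_deriv_def)
qed

text \<open>The Taylor expansion of \<open>t \<mapsto> F (exp (t x))\<close>.\<close>

definition exp_taylor :: "'k::field_char_0^'n^'n \<Rightarrow> ('k^'n^'n \<Rightarrow> 'k) \<Rightarrow> 'k fps" where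
  "exp_taylor x F = Abs_fps (\<lambda>k. (invariant_deriv x ^^ k) F (mat 1) / fact k)"

lemma exp_taylor_0: "fps_nth (exp_taylor x F) 0 = F (mat 1)"
  by (simp add: exp_taylor_def)

lemma fps_deriv_exp_taylor: "fps_deriv (exp_taylor x F) = exp_taylor x (invariant_deriv x F)"
  by (rule fps_ext) (simp add: exp_taylor_def funpow_swap1 field_simps del: of_nat_Suc)

lemma exp_taylor_add:
  fixes x :: "'k::field_char_0^'n^'n"
  assumes "f \<in> fun_alg entries" "g \<in> fun_alg entries"
  shows "exp_taylor x (\<lambda>A. f A + g A) = exp_taylor x f + exp_taylor x g"
proof -
  have "(invariant_deriv x ^^ k) f \<in> fun_alg entries \<and> (invariant_deriv x ^^ k) g \<in> fun_alg entries \<and>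
    (invariant_deriv x ^^ k) (\<lambda>A. f A + g A) = (\<lambda>A. (invariant_deriv x ^^ k) f A + (invariant_deriv x ^^ k) g A)" for k
    by (induction k) (auto simp: assms invariant_deriv_simps invariant_deriv_fun_alg)
  then show ?thesis by (intro fps_ext) (simp add: exp_taylor_def add_divide_distrib)
qed

text \<open>The Leibniz rule for the invariant derivative turns into the product rule for the formal
  derivative, and in characteristic zero a series is determined by its constant term and its
  derivative. So \<open>exp_taylor x\<close> is a ring homomorphism, that is, a matrix over the
  power series.\<close>

lemma exp_taylor_mult:
  fixes x :: "'k::field_char_0^'n^'n"
  assumes "f \<in> fun_alg entries" "g \<in> fun_alg entries"
  shows "exp_taylor x (\<lambda>A. f A * g A) = exp_taylor x f * exp_taylor x g"
proof (rule fps_ext)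
  fix n
  show "fps_nth (exp_taylor x (\<lambda>A. f A * g A)) n = fps_nth (exp_taylor x f * exp_taylor x g) n"
    using assms
  proof (induction n arbitrary: f g)
    case 0
    then show ?case by (simp add: exp_taylor_0)
  next
    case (Suc n)
    note D = invariant_deriv_fun_alg[OF Suc.prems(1), of x] invariant_deriv_fun_alg[OF Suc.prems(2), of x]
    have "of_nat (Suc n) * fps_nth (exp_taylor x (\<lambda>A. f A * g A)) (Suc n) =
        fps_nth (exp_taylor x (invariant_deriv x (\<lambda>A. f A * g A))) n"
      by (simp flip: fps_deriv_exp_taylor del: of_nat_Suc)
    also have "\<dots> = fps_nth (exp_taylor x (invariant_deriv x f) * exp_taylor x g + exp_taylor x f * exp_taylor x (invariant_deriv x g)) n"
      unfolding invariant_deriv_simps(3)[OF Suc.prems]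
      using Suc.IH[OF D(1) Suc.prems(2)] Suc.IH[OF Suc.prems(1) D(2)]
      by (simp add: exp_taylor_add fun_alg.mult Suc.prems D)
    also have "\<dots> = fps_nth (fps_deriv (exp_taylor x f * exp_taylor x g)) n"
      by (simp add: fps_deriv_exp_taylor add.commute)
    also have "\<dots> = of_nat (Suc n) * fps_nth (exp_taylor x f * exp_taylor x g) (Suc n)"
      by (simp del: of_nat_Suc fps_deriv_mult)
    finally show ?case by (simp del: of_nat_Suc)
  qed
qed

lemma exp_taylor_const: "exp_taylor x (\<lambda>_. c) = fps_const c"
proof (rule fps_ext)
  fix n
  have "(invariant_deriv x ^^ k) (\<lambda>_. 0) = (\<lambda>_. 0)" for k
    by (induction k) (simp_all add: invariant_deriv_simps)
  then show "fps_nth (exp_taylor x (\<lambda>_. c)) n = fps_nth (fps_const c) n"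
    by (cases n) (simp_all add: exp_taylor_def funpow_swap1 invariant_deriv_simps del: funpow.simps(2) add: funpow_Suc_right)
qed

text \<open>All iterated invariant derivatives of an equation of \<open>L\<close> vanish on
  \<open>L\<close>, in particular at the identity: the formal one-parameter group lies on
  \<open>L\<close>.\<close>

lemma exp_taylor_vanish:
  fixes x :: "'k::field_char_0^'n^'n"
  assumes L: "subgroup L GL" and x: "x \<in> Lie L"
    and f: "f \<in> fun_alg entries" "\<And>g. g \<in> L \<Longrightarrow> f g = 0"
  shows "exp_taylor x f = 0"
proof -
  have "(invariant_deriv x ^^ k) f \<in> fun_alg entries \<and> (\<forall>g\<in>L. (invariant_deriv x ^^ k) f g = 0)" for k
    by (induction k) (use f invariant_deriv_fun_alg invariant_deriv_vanish[OF L x] in auto)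
  then show ?thesis using subgroup_GL_D(1)[OF L] by (intro fps_ext) (simp add: exp_taylor_def)
qed

section \<open>Matrices of formal power series\<close>

definition fps_matrix_deriv :: "'k::field_char_0 fps^'n^'n \<Rightarrow> 'k fps^'n^'n" where
  "fps_matrix_deriv M = (\<chi> i j. fps_deriv (M $ i $ j))"

definition fps_matrix_const :: "'k::field_char_0^'n^'n \<Rightarrow> 'k fps^'n^'n" where
  "fps_matrix_const A = (\<chi> i j. fps_const (A $ i $ j))"

definition fps_matrix_coeff :: "'k::field_char_0 fps^'n^'n \<Rightarrow> nat \<Rightarrow> 'k^'n^'n" where
  "fps_matrix_coeff M k = (\<chi> i j. fps_nth (M $ i $ j) k)"

definition fps_matrix_exp :: "'k::field_char_0^'n^'n \<Rightarrow> 'k fps^'n^'n" where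
  "fps_matrix_exp x = (\<chi> i j. exp_taylor x (\<lambda>A. A $ i $ j))"

lemma fps_matrix_eqI: "(\<And>k. fps_matrix_coeff A k = fps_matrix_coeff B k) \<Longrightarrow> A = B"
  by (simp add: fps_matrix_coeff_def vec_eq_iff fps_eq_iff)

lemma fps_matrix_deriv_mult:
  "fps_matrix_deriv (A ** B) = fps_matrix_deriv A ** B + A ** fps_matrix_deriv B"
  by (simp add: fps_matrix_deriv_def vec_eq_iff matrix_matrix_mult_def fps_deriv_sum sum.distrib add.commute)

lemma fps_matrix_deriv_const: "fps_matrix_deriv (fps_matrix_const A) = 0"
  by (simp add: fps_matrix_deriv_def fps_matrix_const_def vec_eq_iff)

lemma fps_matrix_coeff_deriv:
  "fps_matrix_coeff (fps_matrix_deriv M) k = mscale (of_nat (Suc k)) (fps_matrix_coeff M (Suc k))"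
  by (simp add: fps_matrix_coeff_def fps_matrix_deriv_def vec_eq_iff)

lemma fps_matrix_coeff_const_mult:
  "fps_matrix_coeff (fps_matrix_const A ** M) k = A ** fps_matrix_coeff M k"
  "fps_matrix_coeff (M ** fps_matrix_const A) k = fps_matrix_coeff M k ** A"
  by (simp_all add: fps_matrix_coeff_def fps_matrix_const_def vec_eq_iff matrix_matrix_mult_def fps_sum_nth)

lemma fps_matrix_coeff_0_mult:
  "fps_matrix_coeff (A ** B) 0 = fps_matrix_coeff A 0 ** fps_matrix_coeff B 0"
  by (simp add: fps_matrix_coeff_def vec_eq_iff matrix_matrix_mult_def fps_sum_nth)

lemma fps_matrix_const_coeff_0: "fps_matrix_coeff (fps_matrix_const A) 0 = A"
  by (simp add: fps_matrix_coeff_def fps_matrix_const_def vec_eq_iff)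

lemma fps_matrix_exp_0: "fps_matrix_coeff (fps_matrix_exp x) 0 = mat 1"
  by (simp add: fps_matrix_coeff_def fps_matrix_exp_def exp_taylor_0 vec_eq_iff)

text \<open>The first claim is the invariant derivative of the matrix entries. It is a recursion for
  the coefficients, by which they all commute with \<open>x\<close>.\<close>

lemma fps_matrix_deriv_exp:
  fixes x :: "'k::field_char_0^'n^'n"
  shows "fps_matrix_deriv (fps_matrix_exp x) = fps_matrix_exp x ** fps_matrix_const x"
    and "fps_matrix_exp x ** fps_matrix_const x = fps_matrix_const x ** fps_matrix_exp x"
proof -
  let ?E = "fps_matrix_exp x"
  have lin: "exp_taylor x (\<lambda>A. \<Sum>l\<in>I. A $ i $ l * c l) = (\<Sum>l\<in>I. exp_taylor x (\<lambda>A. A $ i $ l) * fps_const (c l))"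
    for i c and I :: "'n set"
    by (induction I rule: infinite_finite_induct)
      (simp_all add: exp_taylor_const[of x 0, simplified] exp_taylor_const exp_taylor_add exp_taylor_mult fun_alg_sum
        fun_alg.mult entry_fun_alg fun_alg.const)
  show D: "fps_matrix_deriv ?E = ?E ** fps_matrix_const x"
    by (simp add: vec_eq_iff fps_matrix_deriv_def fps_matrix_exp_def fps_matrix_const_def
        fps_deriv_exp_taylor invariant_deriv_simps matrix_matrix_mult_def lin)
  have step: "mscale (of_nat (Suc k)) (fps_matrix_coeff ?E (Suc k)) = fps_matrix_coeff ?E k ** x" for k
    using arg_cong[OF D, of "\<lambda>M. fps_matrix_coeff M k"]
    by (simp only: fps_matrix_coeff_deriv fps_matrix_coeff_const_mult)
  have inj: "A = B" if "mscale (of_nat (Suc k)) A = mscale (of_nat (Suc k)) B" for k and A B :: "'k^'n^'n"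
    using that mvs.scale_cancel_left[of "of_nat (Suc k)" A B] by (simp del: of_nat_Suc)
  have comm: "x ** fps_matrix_coeff ?E k = fps_matrix_coeff ?E k ** x" for k
  proof (induction k)
    case 0
    then show ?case by (simp add: fps_matrix_exp_0)
  next
    case (Suc k)
    have "mscale (of_nat (Suc k)) (x ** fps_matrix_coeff ?E (Suc k)) = x ** (fps_matrix_coeff ?E k ** x)"
      by (simp only: mscale_mult_right[symmetric] step)
    also have "\<dots> = (fps_matrix_coeff ?E k ** x) ** x"
      by (simp only: matrix_mul_assoc Suc)
    also have "\<dots> = mscale (of_nat (Suc k)) (fps_matrix_coeff ?E (Suc k) ** x)"
      by (simp only: mscale_mult_left[symmetric] step)
    finally show ?case by (rule inj)
  qed
  show "?E ** fps_matrix_const x = fps_matrix_const x ** ?E"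
    by (rule fps_matrix_eqI) (simp only: fps_matrix_coeff_const_mult comm)
qed

lemma fps_matrix_mult_simps:
  fixes A B C :: "'k::field_char_0 fps^'n^'n" and x :: "'k^'n^'n"
  shows "(A + B) ** C = A ** C + B ** C" "C ** (A + B) = C ** A + C ** B"
    "(- A) ** B = - (A ** B)" "A ** (- B) = - (A ** B)" "fps_matrix_const (- x) = - fps_matrix_const x"
    "A ** fps_matrix_const 0 = 0" "0 ** A = 0"
  by (simp_all add: vec_eq_iff matrix_matrix_mult_def sum.distrib algebra_simps sum_negf fps_matrix_const_def)

lemma fps_matrix_deriv_0:
  assumes "fps_matrix_deriv M = 0" shows "M = fps_matrix_const (fps_matrix_coeff M 0)"
proof -
  have "fps_deriv (M $ i $ j) = 0" for i j
    using assms by (simp add: fps_matrix_deriv_def vec_eq_iff)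
  then have "M $ i $ j = fps_const (fps_nth (M $ i $ j) 0)" for i j
    using fps_deriv_eq_0_iff by blast
  then show ?thesis by (simp add: vec_eq_iff fps_matrix_const_def fps_matrix_coeff_def)
qed

text \<open>The product has derivative zero and hence equals its constant term.\<close>

lemma fps_matrix_exp_inverse:
  fixes x :: "'k::field_char_0^'n^'n"
  shows "fps_matrix_exp x ** fps_matrix_exp (- x) = mat 1"
proof -
  let ?M = "fps_matrix_exp x ** fps_matrix_exp (- x)"
  have "fps_matrix_deriv ?M = 0"
    unfolding fps_matrix_deriv_mult fps_matrix_deriv_exp(1) fps_matrix_deriv_exp(2)[of "- x"]
    by (simp add: fps_matrix_mult_simps matrix_mul_assoc)
  then have "?M = fps_matrix_const (fps_matrix_coeff ?M 0)" by (rule fps_matrix_deriv_0)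
  also have "\<dots> = mat 1"
    by (simp add: fps_matrix_coeff_0_mult fps_matrix_exp_0) (simp add: fps_matrix_const_def vec_eq_iff mat_def)
  finally show ?thesis .
qed

text \<open>The flow of \<open>x\<close> on \<open>V\<close> multiplies an eigenfunctional \<open>\<Gamma>\<close> of the infinitesimal action by a
  scalar exponential.\<close>

lemma exp_conj_eigenfunctional:
  fixes x v :: "'k::field_char_0^'n^'n" and \<Gamma> :: "'k^'n^'n \<Rightarrow> 'k"
  assumes V: "mvs.subspace V" "\<And>v. v \<in> V \<Longrightarrow> lie_bracket x v \<in> V" and v: "v \<in> V"
    and \<Gamma>: "\<And>X. \<Gamma> X = (\<Sum>i\<in>UNIV. \<Sum>j\<in>UNIV. G i j * X $ i $ j)"
    and c: "\<And>v. v \<in> V \<Longrightarrow> \<Gamma> (lie_bracket x v) = c * \<Gamma> v"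
  shows "(\<Sum>i\<in>UNIV. \<Sum>j\<in>UNIV. fps_const (G i j) *
      (fps_matrix_exp (- x) ** fps_matrix_const v ** fps_matrix_exp x) $ i $ j) = fps_const (\<Gamma> v) * fps_exp (- c)"
proof -
  let ?u = "fps_matrix_exp (- x) ** fps_matrix_const v ** fps_matrix_exp x"
  have scale: "\<Gamma> (mscale a X) = a * \<Gamma> X" for a X
    by (simp add: \<Gamma> sum_distrib_left mult_ac)
  \<comment> \<open>The series \<open>?u\<close> solves the equation u' = - [x, u]. Each coefficient
    therefore arises from the previous one by a bracket with \<open>x\<close>; it stays in
    \<open>V\<close>, and \<Gamma> acquires the factor - c, divided by the index.\<close>
  have "fps_matrix_deriv ?u = - (fps_matrix_const x ** ?u) + ?u ** fps_matrix_const x"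
    unfolding fps_matrix_deriv_mult fps_matrix_deriv_exp(1) fps_matrix_deriv_exp(2)[of "- x"] fps_matrix_deriv_const
    by (simp add: fps_matrix_mult_simps matrix_mul_assoc)
  then have D: "fps_matrix_deriv ?u + fps_matrix_const x ** ?u = ?u ** fps_matrix_const x" by simp
  let ?c = "fps_matrix_coeff ?u"
  have add: "fps_matrix_coeff (A + B) k = fps_matrix_coeff A k + fps_matrix_coeff B k" for A B :: "'k fps^'n^'n" and k
    by (simp add: fps_matrix_coeff_def vec_eq_iff)
  have "mscale (of_nat (Suc k)) (?c (Suc k)) + x ** ?c k = ?c k ** x" for k
    using arg_cong[OF D, of "\<lambda>M. fps_matrix_coeff M k"]
    by (simp only: add fps_matrix_coeff_deriv fps_matrix_coeff_const_mult)
  then have *: "mscale (of_nat (Suc k)) (?c (Suc k)) = mscale (- 1) (lie_bracket x (?c k))" for k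
    by (simp add: lie_bracket_def eq_diff_eq del: of_nat_Suc)
  have step: "?c (Suc k) = mscale (- 1 / of_nat (Suc k)) (lie_bracket x (?c k))" for k
    using arg_cong[OF *[of k], of "mscale (1 / of_nat (Suc k))"] by (simp del: of_nat_Suc)
  have 0: "?c 0 = v"
    by (simp add: fps_matrix_coeff_0_mult fps_matrix_exp_0 fps_matrix_const_coeff_0)
  have "?c k \<in> V \<and> \<Gamma> (?c k) = \<Gamma> v * ((- c) ^ k / fact k)" for k
  proof (induction k)
    case 0
    then show ?case using v by (simp add: \<open>?c 0 = v\<close>)
  next
    case (Suc k)
    have "?c (Suc k) \<in> V" unfolding step using V Suc by (intro mvs.subspace_scale) auto
    moreover have "\<Gamma> (?c (Suc k)) = \<Gamma> v * ((- c) ^ Suc k / fact (Suc k))"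
      unfolding step scale using Suc c[of "?c k"] by (simp del: of_nat_Suc add: fact_Suc)
    ultimately show ?case by blast
  qed
  then have "(\<Sum>i\<in>UNIV. \<Sum>j\<in>UNIV. G i j * fps_nth (?u $ i $ j) k) = \<Gamma> v * ((- c) ^ k / fact k)" for k
    using \<Gamma>[of "?c k"] by (simp add: fps_matrix_coeff_def)
  then show ?thesis by (intro fps_ext) (simp add: fps_sum_nth)
qed

lemma hom_mod_matrix_mult:
  fixes A B :: "'r::comm_ring_1^'n^'n"
  assumes "ring_mod_prime S Z" "hom_mod S Z \<theta>" "\<And>i j. A $ i $ j \<in> S" "\<And>i j. B $ i $ j \<in> S"
  shows "(\<chi> i j. \<theta> ((A ** B) $ i $ j)) = (\<chi> i j. \<theta> (A $ i $ j)) ** (\<chi> i j. \<theta> (B $ i $ j))"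
proof -
  interpret ring_mod_prime S Z by fact
  show ?thesis
    by (simp add: vec_eq_iff matrix_matrix_mult_def hom_sum[OF assms(2)] hom_mult[OF assms(2)] assms(3,4) mult)
qed

lemma mem_matrix_mult:
  fixes A B :: "'r::comm_ring_1^'n^'n"
  assumes "ring_mod_prime S Z" "\<And>i j. A $ i $ j \<in> S" "\<And>i j. B $ i $ j \<in> S"
  shows "(A ** B) $ i $ j \<in> S"
proof -
  interpret ring_mod_prime S Z by fact
  show ?thesis by (auto simp: matrix_matrix_mult_def intro!: sum mult assms)
qed

lemma matrix_entry_list:
  fixes M :: "'r^'n^'n"
  obtains xs where "set xs = {M $ i $ j | i j. True}"
proof -
  have "finite {M $ i $ j | i j. True}"
    by (rule finite_subset[of _ "(\<lambda>(i, j). M $ i $ j) ` UNIV"]) auto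
  then show ?thesis using that finite_list by blast
qed

text \<open>The element \<open>h\<close> is a specialisation of the formal one-parameter group \<open>exp (t x)\<close>.\<close>

lemma specialise_exp:
  fixes x :: "'k::{alg_closed_field, field_char_0}^'n^'n" and \<Gamma> :: "'k^'n^'n \<Rightarrow> 'k"
  assumes L: "algebraic_group L" and x: "x \<in> Lie L"
    and V: "mvs.subspace V" "\<And>v. v \<in> V \<Longrightarrow> lie_bracket x v \<in> V"
    and \<Gamma>: "\<And>X. \<Gamma> X = (\<Sum>i\<in>UNIV. \<Sum>j\<in>UNIV. G i j * X $ i $ j)"
    and c: "\<And>v. v \<in> V \<Longrightarrow> \<Gamma> (lie_bracket x v) = c * \<Gamma> v"
    and F: "F \<in> fun_alg entries" "exp_taylor x F \<noteq> 0"
  shows "\<exists>h\<in>L. F h \<noteq> 0 \<and> (\<exists>e. \<forall>v\<in>V. \<Gamma> (matrix_inv h ** v ** h) = e * \<Gamma> v)"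
proof -
  have sub: "subgroup L GL" using L by (simp add: algebraic_group_def)
  let ?E = "fps_matrix_exp x" and ?E' = "fps_matrix_exp (- x)"
  define R where "R = range (fps_const :: 'k \<Rightarrow> _)"
  have R: "ring_mod_prime R {0}"
  proof
    show "(of_nat n :: 'k fps) \<notin> {0}" if "n > 0" for n
      using that by (simp flip: fps_of_nat)
    show "1 \<in> R" "- 1 \<in> R" unfolding R_def
      by (auto intro: range_eqI[of _ _ 1] range_eqI[of _ _ "-1"] simp flip: fps_const_neg)
  qed (auto simp: R_def)
  obtain xs1 where xs1: "set xs1 = {?E $ i $ j | i j. True}" by (rule matrix_entry_list)
  obtain xs2 where xs2: "set xs2 = {?E' $ i $ j | i j. True}" by (rule matrix_entry_list)
  \<comment> \<open>The image of the scalar exponential will be the factor \<open>e\<close>, and the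
    entries of \<open>?E'\<close> are adjoined to make \<open>h\<close> invertible.\<close>
  let ?xs = "fps_exp (- c) # xs1 @ xs2"
  define S where "S = fold (\<lambda>x R. adjoin R x) ?xs R"
  have S: "ring_mod_prime S {0}" "R \<subseteq> S" "set ?xs \<subseteq> S"
    using fold_adjoin[OF R] unfolding S_def by blast+
  interpret S: ring_mod_prime S "{0}" by fact
  have const: "fps_const a \<in> S" for a using S(2) by (auto simp: R_def)
  have E: "?E $ i $ j \<in> S" "?E' $ i $ j \<in> S" for i j
  proof -
    have "?E $ i $ j \<in> set xs1" "?E' $ i $ j \<in> set xs2" unfolding xs1 xs2 by blast+
    then show "?E $ i $ j \<in> S" "?E' $ i $ j \<in> S" using S(3) by auto
  qed
  have T: "exp_taylor x P \<in> S" if "P \<in> fun_alg entries" for P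
    using that
  proof induction
    case (gen f)
    then show ?case using E(1) by (auto simp: entries_def fps_matrix_exp_def)
  qed (auto simp: exp_taylor_const exp_taylor_add exp_taylor_mult const S.add S.mult)
  obtain a where a: "a \<in> R - {0}" "\<forall>\<phi> :: 'k fps \<Rightarrow> 'k dual. hom_mod R {0} \<phi> \<and> dual_re (\<phi> a) \<noteq> 0 \<longrightarrow>
      (\<exists>\<psi>. hom_mod S {0} \<psi> \<and> (\<forall>a\<in>R. \<psi> a = \<phi> a) \<and> dual_re (\<psi> (exp_taylor x F)) \<noteq> 0)"
    using extend_specialisation_list[OF R, of "exp_taylor x F" ?xs] T[OF F(1)] F(2) unfolding S_def by auto
  \<comment> \<open>On the constants this is the inclusion of the field, so the nonzero constant
    \<open>a\<close> cannot be specialised to zero.\<close>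
  define \<phi> where "\<phi> f = Dual (fps_nth f 0) (0 :: 'k)" for f
  have "hom_mod R {0} \<phi>"
    unfolding hom_mod_def by (auto simp: \<phi>_def one_dual_def zero_dual_def plus_dual_def times_dual_def)
  moreover have "dual_re (\<phi> a) \<noteq> 0" using a(1) by (auto simp: \<phi>_def R_def)
  ultimately obtain \<psi> where \<psi>: "hom_mod S {0} \<psi>" "\<forall>a\<in>R. \<psi> a = \<phi> a" "dual_re (\<psi> (exp_taylor x F)) \<noteq> 0"
    using a(2) by blast
  define \<theta> where "\<theta> f = dual_re (\<psi> f)" for f
  have \<theta>: "hom_mod S {0} \<theta>" unfolding \<theta>_def by (rule hom_mod_re[OF \<psi>(1)])
  have \<theta>_const: "\<theta> (fps_const a) = a" for a using \<psi>(2) by (simp add: \<theta>_def \<phi>_def R_def)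
  define h where "h = (\<chi> i j. \<theta> (?E $ i $ j))"
  define h' where "h' = (\<chi> i j. \<theta> (?E' $ i $ j))"
  have \<theta>_mat: "(\<chi> i j. \<theta> ((mat 1 :: 'k fps^'n^'n) $ i $ j)) = mat 1"
    by (simp add: vec_eq_iff mat_def S.hom_0[OF \<theta>] S.hom_1[OF \<theta>])
  have hh': "h ** h' = mat 1" "h' ** h = mat 1"
    using hom_mod_matrix_mult[OF S(1) \<theta>, of ?E ?E'] hom_mod_matrix_mult[OF S(1) \<theta>, of ?E' ?E] E
      fps_matrix_exp_inverse[of x] fps_matrix_exp_inverse[of "- x"]
    by (simp_all add: h_def h'_def \<theta>_mat)
  then have inv: "matrix_inv h = h'" "invertible h"
    by (simp_all add: matrix_inv_unique) (auto simp: invertible_def)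
  have eval: "\<theta> (exp_taylor x P) = P h" if "P \<in> fun_alg entries" for P
    using that
  proof induction
    case (gen f)
    then show ?case by (auto simp: entries_def fps_matrix_exp_def h_def)
  qed (auto simp: exp_taylor_const \<theta>_const exp_taylor_add exp_taylor_mult S.hom_add[OF \<theta>] S.hom_mult[OF \<theta>] T)
  have "h \<in> L"
  proof (rule algebraic_group_closed[OF L inv(2)])
    fix P :: "'k^'n^'n \<Rightarrow> 'k" assume P: "P \<in> fun_alg entries" "\<And>g. g \<in> L \<Longrightarrow> P g = 0"
    show "P h = 0" using eval[OF P(1)] exp_taylor_vanish[OF sub x P] S.hom_0[OF \<theta>] by simp
  qed
  moreover have "F h \<noteq> 0" using eval[OF F(1)] \<psi>(3) by (simp add: \<theta>_def)
  moreover have "\<Gamma> (matrix_inv h ** v ** h) = \<theta> (fps_exp (- c)) * \<Gamma> v" if v: "v \<in> V" for v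
  proof -
    have vS: "fps_matrix_const v $ i $ j \<in> S" for i j by (simp add: fps_matrix_const_def const)
    have v\<theta>: "(\<chi> i j. \<theta> (fps_matrix_const v $ i $ j)) = v"
      by (simp add: fps_matrix_const_def \<theta>_const vec_eq_iff)
    let ?u = "?E' ** fps_matrix_const v ** ?E"
    have u1: "(?E' ** fps_matrix_const v) $ i $ j \<in> S" for i j by (rule mem_matrix_mult[OF S(1) E(2) vS])
    have uS: "?u $ i $ j \<in> S" for i j by (rule mem_matrix_mult[OF S(1) u1 E(1)])
    have "(\<chi> i j. \<theta> (?u $ i $ j)) = h' ** v ** h"
      using hom_mod_matrix_mult[OF S(1) \<theta> u1 E(1)] hom_mod_matrix_mult[OF S(1) \<theta> E(2) vS]
      by (simp add: h_def h'_def v\<theta>)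
    then have "\<theta> (?u $ i $ j) = (h' ** v ** h) $ i $ j" for i j
      by (simp add: vec_eq_iff)
    then have "\<Gamma> (h' ** v ** h) = \<theta> (\<Sum>i\<in>UNIV. \<Sum>j\<in>UNIV. fps_const (G i j) * ?u $ i $ j)"
      by (simp add: \<Gamma> S.hom_sum[OF \<theta>] S.hom_mult[OF \<theta>] const uS S.sum S.mult \<theta>_const)
    also have "\<dots> = \<theta> (fps_const (\<Gamma> v) * fps_exp (- c))"
      by (simp only: exp_conj_eigenfunctional[OF V v \<Gamma> c])
    also have "\<dots> = \<theta> (fps_exp (- c)) * \<Gamma> v"
      using S(3) by (simp add: S.hom_mult[OF \<theta>] const \<theta>_const)
    finally show ?thesis by (simp add: inv)
  qed
  ultimately show ?thesis by blast
qed

text \<open>If the Taylor series of an equation \<open>F\<close> of \<open>A\<close> were nonzero, a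
  specialisation of the formal group would be an element of \<open>A\<close> at which
  \<open>F\<close> is nonzero. So the series vanishes, and its linear coefficient is the derivative
  of \<open>F\<close> along \<open>x\<close>.\<close>

lemma Lie_line_normaliser_superset:
  fixes x :: "'k::{alg_closed_field, field_char_0}^'n^'n" and \<Gamma> :: "'k^'n^'n \<Rightarrow> 'k"
  assumes "algebraic_group L" and x: "x \<in> Lie L"
    and "mvs.subspace V" "\<And>v. v \<in> V \<Longrightarrow> lie_bracket x v \<in> V"
    and "\<And>X. \<Gamma> X = (\<Sum>i\<in>UNIV. \<Sum>j\<in>UNIV. G i j * X $ i $ j)"
    and "\<And>v. v \<in> V \<Longrightarrow> \<Gamma> (lie_bracket x v) = c * \<Gamma> v"
    and A: "\<And>h e. h \<in> L \<Longrightarrow> (\<And>v. v \<in> V \<Longrightarrow> \<Gamma> (matrix_inv h ** v ** h) = e * \<Gamma> v) \<Longrightarrow> h \<in> A"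
  shows "x \<in> Lie A"
  unfolding Lie_iff
proof (intro ballI impI)
  fix F assume F: "F \<in> fun_alg entries" "\<forall>h\<in>A. F h = 0"
  have "exp_taylor x F = 0"
  proof (rule ccontr)
    assume "exp_taylor x F \<noteq> 0"
    from specialise_exp[OF assms(1-6) F(1) this] obtain h e where
      "h \<in> L" "F h \<noteq> 0" "\<forall>v\<in>V. \<Gamma> (matrix_inv h ** v ** h) = e * \<Gamma> v" by blast
    then show False using A[of h e] F(2) by blast
  qed
  moreover have "fps_nth (exp_taylor x F) 1 = dir_deriv F (mat 1) x"
    by (simp add: exp_taylor_def invariant_deriv_def)
  ultimately show "dir_deriv F (mat 1) x = 0" by simp
qed

section \<open>The tangent space of an open orbit\<close>

text \<open>Krull's argument: an ideal that is maximal among those disjoint from a multiplicative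
  set is prime.\<close>

lemma prime_ideal_exists:
  fixes I S :: "'r::comm_ring_1 set"
  assumes I: "0 \<in> I" "\<And>a b. a \<in> I \<Longrightarrow> b \<in> I \<Longrightarrow> a + b \<in> I" "\<And>a b. b \<in> I \<Longrightarrow> a * b \<in> I"
    and S: "1 \<in> S" "\<And>a b. a \<in> S \<Longrightarrow> b \<in> S \<Longrightarrow> a * b \<in> S" and disj: "I \<inter> S = {}"
  shows "\<exists>Z. I \<subseteq> Z \<and> Z \<inter> S = {} \<and> (\<forall>a\<in>Z. \<forall>b\<in>Z. a + b \<in> Z) \<and> (\<forall>a. \<forall>b\<in>Z. a * b \<in> Z) \<and>
    (\<forall>a b. a * b \<in> Z \<longrightarrow> a \<in> Z \<or> b \<in> Z)"
proof -
  define \<A> where "\<A> = {J. I \<subseteq> J \<and> J \<inter> S = {} \<and> (\<forall>a\<in>J. \<forall>b\<in>J. a + b \<in> J) \<and> (\<forall>a. \<forall>b\<in>J. a * b \<in> J)}"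
  have IA: "I \<in> \<A>" using I disj by (simp add: \<A>_def)
  have "\<Union>\<C> \<in> \<A>" if \<C>: "\<C> \<noteq> {}" "subset.chain \<A> \<C>" for \<C>
  proof -
    have sub: "J \<in> \<A>" if "J \<in> \<C>" for J using \<C>(2) that by (auto simp: subset_chain_def)
    have add: "a + b \<in> \<Union>\<C>" if ab: "a \<in> \<Union>\<C>" "b \<in> \<Union>\<C>" for a b
    proof -
      obtain J K where JK: "J \<in> \<C>" "a \<in> J" "K \<in> \<C>" "b \<in> K" using ab by blast
      then have "J \<subseteq> K \<or> K \<subseteq> J" using \<C>(2) by (auto simp: subset_chain_def)
      then obtain M where "M \<in> \<C>" "a \<in> M" "b \<in> M" using JK by blast
      then have "a + b \<in> M" using sub[of M] by (simp add: \<A>_def)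
      then show ?thesis using \<open>M \<in> \<C>\<close> by blast
    qed
    have "I \<subseteq> \<Union>\<C>" using \<C>(1) sub by (fastforce simp: \<A>_def)
    moreover have "\<Union>\<C> \<inter> S = {}" using sub by (fastforce simp: \<A>_def)
    moreover have "a * b \<in> \<Union>\<C>" if "b \<in> \<Union>\<C>" for a b using that sub by (fastforce simp: \<A>_def)
    ultimately show ?thesis using add by (simp add: \<A>_def)
  qed
  then obtain Z where Z: "Z \<in> \<A>" and max: "\<And>J. J \<in> \<A> \<Longrightarrow> Z \<subseteq> J \<Longrightarrow> J = Z"
    using subset_Zorn_nonempty[of \<A>] IA by blast
  have Z': "I \<subseteq> Z" "Z \<inter> S = {}" "\<And>a b. a \<in> Z \<Longrightarrow> b \<in> Z \<Longrightarrow> a + b \<in> Z" "\<And>a b. b \<in> Z \<Longrightarrow> a * b \<in> Z"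
    using Z by (auto simp: \<A>_def)
  have 0: "0 \<in> Z" using Z'(1) I(1) by blast
  have meets: "\<exists>z\<in>Z. \<exists>r. z + r * a \<in> S" if "a \<notin> Z" for a
  proof (rule ccontr)
    assume no: "\<not> ?thesis"
    define J where "J = {z + r * a | z r. z \<in> Z}"
    have ZJ: "Z \<subseteq> J"
    proof
      fix z assume "z \<in> Z"
      then show "z \<in> J" unfolding J_def by (intro CollectI exI[of _ z] exI[of _ 0]) simp
    qed
    have "J \<in> \<A>"
      unfolding \<A>_def
    proof (intro CollectI conjI ballI allI)
      show "I \<subseteq> J" using Z'(1) ZJ by simp
      show "J \<inter> S = {}" using no unfolding J_def by blast
      fix x y assume "x \<in> J" "y \<in> J"
      then obtain z r w s where "x = z + r * a" "y = w + s * a" "z \<in> Z" "w \<in> Z" unfolding J_def by blast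
      then show "x + y \<in> J" unfolding J_def using Z'(3)[of z w]
        by (intro CollectI exI[of _ "z + w"] exI[of _ "r + s"]) (simp add: algebra_simps)
    next
      fix x y assume "y \<in> J"
      then obtain z r where "y = z + r * a" "z \<in> Z" unfolding J_def by blast
      then show "x * y \<in> J" unfolding J_def using Z'(4)[of z x]
        by (intro CollectI exI[of _ "x * z"] exI[of _ "x * r"]) (simp add: algebra_simps)
    qed
    then have "J = Z" using max ZJ by blast
    moreover have "a \<in> J" unfolding J_def using 0 by (intro CollectI exI[of _ 0] exI[of _ 1]) simp
    ultimately show False using that by blast
  qed
  have prime: "a \<in> Z \<or> b \<in> Z" if ab: "a * b \<in> Z" for a b
  proof (rule ccontr)
    assume "\<not> ?thesis"
    then obtain z r w s where *: "z \<in> Z" "z + r * a \<in> S" "w \<in> Z" "w + s * b \<in> S" using meets by blast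
    have "(z + r * a) * (w + s * b) = (w + s * b) * z + (r * a) * w + (r * s) * (a * b)"
      by (simp add: algebra_simps)
    also have "\<dots> \<in> Z" using Z'(3,4) * ab by blast
    finally show False using S(2)[OF *(2,4)] Z'(2) by blast
  qed
  show ?thesis using Z' prime by (intro exI[of _ Z]) simp
qed

lemma sum_fun_apply: "(\<Sum>i\<in>I. f i) x = (\<Sum>i\<in>I. f i x)"
  for f :: "'i \<Rightarrow> 'a \<Rightarrow> 'b::comm_monoid_add"
  by (induction I rule: infinite_finite_induct) auto

section \<open>Polynomial functions on the dual of a subspace\<close>

abbreviation evaluations :: "('k::field^'n^'n) set \<Rightarrow> (('k^'n^'n \<Rightarrow> 'k) \<Rightarrow> 'k) set" where
  "evaluations W \<equiv> (\<lambda>v \<phi>. \<phi> v) ` W"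

lemma dual_space_D:
  assumes "\<phi> \<in> dual_space W"
  shows "x \<in> W \<Longrightarrow> y \<in> W \<Longrightarrow> \<phi> (x + y) = \<phi> x + \<phi> y" "x \<in> W \<Longrightarrow> \<phi> (mscale c x) = c * \<phi> x" "x \<notin> W \<Longrightarrow> \<phi> x = 0"
  using assms by (auto simp: dual_space_def)

lemma dual_space_line:
  assumes "\<phi> \<in> dual_space W" "\<psi> \<in> dual_space W"
  shows "(\<lambda>v. \<phi> v + t * \<psi> v) \<in> dual_space W"
  using assms unfolding dual_space_def by (simp add: algebra_simps)

lemma evaluations_line_poly:
  assumes "P \<in> fun_alg (evaluations W)"
  shows "\<exists>p. \<forall>t. poly p t = P (\<lambda>v. \<phi> v + t * \<psi> v)"
  using assms
proof induction
  case (gen f)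
  then obtain v where "f = (\<lambda>\<phi>. \<phi> v)" by blast
  then show ?case by (intro exI[of _ "[:\<phi> v, \<psi> v:]"]) simp
next
  case (const c)
  then show ?case by (intro exI[of _ "[:c:]"]) simp
next
  case (add f g)
  then show ?case by (metis poly_add)
next
  case (mult f g)
  then show ?case by (metis poly_mult)
qed

text \<open>The dual space is irreducible: two nonempty principal open sets have a common point,
  already on the line through a point of each, where both functions become nonzero polynomials in
  \<open>t\<close>.\<close>

lemma evaluations_common_nonzero:
  fixes W :: "('k::field_char_0^'n^'n) set"
  assumes P: "P \<in> fun_alg (evaluations W)" "P \<phi> \<noteq> 0" and Q: "Q \<in> fun_alg (evaluations W)" "Q \<phi>' \<noteq> 0"
  obtains t where "P (\<lambda>v. \<phi> v + t * (\<phi>' v - \<phi> v)) \<noteq> 0" "Q (\<lambda>v. \<phi> v + t * (\<phi>' v - \<phi> v)) \<noteq> 0"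
proof -
  obtain p where p: "\<And>t. poly p t = P (\<lambda>v. \<phi> v + t * (\<phi>' v - \<phi> v))"
    using evaluations_line_poly[OF P(1), of \<phi> "\<lambda>v. \<phi>' v - \<phi> v"] by blast
  obtain q where q: "\<And>t. poly q t = Q (\<lambda>v. \<phi> v + t * (\<phi>' v - \<phi> v))"
    using evaluations_line_poly[OF Q(1), of \<phi> "\<lambda>v. \<phi>' v - \<phi> v"] by blast
  have "poly p 0 \<noteq> 0" "poly q 1 \<noteq> 0" using P(2) Q(2) by (simp_all add: p q)
  then have "p * q \<noteq> 0" by auto
  then obtain t where "poly (p * q) t \<noteq> 0" by (rule exists_nonroot)
  then show ?thesis by (intro that[of t]) (auto simp: p q)
qed

lemma dual_space_convex:
  assumes "\<phi> \<in> dual_space W" "\<phi>' \<in> dual_space W"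
  shows "(\<lambda>v. \<phi> v + t * (\<phi>' v - \<phi> v)) \<in> dual_space W"
  using assms unfolding dual_space_def by (simp add: algebra_simps)

text \<open>The value of \<open>P\<close> at the dual-number point \<phi> + \<epsilon>
  \<psi>.\<close>

definition dual_eval :: "('k::field_char_0^'n^'n \<Rightarrow> 'k) \<Rightarrow> ('k^'n^'n \<Rightarrow> 'k) \<Rightarrow> (('k^'n^'n \<Rightarrow> 'k) \<Rightarrow> 'k) \<Rightarrow> 'k dual" where
  "dual_eval \<phi> \<psi> P = Dual (P \<phi>) (coeff (THE p. \<forall>t. poly p t = P (\<lambda>v. \<phi> v + t * \<psi> v)) 1)"

lemma dual_evalI:
  assumes "\<And>t. poly p t = P (\<lambda>v. \<phi> v + t * \<psi> v)"
  shows "dual_eval \<phi> \<psi> P = Dual (coeff p 0) (coeff p 1)"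
proof -
  have "(THE p. \<forall>t. poly p t = P (\<lambda>v. \<phi> v + t * \<psi> v)) = p"
    using assms by (intro the_equality) (auto simp: poly_eq_poly_eq_iff[symmetric] fun_eq_iff)
  then show ?thesis using assms[of 0] by (simp add: dual_eval_def poly_0_coeff_0)
qed

lemma dual_eval_simps:
  fixes W :: "('k::field_char_0^'n^'n) set"
  shows "dual_eval \<phi> \<psi> (\<lambda>_. c) = Dual c 0" "dual_eval \<phi> \<psi> (\<lambda>\<phi>. \<phi> v) = Dual (\<phi> v) (\<psi> v)"
    "P \<in> fun_alg (evaluations W) \<Longrightarrow> Q \<in> fun_alg (evaluations W) \<Longrightarrow>
      dual_eval \<phi> \<psi> (\<lambda>x. P x + Q x) = dual_eval \<phi> \<psi> P + dual_eval \<phi> \<psi> Q"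
    "P \<in> fun_alg (evaluations W) \<Longrightarrow> Q \<in> fun_alg (evaluations W) \<Longrightarrow>
      dual_eval \<phi> \<psi> (\<lambda>x. P x * Q x) = dual_eval \<phi> \<psi> P * dual_eval \<phi> \<psi> Q"
proof -
  show "dual_eval \<phi> \<psi> (\<lambda>_. c) = Dual c 0" using dual_evalI[of "[:c:]" "\<lambda>_. c"] by simp
  show "dual_eval \<phi> \<psi> (\<lambda>\<phi>. \<phi> v) = Dual (\<phi> v) (\<psi> v)"
    using dual_evalI[of "[:\<phi> v, \<psi> v:]" "\<lambda>\<phi>. \<phi> v" \<phi> \<psi>] by simp
  assume P: "P \<in> fun_alg (evaluations W)" and Q: "Q \<in> fun_alg (evaluations W)"
  obtain p where p: "\<And>t. poly p t = P (\<lambda>v. \<phi> v + t * \<psi> v)"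
    using evaluations_line_poly[OF P] by blast
  obtain q where q: "\<And>t. poly q t = Q (\<lambda>v. \<phi> v + t * \<psi> v)"
    using evaluations_line_poly[OF Q] by blast
  show "dual_eval \<phi> \<psi> (\<lambda>x. P x + Q x) = dual_eval \<phi> \<psi> P + dual_eval \<phi> \<psi> Q"
    using dual_evalI[of p P, OF p] dual_evalI[of q Q, OF q] dual_evalI[of "p + q" "\<lambda>x. P x + Q x" \<phi> \<psi>] p q
    by (simp add: plus_dual_def)
  show "dual_eval \<phi> \<psi> (\<lambda>x. P x * Q x) = dual_eval \<phi> \<psi> P * dual_eval \<phi> \<psi> Q"
    using dual_evalI[of p P, OF p] dual_evalI[of q Q, OF q] dual_evalI[of "p * q" "\<lambda>x. P x * Q x" \<phi> \<psi>] p q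
    by (simp add: times_dual_def coeff_mult)
qed

lemma dual_matrix_mult:
  fixes M N :: "'k::comm_ring_1 dual^'n^'n"
  shows "(\<chi> i j. dual_re ((M ** N) $ i $ j)) = (\<chi> i j. dual_re (M $ i $ j)) ** (\<chi> i j. dual_re (N $ i $ j))"
    and "(\<chi> i j. dual_eps ((M ** N) $ i $ j)) =
      (\<chi> i j. dual_re (M $ i $ j)) ** (\<chi> i j. dual_eps (N $ i $ j)) +
      (\<chi> i j. dual_eps (M $ i $ j)) ** (\<chi> i j. dual_re (N $ i $ j))"
proof -
  have "dual_re (sum f I) = (\<Sum>i\<in>I. dual_re (f i))" "dual_eps (sum f I) = (\<Sum>i\<in>I. dual_eps (f i))"
    for f :: "'n \<Rightarrow> 'k dual" and I
    by (induction I rule: infinite_finite_induct) auto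
  note s = this
  show "(\<chi> i j. dual_re ((M ** N) $ i $ j)) = (\<chi> i j. dual_re (M $ i $ j)) ** (\<chi> i j. dual_re (N $ i $ j))"
    by (simp add: vec_eq_iff matrix_matrix_mult_def s)
  show "(\<chi> i j. dual_eps ((M ** N) $ i $ j)) =
      (\<chi> i j. dual_re (M $ i $ j)) ** (\<chi> i j. dual_eps (N $ i $ j)) +
      (\<chi> i j. dual_eps (M $ i $ j)) ** (\<chi> i j. dual_re (N $ i $ j))"
    by (simp add: vec_eq_iff matrix_matrix_mult_def s sum.distrib)
qed

lemma conj_lie_bracket:
  fixes g :: "'k::field^'n^'n"
  assumes "g ** h = mat 1" "h ** g = mat 1"
  shows "lie_bracket (g ** X ** h) (g ** Y ** h) = g ** lie_bracket X Y ** h"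
proof -
  have "g ** X ** h ** (g ** Y ** h) = g ** X ** (h ** g) ** Y ** h" for X Y
    by (simp only: matrix_mul_assoc)
  then show ?thesis using assms by (simp add: lie_bracket_def matrix_mult_diff matrix_diff_mult matrix_mul_assoc)
qed

text \<open>Points of \<open>L\<close> over the dual numbers that lift \<open>\<phi> + \<epsilon> \<delta>\<close> for a general point \<open>\<phi>\<close> of the orbit: the
  algebra of functions of the form \<open>P (g \<gamma>)\<close> has a specialisation at \<open>\<phi> + \<epsilon> \<delta>\<close>, since the orbit is dense,
  and it extends to the matrix entries.\<close>

lemma open_orbit_lift:
  fixes L V :: "('k::{alg_closed_field, field_char_0}^'n^'n) set"
  assumes L: "algebraic_group L" and subV: "mvs.subspace V"
    and V: "\<And>g v. g \<in> L \<Longrightarrow> v \<in> V \<Longrightarrow> matrix_inv g ** v ** g \<in> V"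
    and \<Gamma>: "\<And>X. \<Gamma> X = (\<Sum>i\<in>UNIV. \<Sum>j\<in>UNIV. G i j * X $ i $ j)"
    and \<gamma>: "\<gamma> \<in> dual_space V" "\<And>v. v \<in> V \<Longrightarrow> \<gamma> v = \<Gamma> v"
    and op: "openin (zariski_dual V) (dual_orbit V L \<gamma>)"
  shows "\<exists>g0\<in>L. \<forall>\<delta>\<in>dual_space V. \<exists>g\<in>L. \<exists>\<xi>\<in>Lie L. \<forall>v\<in>V.
    \<Gamma> (matrix_inv g0 ** v ** g0) = \<Gamma> (matrix_inv g ** v ** g) \<and>
    \<delta> v = \<Gamma> (lie_bracket (matrix_inv g ** v ** g) \<xi>)"
proof -
  have sub: "subgroup L GL" using L by (simp add: algebraic_group_def)
  note grp = subgroup_GL_D[OF sub]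
  \<comment> \<open>Written with \<Gamma>, which is linear on all matrices, so that
    \<open>orb g\<close> is a functional on \<open>V\<close> for every matrix \<open>g\<close>; the
    functions below live on the whole type.\<close>
  define orb where "orb g = (\<lambda>v. if v \<in> V then \<Gamma> (matrix_inv g ** v ** g) else 0)" for g
  have orb: "orb g = dual_act V g \<gamma>" if "g \<in> L" for g
    unfolding orb_def dual_act_def using \<gamma>(2) V[OF that] by auto
  have \<Gamma>_lin: "\<Gamma> (X + Y) = \<Gamma> X + \<Gamma> Y" "\<Gamma> (mscale c X) = c * \<Gamma> X" for X Y c
    unfolding \<Gamma> by (simp_all add: sum.distrib sum_distrib_left algebra_simps)
  let ?A = "fun_alg (evaluations V)"
  have "\<gamma> \<in> dual_orbit V L \<gamma>"
    unfolding dual_orbit_def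
  proof (rule image_eqI[OF _ grp(1)])
    show "\<gamma> = dual_act V (mat 1) \<gamma>" using \<gamma>(1) by (auto simp: dual_act_def dual_space_def)
  qed
  then obtain f0 where f0: "f0 \<in> ?A" "f0 \<gamma> \<noteq> 0" "\<And>\<phi>. \<phi> \<in> dual_space V \<Longrightarrow> f0 \<phi> \<noteq> 0 \<Longrightarrow> \<phi> \<in> dual_orbit V L \<gamma>"
    using op unfolding zariski_dual_def openin_zariski by blast
  have orbit: "\<exists>g\<in>L. \<phi> = orb g" if "\<phi> \<in> dual_space V" "f0 \<phi> \<noteq> 0" for \<phi>
    using f0(3)[OF that] orb unfolding dual_orbit_def by auto
  have general: "\<exists>g\<in>L. orb g \<in> dual_space V \<and> P (orb g) \<noteq> 0"
    if P: "P \<in> ?A" and \<phi>: "\<phi> \<in> dual_space V" "P \<phi> \<noteq> 0" for P \<phi>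
  proof -
    obtain t where t: "P (\<lambda>v. \<phi> v + t * (\<gamma> v - \<phi> v)) \<noteq> 0" "f0 (\<lambda>v. \<phi> v + t * (\<gamma> v - \<phi> v)) \<noteq> 0"
      by (rule evaluations_common_nonzero[OF P \<phi>(2) f0(1,2)])
    have d: "(\<lambda>v. \<phi> v + t * (\<gamma> v - \<phi> v)) \<in> dual_space V" by (rule dual_space_convex[OF \<phi>(1) \<gamma>(1)])
    from orbit[OF d t(2)] obtain g where "g \<in> L" "(\<lambda>v. \<phi> v + t * (\<gamma> v - \<phi> v)) = orb g" by blast
    then show ?thesis using t(1) d by metis
  qed
  \<comment> \<open>The ambient ring consists of all functions on matrices. \<open>I\<close> is the
    ideal of \<open>L\<close>, and \<open>R\<close> and \<open>S\<close> are the pullbacks under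
    \<open>orb\<close> of the polynomial functions on the dual of \<open>V\<close>, in
    \<open>S\<close> of the nonzero ones. A prime ideal above \<open>I\<close> that avoids
    \<open>S\<close> gives a domain of functions on \<open>L\<close> that contains the polynomial
    functions on the dual.\<close>
  define I where "I = {F :: 'k^'n^'n \<Rightarrow> 'k. \<forall>g\<in>L. F g = 0}"
  define S where "S = {(\<lambda>g. P (orb g)) | P. P \<in> ?A \<and> (\<exists>\<phi>\<in>dual_space V. P \<phi> \<noteq> 0)}"
  define R where "R = {(\<lambda>g. P (orb g)) | P. P \<in> ?A}"
  have RI: "(\<lambda>g. P (orb g)) \<in> R" if "P \<in> ?A" for P using that unfolding R_def by blast
  have I: "0 \<in> I" "\<And>a b. a \<in> I \<Longrightarrow> b \<in> I \<Longrightarrow> a + b \<in> I" "\<And>a b. b \<in> I \<Longrightarrow> a * b \<in> I"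
    by (auto simp: I_def)
  have S1: "1 \<in> S"
    unfolding S_def using \<gamma>(1)
    by (intro CollectI exI[of _ "\<lambda>_. 1"]) (auto intro: fun_alg.const simp: one_fun_def)
  have S2: "a * b \<in> S" if ab: "a \<in> S" "b \<in> S" for a b
  proof -
    obtain P \<phi> where P: "a = (\<lambda>g. P (orb g))" "P \<in> ?A" "\<phi> \<in> dual_space V" "P \<phi> \<noteq> 0"
      using ab(1) unfolding S_def by blast
    obtain Q \<phi>' where Q: "b = (\<lambda>g. Q (orb g))" "Q \<in> ?A" "\<phi>' \<in> dual_space V" "Q \<phi>' \<noteq> 0"
      using ab(2) unfolding S_def by blast
    obtain t where t: "P (\<lambda>v. \<phi> v + t * (\<phi>' v - \<phi> v)) \<noteq> 0" "Q (\<lambda>v. \<phi> v + t * (\<phi>' v - \<phi> v)) \<noteq> 0"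
      by (rule evaluations_common_nonzero[OF P(2,4) Q(2,4)])
    show ?thesis
      unfolding S_def
    proof (intro CollectI exI conjI bexI)
      show "a * b = (\<lambda>g. P (orb g) * Q (orb g))" by (simp add: P(1) Q(1) times_fun_def)
      show "(\<lambda>x. P x * Q x) \<in> ?A" using P(2) Q(2) by (rule fun_alg.mult)
      show "(\<lambda>v. \<phi> v + t * (\<phi>' v - \<phi> v)) \<in> dual_space V" by (rule dual_space_convex[OF P(3) Q(3)])
      show "P (\<lambda>v. \<phi> v + t * (\<phi>' v - \<phi> v)) * Q (\<lambda>v. \<phi> v + t * (\<phi>' v - \<phi> v)) \<noteq> 0" using t by simp
    qed
  qed
  have IS: "I \<inter> S = {}" using general unfolding I_def S_def by blast
  obtain Z where Z': "I \<subseteq> Z \<and> Z \<inter> S = {} \<and> (\<forall>a\<in>Z. \<forall>b\<in>Z. a + b \<in> Z) \<and> (\<forall>a. \<forall>b\<in>Z. a * b \<in> Z) \<and>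
      (\<forall>a b. a * b \<in> Z \<longrightarrow> a \<in> Z \<or> b \<in> Z)"
    using prime_ideal_exists[OF I S1 S2 IS] ..
  have Z: "I \<subseteq> Z" "Z \<inter> S = {}" "0 \<in> Z" "\<And>a b. a \<in> Z \<Longrightarrow> b \<in> Z \<Longrightarrow> a + b \<in> Z"
    "\<And>a b. b \<in> Z \<Longrightarrow> a * b \<in> Z" "\<And>a b. a * b \<in> Z \<Longrightarrow> a \<in> Z \<or> b \<in> Z"
    using Z' I(1) by blast+
  have const: "(\<lambda>_. c) \<in> R" for c using RI[OF fun_alg.const] .
  have ring: "ring_mod_prime R Z"
  proof
    show "1 \<in> R" "- 1 \<in> R" using const[of 1] const[of "- 1"] by (simp_all add: one_fun_def fun_Compl_def)
    show "of_nat n \<notin> Z" if "n > 0" for n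
    proof
      assume "of_nat n \<in> Z"
      then have "(\<lambda>_. 1 / of_nat n) * of_nat n \<in> Z" by (rule Z(5))
      also have "(\<lambda>_. 1 / of_nat n) * of_nat n = (1 :: 'k^'n^'n \<Rightarrow> 'k)"
        using that by (simp add: fun_eq_iff of_nat_fun)
      finally show False using Z(2) S1 by blast
    qed
    fix a b assume "a \<in> R" "b \<in> R"
    then obtain P Q where PQ: "a = (\<lambda>g. P (orb g))" "b = (\<lambda>g. Q (orb g))" "P \<in> ?A" "Q \<in> ?A"
      unfolding R_def by blast
    show "a + b \<in> R" using RI[OF fun_alg.add[OF PQ(3,4)]] by (simp add: PQ plus_fun_def)
    show "a * b \<in> R" using RI[OF fun_alg.mult[OF PQ(3,4)]] by (simp add: PQ times_fun_def)
  qed (use Z in blast)+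
  \<comment> \<open>Because \<open>Z\<close> avoids \<open>S\<close>, there are no relations between
    the orbit coordinates modulo \<open>Z\<close> beyond those on the dual of \<open>V\<close>;
    every dual-number point of this space is a specialisation of \<open>R\<close>.\<close>
  have Z_van: "P \<phi> = 0" if "P \<in> ?A" "(\<lambda>g. P (orb g)) \<in> Z" "\<phi> \<in> dual_space V" for P \<phi>
    using that Z(2) unfolding S_def by blast
  define X :: "('k^'n^'n \<Rightarrow> 'k)^'n^'n" where "X = (\<chi> i j. (\<lambda>A. A $ i $ j))"
  define Y :: "('k^'n^'n \<Rightarrow> 'k)^'n^'n" where "Y = (\<chi> i j. (\<lambda>A. matrix_inv A $ i $ j))"
  obtain xs1 where xs1: "set xs1 = {X $ i $ j | i j. True}" by (rule matrix_entry_list)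
  obtain xs2 where xs2: "set xs2 = {Y $ i $ j | i j. True}" by (rule matrix_entry_list)
  define T where "T = fold (\<lambda>x R. adjoin R x) (xs1 @ xs2) R"
  have T: "ring_mod_prime T Z" "R \<subseteq> T" "set (xs1 @ xs2) \<subseteq> T"
    using fold_adjoin[OF ring] unfolding T_def by blast+
  interpret T: ring_mod_prime T Z by fact
  have XT: "X $ i $ j \<in> T" and YT: "Y $ i $ j \<in> T" for i j
  proof -
    have "X $ i $ j \<in> set xs1" "Y $ i $ j \<in> set xs2" unfolding xs1 xs2 by blast+
    then show "X $ i $ j \<in> T" "Y $ i $ j \<in> T" using T(3) by auto
  qed
  have FT: "F \<in> T" if "F \<in> fun_alg entries" for F
    using that
  proof induction
    case (gen f)
    then obtain i j where "f = X $ i $ j" by (auto simp: entries_def X_def)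
    then show ?case using XT by simp
  next
    case (const c)
    then show ?case using T(2) \<open>\<And>c. (\<lambda>_. c) \<in> R\<close> by blast
  next
    case (add f g)
    then show ?case using T.add[of f g] by (simp add: plus_fun_def)
  next
    case (mult f g)
    then show ?case using T.mult[of f g] by (simp add: times_fun_def)
  qed
  obtain a where a: "a \<in> R - Z" "\<forall>\<phi> :: ('k^'n^'n \<Rightarrow> 'k) \<Rightarrow> 'k dual. hom_mod R Z \<phi> \<and> dual_re (\<phi> a) \<noteq> 0 \<longrightarrow>
      (\<exists>\<psi>. hom_mod T Z \<psi> \<and> (\<forall>a\<in>R. \<psi> a = \<phi> a) \<and> dual_re (\<psi> 1) \<noteq> 0)"
    using extend_specialisation_list[OF ring, of 1 "xs1 @ xs2"] T.one T.Z1 unfolding T_def by blast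
  obtain Pa where Pa: "a = (\<lambda>g. Pa (orb g))" "Pa \<in> ?A" using a(1) unfolding R_def by blast
  \<comment> \<open>Any point of the orbit at which \<open>Pa\<close> does not vanish is general
    enough. It is fixed before \<delta> is given, so that one point serves all tangent
    vectors.\<close>
  have "\<exists>g\<in>L. Pa (orb g) \<noteq> 0"
  proof (rule ccontr)
    assume "\<not> ?thesis"
    then have "a \<in> I" by (simp add: I_def Pa(1))
    then show False using a(1) Z(1) by blast
  qed
  then obtain g0 where g0: "g0 \<in> L" "Pa (orb g0) \<noteq> 0" by blast
  show ?thesis
  proof (rule bexI[OF _ g0(1)], rule ballI)
    fix \<delta> assume \<delta>: "\<delta> \<in> dual_space V"
    have g0d: "orb g0 \<in> dual_space V"
      using mvs.subspace_add[OF subV] mvs.subspace_scale[OF subV] unfolding dual_space_def orb_def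
      by (simp add: matrix_add_mult matrix_add_ldistrib mscale_mult_left mscale_mult_right \<Gamma>_lin)
    \<comment> \<open>The representative \<open>P\<close> is a choice; the difference of two choices
      has pullback zero, which is in \<open>Z\<close>.\<close>
    define \<phi> where "\<phi> b = dual_eval (orb g0) \<delta> (SOME P. P \<in> ?A \<and> b = (\<lambda>g. P (orb g)))" for b
    have ev_zero: "dual_eval (orb g0) \<delta> P = 0" if "P \<in> ?A" "(\<lambda>g. P (orb g)) \<in> Z" for P
      using Z_van[OF that dual_space_line[OF g0d \<delta>]] dual_evalI[of 0 P "orb g0" \<delta>] by (simp add: zero_dual_def)
    have \<phi>: "\<phi> (\<lambda>g. P (orb g)) = dual_eval (orb g0) \<delta> P" if P: "P \<in> ?A" for P
    proof -
      define Q where "Q = (SOME Q. Q \<in> ?A \<and> (\<lambda>g. P (orb g)) = (\<lambda>g. Q (orb g)))"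
      have "Q \<in> ?A \<and> (\<lambda>g. P (orb g)) = (\<lambda>g. Q (orb g))"
        unfolding Q_def by (rule someI[of _ P]) (use P in auto)
      then have Q: "Q \<in> ?A" "\<And>g. P (orb g) = Q (orb g)" by (auto dest: fun_cong)
      have m: "(\<lambda>x. -1 * Q x) \<in> ?A" by (rule fun_alg_scale[OF Q(1)])
      have "(\<lambda>g. P (orb g) + -1 * Q (orb g)) = 0" by (simp add: fun_eq_iff Q(2))
      then have "dual_eval (orb g0) \<delta> (\<lambda>x. P x + -1 * Q x) = 0"
        using Z(3) by (intro ev_zero fun_alg.add P m) simp
      then have "dual_eval (orb g0) \<delta> P + dual_eval (orb g0) \<delta> (\<lambda>_. - 1) * dual_eval (orb g0) \<delta> Q = 0"
        using dual_eval_simps(3)[OF P m] dual_eval_simps(4)[OF fun_alg.const Q(1), of "orb g0" \<delta> "-1"] by simp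
      moreover have "dual_eval (orb g0) \<delta> (\<lambda>_. - 1 :: 'k) = - 1"
        by (simp add: dual_eval_simps one_dual_def uminus_dual_def)
      ultimately have "dual_eval (orb g0) \<delta> P = dual_eval (orb g0) \<delta> Q" by simp
      then show ?thesis by (simp add: \<phi>_def Q_def)
    qed
    have hom: "hom_mod R Z \<phi>"
      unfolding hom_mod_def
    proof (intro conjI ballI)
      show "\<phi> 1 = 1" using \<phi>[OF fun_alg.const, of 1] by (simp add: dual_eval_simps one_dual_def one_fun_def)
    next
      fix a b assume "a \<in> R" "b \<in> R"
      then obtain P Q where PQ: "a = (\<lambda>g. P (orb g))" "b = (\<lambda>g. Q (orb g))" "P \<in> ?A" "Q \<in> ?A"
        unfolding R_def by blast
      show "\<phi> (a + b) = \<phi> a + \<phi> b"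
        using \<phi>[OF fun_alg.add[OF PQ(3,4)]] by (simp add: PQ plus_fun_def \<phi> dual_eval_simps(3)[OF PQ(3,4)])
      show "\<phi> (a * b) = \<phi> a * \<phi> b"
        using \<phi>[OF fun_alg.mult[OF PQ(3,4)]] by (simp add: PQ times_fun_def \<phi> dual_eval_simps(4)[OF PQ(3,4)])
    next
      fix a assume "a \<in> R \<inter> Z"
      then obtain P where "P \<in> ?A" "a = (\<lambda>g. P (orb g))" "(\<lambda>g. P (orb g)) \<in> Z" unfolding R_def by blast
      then show "\<phi> a = 0" using \<phi> ev_zero by simp
    qed
    have "dual_re (\<phi> a) \<noteq> 0" using g0(2) by (simp add: Pa \<phi> dual_eval_def)
    then obtain \<psi> where \<psi>: "hom_mod T Z \<psi>" "\<forall>a\<in>R. \<psi> a = \<phi> a" using a(2) hom by blast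
    have \<psi>const: "\<psi> (\<lambda>_. c) = Dual c 0" for c
      using \<psi>(2) const \<phi>[OF fun_alg.const, of c] by (simp add: dual_eval_simps)
    define M where "M = (\<chi> i j. \<psi> (X $ i $ j))"
    define N where "N = (\<chi> i j. \<psi> (Y $ i $ j))"
    define M0 where "M0 = (\<chi> i j. dual_re (M $ i $ j))"
    define M1 where "M1 = (\<chi> i j. dual_eps (M $ i $ j))"
    define N0 where "N0 = (\<chi> i j. dual_re (N $ i $ j))"
    define N1 where "N1 = (\<chi> i j. dual_eps (N $ i $ j))"
    have ev: "\<psi> F = Dual (F M0) (dir_deriv F M0 M1)" if "F \<in> fun_alg entries" for F
      using that
    proof induction
      case (gen f)
      then obtain i j where f: "f = (\<lambda>A. A $ i $ j)" by (auto simp: entries_def)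
      then have "f = X $ i $ j" by (simp add: X_def)
      then have "\<psi> f = M $ i $ j" by (simp add: M_def)
      then show ?case unfolding f by (simp add: M0_def M1_def)
    next
      case (const c)
      then show ?case by (simp add: \<psi>const)
    next
      case (add f g)
      have "\<psi> (\<lambda>x. f x + g x) = \<psi> f + \<psi> g"
        using T.hom_add[OF \<psi>(1) FT FT, OF add.hyps(1,2)] by (simp add: plus_fun_def)
      then show ?case using add by (simp add: dir_deriv_add plus_dual_def)
    next
      case (mult f g)
      have "\<psi> (\<lambda>x. f x * g x) = \<psi> f * \<psi> g"
        using T.hom_mult[OF \<psi>(1) FT FT, OF mult.hyps(1,2)] by (simp add: times_fun_def)
      then show ?case using mult by (simp add: dir_deriv_mult times_dual_def)
    qed
    have van: "F M0 = 0 \<and> dir_deriv F M0 M1 = 0" if "F \<in> fun_alg entries" "\<And>g. g \<in> L \<Longrightarrow> F g = 0" for F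
    proof -
      have "F \<in> I" using that(2) by (simp add: I_def)
      then have "\<psi> F = 0" using Z(1) T.hom_Z[OF \<psi>(1) FT[OF that(1)]] by blast
      then show ?thesis using ev[OF that(1)] by (simp add: zero_dual_def)
    qed
    \<comment> \<open>The product is the identity on \<open>L\<close>; that suffices, since
      functions that vanish on \<open>L\<close> are in \<open>Z\<close>.\<close>
    have YX: "(\<chi> i j. \<psi> ((Y ** X) $ i $ j)) = mat 1"
    proof -
      have "\<psi> ((Y ** X) $ i $ j) = (mat 1 :: 'k dual^'n^'n) $ i $ j" for i j
      proof -
        let ?m = "(mat 1 :: ('k^'n^'n \<Rightarrow> 'k)^'n^'n) $ i $ j"
        have m: "?m \<in> T" by (simp add: mat_def T.zero T.one)
        have YXT: "(Y ** X) $ i $ j \<in> T" by (rule mem_matrix_mult[OF T(1) YT XT])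
        have "((Y ** X) $ i $ j - ?m) g = 0" if "g \<in> L" for g
        proof -
          have "((Y ** X) $ i $ j) g = (matrix_inv g ** g) $ i $ j"
            by (simp add: matrix_matrix_mult_def sum_fun_apply X_def Y_def)
          also have "\<dots> = ?m g" using matrix_inv_works(2)[OF grp(2)[OF that]] by (simp add: mat_def)
          finally show ?thesis by simp
        qed
        then have "(Y ** X) $ i $ j - ?m \<in> Z" using Z(1) unfolding I_def by blast
        then have "\<psi> ((Y ** X) $ i $ j) - \<psi> ?m = 0"
          using T.hom_Z[OF \<psi>(1) T.diff[OF YXT m]] T.hom_diff[OF \<psi>(1) YXT m] by simp
        moreover have "\<psi> ?m = (mat 1 :: 'k dual^'n^'n) $ i $ j"
          by (simp add: mat_def T.hom_0[OF \<psi>(1)] T.hom_1[OF \<psi>(1)])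
        ultimately show ?thesis by simp
      qed
      then show ?thesis by (simp add: vec_eq_iff)
    qed
    then have NM: "N ** M = mat 1"
      using hom_mod_matrix_mult[OF T(1) \<psi>(1) YT XT] by (simp add: N_def M_def)
    have mat_1: "(\<chi> i j. dual_re ((mat 1 :: 'k dual^'n^'n) $ i $ j)) = mat 1"
      "(\<chi> i j. dual_eps ((mat 1 :: 'k dual^'n^'n) $ i $ j)) = 0"
      by (simp_all add: mat_def vec_eq_iff)
    have "N0 ** M0 = mat 1"
      using dual_matrix_mult(1)[of N M, unfolded NM mat_1] by (simp add: N0_def M0_def)
    then have inv: "N0 ** M0 = mat 1" "M0 ** N0 = mat 1" by (simp_all add: matrix_left_right_inverse)
    then have N0: "matrix_inv M0 = N0" "invertible M0"
      by (simp_all add: matrix_inv_unique) (auto simp: invertible_def)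
    have "N0 ** M1 + N1 ** M0 = 0"
      using dual_matrix_mult(2)[of N M, unfolded NM mat_1] by (simp add: N0_def M0_def N1_def M1_def)
    then have "(N0 ** M1 + N1 ** M0) ** N0 = 0" by (simp add: vec_eq_iff matrix_matrix_mult_def)
    then have N1: "N1 = - (N0 ** M1 ** N0)"
      using inv(2) by (simp add: matrix_add_mult matrix_mul_assoc[symmetric] eq_neg_iff_add_eq_0 add.commute)
    have M0L: "M0 \<in> L" by (rule algebraic_group_closed[OF L N0(2)]) (use van in blast)
    have N0L: "N0 \<in> L" using grp(4)[OF M0L] N0(1) by simp
    \<comment> \<open>Left translation by the inverse of \<open>M0\<close> carries the tangent
      vector \<open>M1\<close> at \<open>M0\<close> to the identity.\<close>
    define \<xi> where "\<xi> = N0 ** M1"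
    have \<xi>L: "\<xi> \<in> Lie L"
      unfolding Lie_iff
    proof (intro ballI impI)
      fix F assume F: "F \<in> fun_alg entries" "\<forall>g\<in>L. F g = 0"
      have "(\<lambda>A. F (N0 ** A)) \<in> fun_alg entries"
        by (intro fun_alg_entries_comp[OF F(1)] matrix_mult_fun_alg entry_fun_alg fun_alg.const)
      then have "dir_deriv (\<lambda>A. F (N0 ** A)) M0 M1 = 0"
        using van[of "\<lambda>A. F (N0 ** A)"] F(2) grp(3)[OF N0L] by blast
      moreover have "dir_deriv (\<lambda>A. F (N0 ** A)) M0 M1 = dir_deriv F (mat 1) \<xi>"
        by (rule dir_deriv_comp_affine[OF F(1)]) (simp add: \<xi>_def matrix_add_ldistrib mscale_mult_right inv)
      ultimately show "dir_deriv F (mat 1) \<xi> = 0" by simp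
    qed
    show "\<exists>g\<in>L. \<exists>\<xi>\<in>Lie L. \<forall>v\<in>V. \<Gamma> (matrix_inv g0 ** v ** g0) = \<Gamma> (matrix_inv g ** v ** g) \<and>
        \<delta> v = \<Gamma> (lie_bracket (matrix_inv g ** v ** g) \<xi>)"
    proof (rule bexI[OF _ M0L], rule bexI[OF _ \<xi>L], rule ballI)
      fix v assume v: "v \<in> V"
      define C :: "('k^'n^'n \<Rightarrow> 'k)^'n^'n" where "C = (\<chi> i j. (\<lambda>_. v $ i $ j))"
      define D :: "'k dual^'n^'n" where "D = (\<chi> i j. Dual (v $ i $ j) 0)"
      have CT: "C $ i $ j \<in> T" for i j using const T(2) by (auto simp: C_def)
      have CD: "(\<chi> i j. \<psi> (C $ i $ j)) = D" by (simp add: C_def D_def \<psi>const)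
      let ?U = "Y ** C ** X"
      have YC: "(Y ** C) $ i $ j \<in> T" for i j by (rule mem_matrix_mult[OF T(1) YT CT])
      have UT: "?U $ i $ j \<in> T" for i j by (rule mem_matrix_mult[OF T(1) YC XT])
      have "(\<chi> i j. \<psi> (?U $ i $ j)) = N ** D ** M"
        using hom_mod_matrix_mult[OF T(1) \<psi>(1) YC XT] hom_mod_matrix_mult[OF T(1) \<psi>(1) YT CT] CD
        by (simp add: N_def M_def)
      then have \<psi>U: "\<psi> (?U $ i $ j) = (N ** D ** M) $ i $ j" for i j by (simp add: vec_eq_iff)
      have D01: "(\<chi> i j. dual_re (D $ i $ j)) = v" "(\<chi> i j. dual_eps (D $ i $ j)) = 0"
        by (simp_all add: D_def vec_eq_iff)
      have z: "N0 ** (0 :: 'k^'n^'n) = 0" by (simp add: vec_eq_iff matrix_matrix_mult_def)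
      have re: "(\<chi> i j. dual_re ((N ** D ** M) $ i $ j)) = N0 ** v ** M0"
        and eps: "(\<chi> i j. dual_eps ((N ** D ** M) $ i $ j)) = N0 ** v ** M1 + N1 ** v ** M0"
        by (simp_all add: dual_matrix_mult D01 z flip: N0_def N1_def M0_def M1_def)
      have fv: "(\<lambda>g. (orb g) v) = (\<Sum>i\<in>UNIV. \<Sum>j\<in>UNIV. (\<lambda>_. G i j) * ?U $ i $ j)"
        using v by (simp add: fun_eq_iff orb_def \<Gamma> sum_fun_apply matrix_matrix_mult_def X_def Y_def C_def)
      \<comment> \<open>The image of one orbit coordinate under \<psi> is computed in two ways: as
        an element of \<open>R\<close> it is prescribed by \<phi>, and as a polynomial in the
        entries of \<open>X\<close> and \<open>Y\<close> it is conjugation of \<open>v\<close> by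
        the dual-number matrix \<open>M\<close>.\<close>
      have "Dual (orb g0 v) (\<delta> v) = \<psi> (\<lambda>g. (orb g) v)"
      proof -
        have "(\<lambda>\<phi>. \<phi> v) \<in> ?A" using v by (intro fun_alg.gen imageI)
        from RI[OF this] \<phi>[OF this] show ?thesis using \<psi>(2) by (simp add: dual_eval_simps)
      qed
      also have "\<dots> = (\<Sum>i\<in>UNIV. \<Sum>j\<in>UNIV. Dual (G i j) 0 * (N ** D ** M) $ i $ j)"
        unfolding fv using const T(2)
        by (simp add: T.hom_sum[OF \<psi>(1)] T.hom_mult[OF \<psi>(1)] subsetD UT T.sum T.mult \<psi>const \<psi>U)
      finally have eq: "Dual (orb g0 v) (\<delta> v) = \<dots>" .
      have s: "dual_re (sum f I) = (\<Sum>i\<in>I. dual_re (f i))" "dual_eps (sum f I) = (\<Sum>i\<in>I. dual_eps (f i))"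
        for f :: "'n \<Rightarrow> 'k dual" and I
        by (induction I rule: infinite_finite_induct) auto
      have "orb g0 v = \<Gamma> (\<chi> i j. dual_re ((N ** D ** M) $ i $ j))"
        using arg_cong[OF eq, of dual_re] by (simp add: s \<Gamma>)
      moreover have "\<delta> v = \<Gamma> (\<chi> i j. dual_eps ((N ** D ** M) $ i $ j))"
        using arg_cong[OF eq, of dual_eps] by (simp add: s \<Gamma>)
      moreover have "N0 ** v ** M1 + N1 ** v ** M0 = lie_bracket (N0 ** v ** M0) \<xi>"
      proof -
        have "N0 ** v ** M0 ** (N0 ** M1) = N0 ** v ** (M0 ** N0) ** M1" by (simp only: matrix_mul_assoc)
        moreover have "(- (N0 ** M1 ** N0)) ** v ** M0 = - (N0 ** M1 ** N0 ** v ** M0)"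
          by (simp add: vec_eq_iff matrix_matrix_mult_def sum_negf)
        ultimately show ?thesis
          unfolding lie_bracket_def \<xi>_def N1 using inv by (simp add: matrix_mul_assoc)
      qed
      ultimately show "\<Gamma> (matrix_inv g0 ** v ** g0) = \<Gamma> (matrix_inv M0 ** v ** M0) \<and>
          \<delta> v = \<Gamma> (lie_bracket (matrix_inv M0 ** v ** M0) \<xi>)"
        unfolding re eps using v by (simp add: N0(1) orb_def)
    qed
  qed
qed

text \<open>The lift is available at a general point of the orbit, the translate of \<gamma> by
  \<open>g0\<close>, and it comes with another representative \<open>g\<close> of the same point.
  Hence \<xi> is conjugated by \<open>g\<close> and then back by \<open>g0\<close>.\<close>

lemma open_orbit_tangent:
  fixes L V :: "('k::{alg_closed_field, field_char_0}^'n^'n) set"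
  assumes L: "algebraic_group L" and subV: "mvs.subspace V"
    and V: "\<And>g v. g \<in> L \<Longrightarrow> v \<in> V \<Longrightarrow> g ** v ** matrix_inv g \<in> V"
    and LV: "\<And>x v. x \<in> Lie L \<Longrightarrow> v \<in> V \<Longrightarrow> lie_bracket x v \<in> V"
    and \<Gamma>: "\<And>X. \<Gamma> X = (\<Sum>i\<in>UNIV. \<Sum>j\<in>UNIV. G i j * X $ i $ j)"
    and \<gamma>: "\<gamma> \<in> dual_space V" "\<And>v. v \<in> V \<Longrightarrow> \<gamma> v = \<Gamma> v"
    and op: "openin (zariski_dual V) (dual_orbit V L \<gamma>)"
    and \<delta>: "\<delta> \<in> dual_space V"
  shows "\<exists>\<xi>\<in>Lie L. \<forall>v\<in>V. \<Gamma> (lie_bracket \<xi> v) = \<delta> v"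
proof -
  have sub: "subgroup L GL" using L by (simp add: algebraic_group_def)
  note grp = subgroup_GL_D[OF sub]
  note inv = matrix_inv_works[OF grp(2)]
  have inv_inv: "matrix_inv (matrix_inv g) = g" if "g \<in> L" for g
    by (rule matrix_inv_unique) (simp_all add: inv that)
  have V': "matrix_inv g ** v ** g \<in> V" if "g \<in> L" "v \<in> V" for g v
    using V[OF grp(4)[OF that(1)] that(2)] inv_inv[OF that(1)] by simp
  have AdL: "g ** \<xi> ** matrix_inv g \<in> Lie L" if "g \<in> L" "\<xi> \<in> Lie L" for g \<xi>
    using that by (intro conj_Lie grp)
  obtain g0 where g0: "g0 \<in> L" and lift: "\<And>\<delta>. \<delta> \<in> dual_space V \<Longrightarrow> \<exists>g\<in>L. \<exists>\<xi>\<in>Lie L. \<forall>v\<in>V.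
      \<Gamma> (matrix_inv g0 ** v ** g0) = \<Gamma> (matrix_inv g ** v ** g) \<and>
      \<delta> v = \<Gamma> (lie_bracket (matrix_inv g ** v ** g) \<xi>)"
    using open_orbit_lift[OF L subV V' \<Gamma> \<gamma> op] by blast
  \<comment> \<open>The prescribed vector \<delta>, transported from \<gamma> to the translate by
    \<open>g0\<close>. The sign makes up for the reversed order in the bracket of the lift.\<close>
  define \<delta>0 where "\<delta>0 = (\<lambda>v. if v \<in> V then - \<delta> (matrix_inv g0 ** v ** g0) else 0)"
  have "\<delta>0 \<in> dual_space V"
    using mvs.subspace_add[OF subV] mvs.subspace_scale[OF subV] V'[OF g0] unfolding dual_space_def \<delta>0_def
    by (simp add: matrix_add_mult matrix_add_ldistrib mscale_mult_left mscale_mult_right dual_space_D[OF \<delta>])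
  from lift[OF this] obtain g \<xi> where g: "g \<in> L" and \<xi>: "\<xi> \<in> Lie L" and eq: "\<And>v. v \<in> V \<Longrightarrow>
      \<Gamma> (matrix_inv g0 ** v ** g0) = \<Gamma> (matrix_inv g ** v ** g)"
      "\<And>v. v \<in> V \<Longrightarrow> \<delta>0 v = \<Gamma> (lie_bracket (matrix_inv g ** v ** g) \<xi>)"
    by blast
  define \<xi>1 where "\<xi>1 = g ** \<xi> ** matrix_inv g"
  define \<xi>2 where "\<xi>2 = matrix_inv g0 ** \<xi>1 ** g0"
  have \<xi>1: "\<xi>1 \<in> Lie L" unfolding \<xi>1_def by (rule AdL[OF g \<xi>])
  have \<xi>2: "\<xi>2 \<in> Lie L" using AdL[OF grp(4)[OF g0] \<xi>1] inv_inv[OF g0] by (simp add: \<xi>2_def)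
  have neg: "\<Gamma> (- X) = - \<Gamma> X" for X by (simp add: \<Gamma> sum_negf)
  have "\<Gamma> (lie_bracket \<xi>2 w) = \<delta> w" if w: "w \<in> V" for w
  proof -
    define v where "v = g0 ** w ** matrix_inv g0"
    have v: "v \<in> V" unfolding v_def by (rule V[OF g0 w])
    have "matrix_inv g0 ** v ** g0 = (matrix_inv g0 ** g0) ** w ** (matrix_inv g0 ** g0)"
      unfolding v_def by (simp only: matrix_mul_assoc)
    then have wv: "matrix_inv g0 ** v ** g0 = w" by (simp add: inv g0)
    have "matrix_inv g ** \<xi>1 ** g = (matrix_inv g ** g) ** \<xi> ** (matrix_inv g ** g)"
      unfolding \<xi>1_def by (simp only: matrix_mul_assoc)
    then have \<xi>': "matrix_inv g ** \<xi>1 ** g = \<xi>" by (simp add: inv g)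
    have "lie_bracket v \<xi>1 = - lie_bracket \<xi>1 v" by (rule lie_bracket_skew)
    then have bV: "lie_bracket v \<xi>1 \<in> V" using LV[OF \<xi>1 v] mvs.subspace_neg[OF subV] by simp
    have "- \<delta> w = \<delta>0 v" using v by (simp add: \<delta>0_def wv)
    also have "\<dots> = \<Gamma> (lie_bracket (matrix_inv g ** v ** g) (matrix_inv g ** \<xi>1 ** g))"
      by (simp add: eq(2)[OF v] \<xi>')
    also have "\<dots> = \<Gamma> (matrix_inv g ** lie_bracket v \<xi>1 ** g)"
      by (simp add: conj_lie_bracket inv g)
    also have "\<dots> = \<Gamma> (matrix_inv g0 ** lie_bracket v \<xi>1 ** g0)" by (simp add: eq(1)[OF bV])
    also have "\<dots> = \<Gamma> (lie_bracket w \<xi>2)"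
      using conj_lie_bracket[of "matrix_inv g0" g0 v \<xi>1] by (simp add: inv g0 wv \<xi>2_def)
    also have "\<dots> = - \<Gamma> (lie_bracket \<xi>2 w)"
      using neg lie_bracket_skew[of w \<xi>2] by simp
    finally show ?thesis by simp
  qed
  then show ?thesis using \<xi>2 by blast
qed

section \<open>Contact forms on Lie algebras of matrices\<close>

lemma matrix_fin_dim: "\<exists>B. fin_dim_char_0 (mscale :: 'k::field_char_0 \<Rightarrow> 'k^'n^'n \<Rightarrow> _) B"
proof -
  define e where "e i j = ((\<chi> k l. if k = i \<and> l = j then 1 else 0) :: 'k^'n^'n)" for i j
  define E where "E = {e i j | i j. True}"
  have "E \<subseteq> (\<lambda>p. e (fst p) (snd p)) ` UNIV"
  proof
    fix X assume "X \<in> E"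
    then obtain i j where "X = e i j" unfolding E_def by blast
    then show "X \<in> (\<lambda>p. e (fst p) (snd p)) ` UNIV" by (intro image_eqI[of _ _ "(i, j)"]) simp_all
  qed
  then have finE: "finite E" by (rule finite_subset) simp
  have span: "X \<in> mvs.span E" for X
  proof -
    have "X = (\<Sum>i\<in>UNIV. \<Sum>j\<in>UNIV. mscale (X $ i $ j) (e i j))"
      unfolding e_def by (rule matrix_unit_sum)
    also have "\<dots> \<in> mvs.span E"
    proof (intro mvs.span_sum mvs.span_scale mvs.span_base)
      show "e i j \<in> E" for i j unfolding E_def by blast
    qed
    finally show ?thesis .
  qed
  obtain B where B: "mvs.independent B" "UNIV \<subseteq> mvs.span (B :: ('k^'n^'n) set)"
    using mvs.basis_exists[of "UNIV :: ('k^'n^'n) set"] by metis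
  have "B \<subseteq> mvs.span E" using span by (rule subsetI)
  from mvs.independent_span_bound[OF finE B(1) this] have "finite B" ..
  moreover have "mvs.span B = UNIV" by (rule subset_antisym[OF subset_UNIV B(2)])
  ultimately have "fin_dim_char_0 (mscale :: 'k \<Rightarrow> 'k^'n^'n \<Rightarrow> _) B"
    using B(1) by (intro fin_dim_char_0.intro finite_dimensional_vector_space.intro
        mvs.vector_space_axioms finite_dimensional_vector_space_axioms.intro)
  then show ?thesis ..
qed

lemma dual_space_extend:
  fixes W :: "('k::field_char_0^'n^'n) set"
  assumes W: "mvs.subspace W" and \<phi>: "\<phi> \<in> dual_space W"
  shows "\<exists>\<Gamma>. (\<forall>X Y. \<Gamma> (X + Y) = \<Gamma> X + \<Gamma> Y) \<and> (\<forall>c X. \<Gamma> (mscale c X) = c * \<Gamma> X) \<and> (\<forall>x\<in>W. \<Gamma> x = \<phi> x)"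
proof -
  interpret K: vector_space "(*) :: 'k \<Rightarrow> 'k \<Rightarrow> 'k" by unfold_locales (simp_all add: algebra_simps)
  interpret P: vector_space_pair "mscale :: 'k \<Rightarrow> 'k^'n^'n \<Rightarrow> _" "(*) :: 'k \<Rightarrow> 'k \<Rightarrow> 'k" ..
  obtain B where B: "B \<subseteq> W" "mvs.independent B" "W \<subseteq> mvs.span B" using mvs.basis_exists[of W] by metis
  obtain \<Gamma> where \<Gamma>': "Vector_Spaces.linear mscale (*) \<Gamma> \<and> (\<forall>x\<in>B. \<Gamma> x = \<phi> x)"
    using P.linear_independent_extend[OF B(2), of \<phi>] ..
  then have \<Gamma>: "Vector_Spaces.linear mscale (*) \<Gamma>" "\<And>x. x \<in> B \<Longrightarrow> \<Gamma> x = \<phi> x" by simp_all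
  have add: "\<Gamma> (X + Y) = \<Gamma> X + \<Gamma> Y" and scale: "\<Gamma> (mscale c X) = c * \<Gamma> X" for X Y c
    by (rule P.linear_add[OF \<Gamma>(1)], rule P.linear_scale[OF \<Gamma>(1)])
  have "mvs.span B \<subseteq> {x\<in>W. \<Gamma> x = \<phi> x}"
  proof (rule mvs.span_minimal)
    show "B \<subseteq> {x\<in>W. \<Gamma> x = \<phi> x}" using B(1) \<Gamma>(2) by (simp add: subset_iff)
    have "\<Gamma> 0 = 0" "\<phi> 0 = 0"
      using scale[of 0 0] dual_space_D(2)[OF \<phi> mvs.subspace_0[OF W], of 0] by simp_all
    then show "mvs.subspace {x\<in>W. \<Gamma> x = \<phi> x}"
      using W by (intro mvs.subspaceI)
        (simp_all add: mvs.subspace_0 mvs.subspace_add mvs.subspace_scale add scale dual_space_D[OF \<phi>])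
  qed
  with B(3) have "W \<subseteq> {x\<in>W. \<Gamma> x = \<phi> x}" by (rule subset_trans)
  then have "\<forall>x\<in>W. \<Gamma> x = \<phi> x" by (simp add: subset_iff)
  with add scale show ?thesis by (intro exI[of _ \<Gamma>]) simp
qed

lemma dual_space_restrict:
  assumes "\<And>X Y. X \<in> W \<Longrightarrow> Y \<in> W \<Longrightarrow> \<Gamma> (X + Y) = \<Gamma> X + \<Gamma> Y" "\<And>c X. X \<in> W \<Longrightarrow> \<Gamma> (mscale c X) = c * \<Gamma> X"
    and "mvs.subspace W"
  shows "(\<lambda>x. if x \<in> W then \<Gamma> x else 0) \<in> dual_space W"
  using assms by (simp add: dual_space_def mvs.subspace_add mvs.subspace_scale)

text \<open>The sum of \<open>W1\<close> and \<open>W2\<close> is direct, so the two functionals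
  glue to one on it, which is then extended to all matrices and cut back to
  \<open>W\<close>.\<close>

lemma dual_space_extend2:
  fixes W1 W2 W :: "('k::field_char_0^'n^'n) set"
  assumes W1: "mvs.subspace W1" and W2: "mvs.subspace W2" and 0: "W1 \<inter> W2 \<subseteq> {0}"
    and \<phi>1: "\<phi>1 \<in> dual_space W1" and \<phi>2: "\<phi>2 \<in> dual_space W2"
    and W: "mvs.subspace W" "W1 \<subseteq> W" "W2 \<subseteq> W"
  obtains \<alpha> where "\<alpha> \<in> dual_space W" "\<forall>x\<in>W1. \<alpha> x = \<phi>1 x" "\<forall>x\<in>W2. \<alpha> x = \<phi>2 x"
proof -
  define S where "S = {x + y | x y. x \<in> W1 \<and> y \<in> W2}"
  have S: "mvs.subspace S" unfolding S_def by (rule mvs.subspace_sums[OF W1 W2])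
  have uniq: "x = x' \<and> y = y'" if "x \<in> W1" "x' \<in> W1" "y \<in> W2" "y' \<in> W2" "x + y = x' + y'" for x x' y y'
  proof -
    have "x - x' = y' - y" using that(5) by (simp add: algebra_simps)
    moreover have "x - x' \<in> W1" "y' - y \<in> W2"
      using mvs.subspace_diff[OF W1 that(1,2)] mvs.subspace_diff[OF W2 that(4,3)] by auto
    ultimately have "x - x' = 0" "y' - y = 0" using 0 by auto
    then show ?thesis by simp
  qed
  define \<phi> where "\<phi> w = (if w \<in> S then THE c. \<exists>x\<in>W1. \<exists>y\<in>W2. w = x + y \<and> c = \<phi>1 x + \<phi>2 y else 0)" for w
  have \<phi>: "\<phi> (x + y) = \<phi>1 x + \<phi>2 y" if "x \<in> W1" "y \<in> W2" for x y
  proof -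
    have "x + y \<in> S" using that by (auto simp: S_def)
    moreover have "(THE c. \<exists>x'\<in>W1. \<exists>y'\<in>W2. x + y = x' + y' \<and> c = \<phi>1 x' + \<phi>2 y') = \<phi>1 x + \<phi>2 y"
    proof (rule the_equality)
      show "\<exists>x'\<in>W1. \<exists>y'\<in>W2. x + y = x' + y' \<and> \<phi>1 x + \<phi>2 y = \<phi>1 x' + \<phi>2 y'" using that by blast
    next
      fix c assume "\<exists>x'\<in>W1. \<exists>y'\<in>W2. x + y = x' + y' \<and> c = \<phi>1 x' + \<phi>2 y'"
      then obtain x' y' where "x' \<in> W1" "y' \<in> W2" "x + y = x' + y'" and c: "c = \<phi>1 x' + \<phi>2 y'" by blast
      with uniq[OF that(1) _ that(2)] have "x = x' \<and> y = y'" by blast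
      then show "c = \<phi>1 x + \<phi>2 y" using c by simp
    qed
    ultimately show ?thesis by (simp add: \<phi>_def)
  qed
  have "\<phi> \<in> dual_space S"
    unfolding dual_space_def
  proof (intro CollectI conjI ballI allI impI)
    fix w w' assume "w \<in> S" "w' \<in> S"
    then obtain x y x' y' where *: "w = x + y" "w' = x' + y'" "x \<in> W1" "y \<in> W2" "x' \<in> W1" "y' \<in> W2"
      by (auto simp: S_def)
    have e: "w + w' = (x + x') + (y + y')" by (simp add: *)
    have "\<phi> (w + w') = \<phi>1 (x + x') + \<phi>2 (y + y')"
      unfolding e using * by (intro \<phi> mvs.subspace_add W1 W2)
    also have "\<dots> = \<phi> w + \<phi> w'"
      using * by (simp add: \<phi> dual_space_D[OF \<phi>1] dual_space_D[OF \<phi>2])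
    finally show "\<phi> (w + w') = \<phi> w + \<phi> w'" .
  next
    fix c w assume "w \<in> S"
    then obtain x y where *: "w = x + y" "x \<in> W1" "y \<in> W2" by (auto simp: S_def)
    then show "\<phi> (mscale c w) = c * \<phi> w"
      by (simp add: mvs.scale_right_distrib \<phi> mvs.subspace_scale W1 W2 dual_space_D[OF \<phi>1] dual_space_D[OF \<phi>2]
          distrib_left)
  qed (simp add: \<phi>_def)
  from dual_space_extend[OF S this] obtain \<Gamma> where \<Gamma>': "(\<forall>X Y. \<Gamma> (X + Y) = \<Gamma> X + \<Gamma> Y) \<and>
      (\<forall>c X. \<Gamma> (mscale c X) = c * \<Gamma> X) \<and> (\<forall>x\<in>S. \<Gamma> x = \<phi> x)" ..
  then have \<Gamma>: "\<Gamma> (X + Y) = \<Gamma> X + \<Gamma> Y" "\<Gamma> (mscale c X) = c * \<Gamma> X" "x \<in> S \<Longrightarrow> \<Gamma> x = \<phi> x" for X Y c x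
    by simp_all
  have "\<phi>1 0 = 0" "\<phi>2 0 = 0"
    using dual_space_D(2)[OF \<phi>1 mvs.subspace_0[OF W1], of 0] dual_space_D(2)[OF \<phi>2 mvs.subspace_0[OF W2], of 0]
    by simp_all
  note 0 = this
  have 1: "\<Gamma> x = \<phi>1 x" if x: "x \<in> W1" for x
  proof -
    have "x + 0 \<in> S" unfolding S_def using x mvs.subspace_0[OF W2] by blast
    then show ?thesis using \<phi>[OF x mvs.subspace_0[OF W2]] \<Gamma>(3)[of x] 0 by simp
  qed
  have 2: "\<Gamma> y = \<phi>2 y" if y: "y \<in> W2" for y
  proof -
    have "0 + y \<in> S" unfolding S_def using y mvs.subspace_0[OF W1] by blast
    then show ?thesis using \<phi>[OF mvs.subspace_0[OF W1] y] \<Gamma>(3)[of y] 0 by simp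
  qed
  show ?thesis
    by (rule that[OF dual_space_restrict[of W \<Gamma>, OF \<Gamma>(1,2) W(1)]]) (use 1 2 W(2,3) in \<open>simp_all add: subsetD\<close>)
qed

definition lie_subalgebra :: "('k::field^'n^'n) set \<Rightarrow> bool" where
  "lie_subalgebra h \<longleftrightarrow> mvs.subspace h \<and> (\<forall>x\<in>h. \<forall>y\<in>h. lie_bracket x y \<in> h)"

lemma lie_subalgebraD:
  assumes "lie_subalgebra h"
  shows "mvs.subspace h" "x \<in> h \<Longrightarrow> y \<in> h \<Longrightarrow> lie_bracket x y \<in> h"
  using assms by (simp_all add: lie_subalgebra_def)

text \<open>This is equivalent to \<open>(d\<alpha>)\<^sup>m \<and> \<alpha> \<noteq> 0\<close> only if the dimension of \<open>h\<close> is \<open>2 m + 1\<close>.\<close>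

definition contact_form :: "('k::field^'n^'n) set \<Rightarrow> ('k^'n^'n \<Rightarrow> 'k) \<Rightarrow> bool" where
  "contact_form h \<alpha> \<longleftrightarrow> (\<forall>z\<in>h. (\<forall>y\<in>h. \<alpha> (lie_bracket z y) = 0) \<longrightarrow> \<alpha> z = 0 \<longrightarrow> z = 0)"

lemma alternating_sum_fun_alg:
  assumes x: "\<And>i. x i \<in> h" and h: "lie_subalgebra h"
  shows "(\<lambda>\<alpha>. alternating_sum m (\<lambda>a b. - \<alpha> (lie_bracket a b)) \<alpha> x) \<in> fun_alg (evaluations h)"
proof -
  have ev: "(\<lambda>\<alpha>. \<alpha> v) \<in> fun_alg (evaluations h)" if "v \<in> h" for v
    using that by (intro fun_alg.gen imageI)
  show ?thesis
    unfolding alternating_sum_def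
    by (intro fun_alg_sum fun_alg_scale fun_alg.mult fun_alg_prod fun_alg_minus ev x lie_subalgebraD(2)[OF h])
qed

lemma coadjoint_form_alternating:
  fixes h :: "('k::field_char_0^'n^'n) set"
  assumes "fin_dim_char_0 (mscale :: 'k \<Rightarrow> 'k^'n^'n \<Rightarrow> _) B" and h: "lie_subalgebra h"
    and \<alpha>: "\<alpha> \<in> dual_space h"
  shows "fin_dim_char_0.alternating_on (mscale :: 'k \<Rightarrow> 'k^'n^'n \<Rightarrow> _) h (\<lambda>a b. - \<alpha> (lie_bracket a b))"
    and "fin_dim_char_0.linear_on (mscale :: 'k \<Rightarrow> 'k^'n^'n \<Rightarrow> _) h \<alpha>"
    and "fin_dim_char_0.radical h (\<lambda>a b. - \<alpha> (lie_bracket a b)) = coadjoint_stabiliser h \<alpha>"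
proof -
  interpret fin_dim_char_0 mscale B by fact
  have "\<alpha> 0 = 0" using dual_space_D(2)[OF \<alpha> mvs.subspace_0[OF lie_subalgebraD(1)[OF h]], of 0] by simp
  then show "alternating_on h (\<lambda>a b. - \<alpha> (lie_bracket a b))"
    unfolding alternating_on_def linear_on_def
    by (simp add: lie_bracket_linear lie_bracket_self dual_space_D[OF \<alpha>] lie_subalgebraD(2)[OF h])
  show "linear_on h \<alpha>" by (simp add: linear_on_def dual_space_D[OF \<alpha>])
  show "radical h (\<lambda>a b. - \<alpha> (lie_bracket a b)) = coadjoint_stabiliser h \<alpha>"
    by (simp add: radical_def coadjoint_stabiliser_def)
qed

lemma contact_form_open:
  fixes h :: "('k::field_char_0^'n^'n) set"
  assumes h: "lie_subalgebra h" and dim: "mvs.dim h = 2 * m + 1"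
    and \<alpha>: "\<alpha> \<in> dual_space h" "contact_form h \<alpha>"
  obtains x where "\<forall>i. x i \<in> h" "alternating_sum m (\<lambda>a b. - \<alpha> (lie_bracket a b)) \<alpha> x \<noteq> 0"
proof -
  obtain B where B: "fin_dim_char_0 (mscale :: 'k \<Rightarrow> 'k^'n^'n \<Rightarrow> _) B" using matrix_fin_dim by blast
  interpret fin_dim_char_0 mscale B by (fact B)
  note cf = coadjoint_form_alternating[OF B h \<alpha>(1)]
  show ?thesis
    using alternating_sum_nonzero[OF lie_subalgebraD(1)[OF h] cf(1,2) dim] that \<alpha>(2)
    unfolding cf(3) contact_form_def coadjoint_stabiliser_def by blast
qed

lemma contact_formI:
  fixes h :: "('k::field_char_0^'n^'n) set"
  assumes h: "lie_subalgebra h" and dim: "mvs.dim h = 2 * m + 1"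
    and \<alpha>: "\<alpha> \<in> dual_space h" and x: "\<And>i. x i \<in> h" "alternating_sum m (\<lambda>a b. - \<alpha> (lie_bracket a b)) \<alpha> x \<noteq> 0"
  shows "contact_form h \<alpha>"
proof -
  obtain B where B: "fin_dim_char_0 (mscale :: 'k \<Rightarrow> 'k^'n^'n \<Rightarrow> _) B" using matrix_fin_dim by blast
  interpret fin_dim_char_0 mscale B by (fact B)
  note cf = coadjoint_form_alternating[OF B h \<alpha>]
  show ?thesis
    using alternating_sum_nonzeroD[OF lie_subalgebraD(1)[OF h] cf(1,2) dim x] unfolding cf(3)
    unfolding contact_form_def coadjoint_stabiliser_def by blast
qed

lemma contact_iff:
  fixes h :: "('k::field_char_0^'n^'n) set"
  assumes h: "lie_subalgebra h"
  shows "contact h \<longleftrightarrow> odd (mvs.dim h) \<and> (\<exists>\<alpha>\<in>dual_space h. contact_form h \<alpha>)"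
proof -
  have eq: "wedge (2 * m) 1 (wedge_power 2 (CE_diff \<alpha>) m) (\<lambda>x. \<alpha> (x 0)) x \<noteq> 0 \<longleftrightarrow>
      alternating_sum m (\<lambda>a b. - \<alpha> (lie_bracket a b)) \<alpha> x \<noteq> 0" for m \<alpha> and x :: "nat \<Rightarrow> 'k^'n^'n"
    unfolding CE_diff_def wedge_contact_eq[of m "\<lambda>a b. - \<alpha> (lie_bracket a b)" \<alpha> x] by simp
  show ?thesis
  proof
    assume "contact h"
    then obtain m \<alpha> x where *: "mvs.dim h = 2 * m + 1" "\<alpha> \<in> dual_space h" "\<And>i. x i \<in> h"
      "alternating_sum m (\<lambda>a b. - \<alpha> (lie_bracket a b)) \<alpha> x \<noteq> 0"
      unfolding contact_def eq by blast
    then show "odd (mvs.dim h) \<and> (\<exists>\<alpha>\<in>dual_space h. contact_form h \<alpha>)"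
      using contact_formI[OF h *] by auto
  next
    assume "odd (mvs.dim h) \<and> (\<exists>\<alpha>\<in>dual_space h. contact_form h \<alpha>)"
    then obtain m \<alpha> where *: "mvs.dim h = 2 * m + 1" "\<alpha> \<in> dual_space h" "contact_form h \<alpha>"
      by (auto elim!: oddE)
    obtain x where "\<forall>i. x i \<in> h" "alternating_sum m (\<lambda>a b. - \<alpha> (lie_bracket a b)) \<alpha> x \<noteq> 0"
      by (rule contact_form_open[OF h *])
    with * show "contact h" unfolding contact_def eq by blast
  qed
qed

text \<open>The arguments \<open>x\<close> found for \<alpha> are kept fixed while the functional
  varies; nonvanishing of the alternating sum at \<open>x\<close> is an open condition that implies
  \<open>contact_form\<close>.\<close>

lemma contact_form_poly:
  fixes h :: "('k::field_char_0^'n^'n) set"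
  assumes h: "lie_subalgebra h" and dim: "odd (mvs.dim h)"
    and \<alpha>: "\<alpha> \<in> dual_space h" "contact_form h \<alpha>"
  obtains F where "F \<in> fun_alg (evaluations h)" "F \<alpha> \<noteq> 0"
    "\<forall>\<alpha>'\<in>dual_space h. F \<alpha>' \<noteq> 0 \<longrightarrow> contact_form h \<alpha>'"
proof -
  obtain m where m: "mvs.dim h = 2 * m + 1" using dim by (rule oddE)
  obtain x where x': "\<forall>i. x i \<in> h" and x2: "alternating_sum m (\<lambda>a b. - \<alpha> (lie_bracket a b)) \<alpha> x \<noteq> 0"
    by (rule contact_form_open[OF h m \<alpha>])
  have x: "x i \<in> h" for i using x' ..
  show ?thesis
    by (rule that[of "\<lambda>\<alpha>. alternating_sum m (\<lambda>a b. - \<alpha> (lie_bracket a b)) \<alpha> x",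
          OF alternating_sum_fun_alg[OF x h] x2]) (intro ballI impI contact_formI[OF h m _ x])
qed

text \<open>The alternating form d\<alpha> has even rank.\<close>

lemma coadjoint_stabiliser_parity:
  fixes h :: "('k::field_char_0^'n^'n) set"
  assumes h: "lie_subalgebra h" and \<alpha>: "\<alpha> \<in> dual_space h"
  shows "even (mvs.dim h) \<longleftrightarrow> even (mvs.dim (coadjoint_stabiliser h \<alpha>))"
proof -
  obtain B where B: "fin_dim_char_0 (mscale :: 'k \<Rightarrow> 'k^'n^'n \<Rightarrow> _) B" using matrix_fin_dim by blast
  interpret fin_dim_char_0 mscale B by (fact B)
  note cf = coadjoint_form_alternating[OF B h \<alpha>]
  obtain m where "mvs.dim h = 2 * m + mvs.dim (coadjoint_stabiliser h \<alpha>)"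
    using symplectic_sequence[OF lie_subalgebraD(1)[OF h] cf(1)] unfolding cf(3) by blast
  then show ?thesis by simp
qed

lemma coadjoint_stabiliser_nonzero:
  fixes h :: "('k::field_char_0^'n^'n) set"
  assumes h: "lie_subalgebra h" and dim: "odd (mvs.dim h)"
    and \<alpha>: "\<alpha> \<in> dual_space h"
  obtains z where "z \<in> coadjoint_stabiliser h \<alpha>" "z \<noteq> 0"
proof -
  obtain B where B: "fin_dim_char_0 (mscale :: 'k \<Rightarrow> 'k^'n^'n \<Rightarrow> _) B" using matrix_fin_dim by blast
  interpret fin_dim_char_0 mscale B by (fact B)
  note cf = coadjoint_form_alternating[OF B h \<alpha>]
  show ?thesis using radical_nonzero[OF lie_subalgebraD(1)[OF h] cf(1) dim] that unfolding cf(3) by blast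
qed

lemma lie_index_attained:
  obtains \<phi> where "\<phi> \<in> dual_space h" "mvs.dim (coadjoint_stabiliser h \<phi>) = lie_index h"
proof -
  have "(\<lambda>_. 0) \<in> dual_space h" by (simp add: dual_space_def)
  then have ne: "(\<lambda>\<phi>. mvs.dim (coadjoint_stabiliser h \<phi>)) ` dual_space h \<noteq> {}" by (simp add: ex_in_conv[symmetric] exI)
  from Inf_nat_def1[OF this] show ?thesis
    unfolding lie_index_def[symmetric] by (elim imageE) (rule that, simp_all)
qed

text \<open>The projections to \<open>L\<close> and \<open>U\<close> are regular, and their
  derivatives in the direction \<open>X\<close> are the two components of \<open>X\<close>, as
  differentiating their product shows. For the intersection, \<open>pL i j\<close> is an entry
  function on \<open>L\<close> and constant on \<open>U\<close>, so its derivative along a common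
  \<open>X\<close> is both the entry of \<open>X\<close> and zero.\<close>

lemma Lie_semidirect_product:
  fixes Q L U :: "('k::field_char_0^'n^'n) set"
  assumes sd: "algebraic_semidirect_product Q L U"
  shows "U \<subseteq> Q" and "Lie Q = {x + v | x v. x \<in> Lie L \<and> v \<in> Lie U}" and "Lie L \<inter> Lie U \<subseteq> {0}"
proof -
  have sub: "subgroup Q GL" "subgroup L GL" "subgroup U GL" and LQ: "L \<subseteq> Q"
    and bij: "bij_betw (\<lambda>(l, u). l ** u) (L \<times> U) Q"
    and pl: "\<exists>f. f \<in> fun_alg GL_coords \<and> (\<forall>l\<in>L. \<forall>u\<in>U. f (l ** u) = l $ i $ j)"
    and pu: "\<exists>f. f \<in> fun_alg GL_coords \<and> (\<forall>l\<in>L. \<forall>u\<in>U. f (l ** u) = u $ i $ j)" for i j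
    using sd unfolding algebraic_semidirect_product_def algebraic_group_def Bex_def by simp_all
  note Q = subgroup_GL_D[OF sub(1)] and L = subgroup_GL_D[OF sub(2)] and U = subgroup_GL_D[OF sub(3)]
  have Q_eq: "Q = (\<lambda>(l, u). l ** u) ` (L \<times> U)" using bij by (simp add: bij_betw_def)
  then have Q_cases: "\<exists>l u. A = l ** u \<and> l \<in> L \<and> u \<in> U" if "A \<in> Q" for A using that by force
  show UQ: "U \<subseteq> Q"
  proof
    fix u assume "u \<in> U"
    then show "u \<in> Q" unfolding Q_eq using L(1) by (intro image_eqI[of _ _ "(mat 1, u)"]) simp_all
  qed
  define pL where "pL i j = (SOME f. f \<in> fun_alg GL_coords \<and> (\<forall>l\<in>L. \<forall>u\<in>U. f (l ** u) = l $ i $ j))" for i j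
  define pU where "pU i j = (SOME f. f \<in> fun_alg GL_coords \<and> (\<forall>l\<in>L. \<forall>u\<in>U. f (l ** u) = u $ i $ j))" for i j
  have pL: "pL i j \<in> fun_alg GL_coords" "l \<in> L \<Longrightarrow> u \<in> U \<Longrightarrow> pL i j (l ** u) = l $ i $ j" for i j l u
    using someI_ex[OF pl[of i j]] unfolding pL_def[symmetric] by simp_all
  have pU: "pU i j \<in> fun_alg GL_coords" "l \<in> L \<Longrightarrow> u \<in> U \<Longrightarrow> pU i j (l ** u) = u $ i $ j" for i j l u
    using someI_ex[OF pu[of i j]] unfolding pU_def[symmetric] by simp_all
  define projL where "projL A = (\<chi> i j. pL i j A)" for A
  define projU where "projU A = (\<chi> i j. pU i j A)" for A
  have projL: "projL (l ** u) = l" and projU: "projU (l ** u) = u" if "l \<in> L" "u \<in> U" for l u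
    using pL(2) pU(2) that by (simp_all add: projL_def projU_def vec_eq_iff)
  have projL1: "projL (mat 1) = mat 1" and projU1: "projU (mat 1) = mat 1"
    using projL[OF L(1) U(1)] projU[OF L(1) U(1)] by simp_all
  have dec: "\<exists>x v. X = x + v \<and> x \<in> Lie L \<and> v \<in> Lie U" if X: "X \<in> Lie Q" for X
  proof -
    define x where "x = (\<chi> i j. SOME c. regular_deriv X (pL i j) c)"
    define v where "v = (\<chi> i j. SOME c. regular_deriv X (pU i j) c)"
    have x: "regular_deriv X (\<lambda>A. projL A $ i $ j) (x $ i $ j)" for i j
      using someI_ex[OF regular_deriv_exists[OF pL(1)[of i j], of X]] by (simp add: x_def projL_def)
    have v: "regular_deriv X (\<lambda>A. projU A $ i $ j) (v $ i $ j)" for i j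
      using someI_ex[OF regular_deriv_exists[OF pU(1)[of i j], of X]] by (simp add: v_def projU_def)
    have "x \<in> Lie L"
      unfolding Lie_iff
    proof (intro ballI impI)
      fix f assume f: "f \<in> fun_alg entries" "\<forall>g\<in>L. f g = 0"
      have "f (projL A) = 0" if "A \<in> Q" for A using Q_cases[OF that] f(2) projL by auto
      from regular_deriv_vanish[OF X Q(1,2) regular_deriv_comp[OF f(1) x] this]
      show "dir_deriv f (mat 1) x = 0" by (simp add: projL1)
    qed
    moreover have "v \<in> Lie U"
      unfolding Lie_iff
    proof (intro ballI impI)
      fix f assume f: "f \<in> fun_alg entries" "\<forall>g\<in>U. f g = 0"
      have "f (projU A) = 0" if "A \<in> Q" for A using Q_cases[OF that] f(2) projU by auto
      from regular_deriv_vanish[OF X Q(1,2) regular_deriv_comp[OF f(1) v] this]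
      show "dir_deriv f (mat 1) v = 0" by (simp add: projU1)
    qed
    moreover have "X = x + v"
    proof -
      have d: "regular_deriv X (\<lambda>A. (projL A ** projU A) $ i $ j - A $ i $ j)
          ((x ** projU (mat 1) + projL (mat 1) ** v) $ i $ j - X $ i $ j)" for i j
        by (rule regular_deriv_diff[OF regular_deriv_matrix_mult[OF x v] regular_deriv_entry])
      have z: "(projL A ** projU A) $ i $ j - A $ i $ j = 0" if "A \<in> Q" for A i j
        using Q_cases[OF that] projL projU by auto
      have "(x ** projU (mat 1) + projL (mat 1) ** v) $ i $ j - X $ i $ j = 0" for i j
        by (rule regular_deriv_vanish[OF X Q(1,2) d z])
      then show ?thesis by (simp add: vec_eq_iff projL1 projU1)
    qed
    ultimately show ?thesis by blast
  qed
  have "x + v \<in> Lie Q" if "x \<in> Lie L" "v \<in> Lie U" for x v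
    using mvs.subspace_add[OF subspace_Lie subsetD[OF Lie_mono[OF LQ] that(1)] subsetD[OF Lie_mono[OF UQ] that(2)]] .
  with dec show "Lie Q = {x + v | x v. x \<in> Lie L \<and> v \<in> Lie U}" by blast
  show "Lie L \<inter> Lie U \<subseteq> {0}"
  proof
    fix X assume "X \<in> Lie L \<inter> Lie U"
    then have X: "X \<in> Lie L" "X \<in> Lie U" by simp_all
    have "X $ i $ j = 0" for i j
    proof -
      obtain c where c: "regular_deriv X (pL i j) c" using regular_deriv_exists[OF pL(1)] ..
      have z: "pL i j A - A $ i $ j = 0" if "A \<in> L" for A using pL(2)[OF that U(1)] by simp
      have "c - X $ i $ j = 0"
        by (rule regular_deriv_vanish[OF X(1) L(1,2) regular_deriv_diff[OF c regular_deriv_entry] z])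
      moreover have z: "pL i j A - (mat 1 :: 'k^'n^'n) $ i $ j = 0" if "A \<in> U" for A
        using pL(2)[OF L(1) that] by simp
      have "c - 0 = 0"
        by (rule regular_deriv_vanish[OF X(2) U(1,2) regular_deriv_diff[OF c regular_deriv_const] z])
      ultimately show ?thesis by simp
    qed
    then show "X \<in> {0}" by (simp add: vec_eq_iff)
  qed
qed

section \<open>Contact forms on a semi-direct product\<close>

lemma lie_bracket_jacobi:
  fixes X Y Z :: "'k::field^'n^'n"
  shows "lie_bracket (lie_bracket X Y) Z = lie_bracket X (lie_bracket Y Z) - lie_bracket Y (lie_bracket X Z)"
  by (simp add: lie_bracket_def matrix_mult_diff matrix_diff_mult matrix_mul_assoc)

text \<open>The situation on the level of Lie algebras. The assumption \<open>tangent\<close> is the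
  infinitesimal form of the openness of the orbit; the sign of \<open>ad_star\<close> disappears
  because \<delta> is arbitrary.\<close>

locale semidirect_functional =
  fixes l V :: "('k::field_char_0^'n^'n) set" and \<gamma> :: "'k^'n^'n \<Rightarrow> 'k"
  assumes l: "lie_subalgebra l" and V: "mvs.subspace V"
    and lV: "x \<in> l \<Longrightarrow> v \<in> V \<Longrightarrow> lie_bracket x v \<in> V"
    and VV: "v \<in> V \<Longrightarrow> w \<in> V \<Longrightarrow> lie_bracket v w = 0" and disj: "l \<inter> V \<subseteq> {0}"
    and \<gamma>: "\<gamma> \<in> dual_space V"
    and tangent: "\<delta> \<in> dual_space V \<Longrightarrow> \<exists>\<xi>\<in>l. \<forall>v\<in>V. \<gamma> (lie_bracket \<xi> v) = \<delta> v"
begin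

text \<open>Mind the sign: \<open>eigen c x\<close> means that \<open>ad\<^sup>* (x) \<gamma> = - c \<gamma>\<close>.\<close>

definition eigen :: "'k \<Rightarrow> 'k^'n^'n \<Rightarrow> bool" where
  "eigen c x \<longleftrightarrow> x \<in> l \<and> (\<forall>v\<in>V. \<gamma> (lie_bracket x v) = c * \<gamma> v)"

definition line_stabiliser :: "('k^'n^'n) set" where
  "line_stabiliser = {x. \<exists>c. eigen c x}"

definition total :: "('k^'n^'n) set" where
  "total = {x + v | x v. x \<in> l \<and> v \<in> V}"

lemmas l_sub = lie_subalgebraD[OF l]
lemmas \<gamma>_lin = dual_space_D[OF \<gamma>]

lemma Vl: "v \<in> V \<Longrightarrow> x \<in> l \<Longrightarrow> lie_bracket v x \<in> V"
  using mvs.subspace_neg[OF V lV[of x v]] lie_bracket_skew[of v x] by simp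

lemma \<gamma>_neg: "v \<in> V \<Longrightarrow> \<gamma> (- v) = - \<gamma> v"
  using \<gamma>_lin(2)[of v "-1"] by simp

lemma \<gamma>_diff: "v \<in> V \<Longrightarrow> w \<in> V \<Longrightarrow> \<gamma> (v - w) = \<gamma> v - \<gamma> w"
  using \<gamma>_lin(1)[of v "- w"] mvs.subspace_neg[OF V, of w] \<gamma>_neg[of w] by simp

lemma totalI: "x \<in> l \<Longrightarrow> v \<in> V \<Longrightarrow> x + v \<in> total"
  by (auto simp: total_def)

lemma totalE:
  assumes "w \<in> total" obtains x v where "w = x + v" "x \<in> l" "v \<in> V"
  using assms by (auto simp: total_def)

lemma l_total: "x \<in> l \<Longrightarrow> x \<in> total" using totalI[of x 0] mvs.subspace_0[OF V] by simp
lemma V_total: "v \<in> V \<Longrightarrow> v \<in> total" using totalI[of 0 v] mvs.subspace_0[OF l_sub(1)] by simp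

lemma total_subalgebra: "lie_subalgebra total"
  unfolding lie_subalgebra_def
proof (intro conjI ballI)
  show "mvs.subspace total" unfolding total_def by (rule mvs.subspace_sums[OF l_sub(1) V])
  fix w w' assume "w \<in> total" "w' \<in> total"
  then obtain x v y u where *: "w = x + v" "x \<in> l" "v \<in> V" "w' = y + u" "y \<in> l" "u \<in> V"
    by (elim totalE)
  have "lie_bracket w w' = lie_bracket x y + (lie_bracket x u + lie_bracket v y)"
    by (simp add: * lie_bracket_linear VV)
  also have "\<dots> \<in> total" by (intro totalI l_sub(2) mvs.subspace_add[OF V] lV Vl *)
  finally show "lie_bracket w w' \<in> total" .
qed

lemma eigen_l: "eigen c x \<Longrightarrow> x \<in> l" by (simp add: eigen_def)

lemma eigen_add: "eigen c x \<Longrightarrow> eigen d y \<Longrightarrow> eigen (c + d) (x + y)"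
  by (simp add: eigen_def lie_bracket_linear \<gamma>_lin lV mvs.subspace_add[OF l_sub(1)] algebra_simps)

lemma eigen_scale: "eigen c x \<Longrightarrow> eigen (k * c) (mscale k x)"
  by (simp add: eigen_def lie_bracket_linear \<gamma>_lin lV mvs.subspace_scale[OF l_sub(1)])

lemma eigen_bracket:
  assumes "eigen c x" "eigen d y" shows "eigen 0 (lie_bracket x y)"
proof -
  have xy: "x \<in> l" "y \<in> l" using assms by (simp_all add: eigen_def)
  have "\<gamma> (lie_bracket (lie_bracket x y) v) = 0" if v: "v \<in> V" for v
    using assms v xy by (simp add: lie_bracket_jacobi \<gamma>_diff lV eigen_def)
  then show ?thesis using l_sub(2)[OF xy] by (simp add: eigen_def)
qed

lemma eigen_line_stabiliser: "eigen c x \<Longrightarrow> x \<in> line_stabiliser"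
  by (auto simp: line_stabiliser_def)

lemma line_stabiliser_subalgebra: "lie_subalgebra line_stabiliser"
  unfolding lie_subalgebra_def
proof (intro conjI ballI)
  have "eigen 0 0"
    by (simp add: eigen_def mvs.subspace_0[OF l_sub(1)] lie_bracket_linear(5)[of 0 0, simplified]
        \<gamma>_lin(2)[OF mvs.subspace_0[OF V], of 0, simplified])
  then have "0 \<in> line_stabiliser" by (rule eigen_line_stabiliser)
  moreover have "x + y \<in> line_stabiliser" if "x \<in> line_stabiliser" "y \<in> line_stabiliser" for x y
    using that eigen_line_stabiliser[OF eigen_add] unfolding line_stabiliser_def by blast
  moreover have "mscale k x \<in> line_stabiliser" if "x \<in> line_stabiliser" for k x
    using that eigen_line_stabiliser[OF eigen_scale] unfolding line_stabiliser_def by blast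
  ultimately show "mvs.subspace line_stabiliser" by (rule mvs.subspaceI)
  show "lie_bracket x y \<in> line_stabiliser" if "x \<in> line_stabiliser" "y \<in> line_stabiliser" for x y
    using that eigen_bracket eigen_line_stabiliser unfolding line_stabiliser_def by blast
qed

lemma line_stabiliser_l: "x \<in> line_stabiliser \<Longrightarrow> x \<in> l"
  by (auto simp: line_stabiliser_def eigen_def)

text \<open>With the coordinate functions of \<open>V\<close> as \<delta>, \<open>tangent\<close>
  expresses each entry of \<open>v\<close> as a value \<gamma> [\<xi>, v].\<close>

lemma \<gamma>_separates:
  assumes v: "v \<in> V" and 0: "\<And>x. x \<in> l \<Longrightarrow> \<gamma> (lie_bracket x v) = 0"
  shows "v = 0"
proof -
  have "v $ i $ j = 0" for i j
  proof -
    have "(\<lambda>w. if w \<in> V then w $ i $ j else 0) \<in> dual_space V"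
      by (rule dual_space_restrict) (simp_all add: V)
    from tangent[OF this] obtain \<xi> where "\<xi> \<in> l" "\<gamma> (lie_bracket \<xi> v) = v $ i $ j" using v by auto
    then show ?thesis using 0 by simp
  qed
  then show ?thesis by (simp add: vec_eq_iff)
qed

lemma eigen_minus_one:
  obtains e where "eigen (- 1) e"
proof -
  have "(\<lambda>v. - \<gamma> v) \<in> dual_space V" using \<gamma> by (simp add: dual_space_def)
  from tangent[OF this] show ?thesis using that by (auto simp: eigen_def)
qed

text \<open>An element \<open>w = x + v\<close> of the radical of \<open>d\<alpha>\<close> is determined by \<open>x\<close>, which is in the radical of the
  restriction to the stabiliser of \<open>\<gamma>\<close>. Testing against \<open>e\<close> gives \<open>\<gamma> v = \<alpha> [e, x]\<close>, and
  testing the principal element \<open>s\<close>, which is \<open>- k e\<close> modulo the stabiliser of \<open>\<gamma>\<close>, against \<open>x\<close> gives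
  \<open>\<alpha> x = k \<alpha> [e, x]\<close>.\<close>

lemma radical_element:
  assumes \<alpha>: "\<alpha> \<in> dual_space total" and \<alpha>\<gamma>: "\<And>v. v \<in> V \<Longrightarrow> \<alpha> v = \<gamma> v" and e: "eigen (- 1) e" and s: "eigen k s"
    and principal: "\<And>y. y \<in> line_stabiliser \<Longrightarrow> \<alpha> (lie_bracket s y) = - \<alpha> y"
    and w: "w \<in> coadjoint_stabiliser total \<alpha>"
  obtains x v where "w = x + v" "v \<in> V" "eigen 0 x" "\<forall>y. eigen 0 y \<longrightarrow> \<alpha> (lie_bracket x y) = 0"
    "\<alpha> w = (1 + k) * \<alpha> (lie_bracket e x)"
proof -
  note \<alpha>_lin = dual_space_D[OF \<alpha>]
  have tot: "lie_bracket x y \<in> total" if "x \<in> l" "y \<in> l" for x y using l_total l_sub(2) that by blast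
  have \<alpha>_neg: "\<alpha> (lie_bracket y x) = - \<alpha> (lie_bracket x y)" if "x \<in> l" "y \<in> l" for x y
    using \<alpha>_lin(2)[OF tot[OF that], of "-1"] lie_bracket_skew[of y x] by simp
  have wt: "w \<in> total" and rad: "\<And>y. y \<in> total \<Longrightarrow> \<alpha> (lie_bracket w y) = 0"
    using w by (simp_all add: coadjoint_stabiliser_def)
  obtain x v where wxv: "w = x + v" and x: "x \<in> l" and v: "v \<in> V" using wt by (rule totalE)
  have ex0: "eigen 0 x"
    using rad[OF V_total] x v by (simp add: eigen_def wxv lie_bracket_linear VV lV flip: \<alpha>\<gamma>)
  have split: "\<alpha> (lie_bracket x y) + \<gamma> (lie_bracket v y) = 0" if y: "y \<in> l" for y
    using rad[OF l_total[OF y]] \<alpha>_lin(1)[OF tot[OF x y] V_total[OF Vl[OF v y]]]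
    by (simp add: wxv lie_bracket_linear \<alpha>\<gamma> Vl v y)
  have neg: "\<gamma> (lie_bracket v y) = - \<gamma> (lie_bracket y v)" if y: "y \<in> l" for y
    using \<gamma>_neg[OF lV[OF y v]] lie_bracket_skew[of v y] by simp
  have xy: "\<alpha> (lie_bracket x y) = 0" if y: "eigen 0 y" for y
    using split[OF eigen_l[OF y]] neg[OF eigen_l[OF y]] y v by (simp add: eigen_def)
  have el: "e \<in> l" and sl: "s \<in> l" using e s by (simp_all add: eigen_def)
  have "\<gamma> (lie_bracket v e) = \<gamma> v" using neg[OF el] e v by (simp add: eigen_def)
  then have \<gamma>v: "\<gamma> v = \<alpha> (lie_bracket e x)" using split[OF el] \<alpha>_neg[OF x el] by (simp add: add_eq_0_iff)
  have ske: "eigen 0 (s + mscale k e)" using eigen_add[OF s eigen_scale[OF e, of k]] by simp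
  have "\<alpha> (lie_bracket (s + mscale k e) x) = 0"
    using xy[OF ske] \<alpha>_neg[OF x eigen_l[OF ske]] by simp
  then have "\<alpha> (lie_bracket s x) + k * \<alpha> (lie_bracket e x) = 0"
    using \<alpha>_lin(1)[OF tot[OF sl x], of "mscale k (lie_bracket e x)"] \<alpha>_lin(2)[OF tot[OF el x]]
      mvs.subspace_scale[OF lie_subalgebraD(1)[OF total_subalgebra] tot[OF el x]]
    by (simp add: lie_bracket_linear)
  then have "\<alpha> x = k * \<alpha> (lie_bracket e x)"
    using principal[OF eigen_line_stabiliser[OF ex0]] by simp
  moreover have "\<alpha> w = \<alpha> x + \<gamma> v"
    using \<alpha>_lin(1)[OF l_total[OF x] V_total[OF v]] by (simp add: wxv \<alpha>\<gamma> v)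
  ultimately have "\<alpha> w = (1 + k) * \<alpha> (lie_bracket e x)" by (simp add: \<gamma>v algebra_simps)
  with xy show ?thesis by (intro that[OF wxv v ex0]) simp_all
qed

lemma contact_form_principal:
  assumes \<alpha>: "\<alpha> \<in> dual_space total" and \<alpha>\<gamma>: "\<And>v. v \<in> V \<Longrightarrow> \<alpha> v = \<gamma> v" and s: "eigen k s"
    and principal: "\<And>y. y \<in> line_stabiliser \<Longrightarrow> \<alpha> (lie_bracket s y) = - \<alpha> y"
    and nondeg: "\<And>x. x \<in> line_stabiliser \<Longrightarrow> (\<And>y. y \<in> line_stabiliser \<Longrightarrow> \<alpha> (lie_bracket x y) = 0) \<Longrightarrow> x = 0"
    and k: "k \<noteq> - 1"
  shows "contact_form total \<alpha>"
  unfolding contact_form_def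
proof (intro ballI impI)
  fix w assume wt: "w \<in> total" and rad: "\<forall>y\<in>total. \<alpha> (lie_bracket w y) = 0" and 0: "\<alpha> w = 0"
  note \<alpha>_lin = dual_space_D[OF \<alpha>]
  obtain e where e: "eigen (- 1) e" by (rule eigen_minus_one)
  have wr: "w \<in> coadjoint_stabiliser total \<alpha>" using wt rad by (simp add: coadjoint_stabiliser_def)
  obtain x v where w: "w = x + v" "v \<in> V" "eigen 0 x" "\<forall>y. eigen 0 y \<longrightarrow> \<alpha> (lie_bracket x y) = 0"
    "\<alpha> w = (1 + k) * \<alpha> (lie_bracket e x)"
    by (rule radical_element[OF \<alpha> \<alpha>\<gamma> e s principal wr]) (assumption | rule that)+
  have xl: "x \<in> l" and el: "e \<in> l" using eigen_l w(3) e by blast+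
  have tot: "lie_bracket x y \<in> total" if "x \<in> l" "y \<in> l" for x y using l_total l_sub(2) that by blast
  have "1 + k \<noteq> 0" using k by (simp add: add_eq_0_iff)
  then have "\<alpha> (lie_bracket e x) = 0" using w(5) 0 by simp
  then have xe: "\<alpha> (lie_bracket x e) = 0"
    using \<alpha>_lin(2)[OF tot[OF el xl], of "-1"] lie_bracket_skew[of x e] by simp
  have "x = 0"
  proof (rule nondeg[OF eigen_line_stabiliser[OF w(3)]])
    fix y assume "y \<in> line_stabiliser"
    then obtain d where y: "eigen d y" by (auto simp: line_stabiliser_def)
    \<comment> \<open>Modulo the stabiliser of \<gamma>, every element of the line stabiliser is a
      multiple of \<open>e\<close>, and both kinds have been seen to pair to zero with
      \<open>x\<close>.\<close>
    have "eigen 0 (y + mscale d e)" using eigen_add[OF y eigen_scale[OF e, of d]] by simp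
    from w(4)[rule_format, OF this] show "\<alpha> (lie_bracket x y) = 0"
      using \<alpha>_lin(1)[OF tot[OF xl eigen_l[OF y]], of "mscale d (lie_bracket x e)"] \<alpha>_lin(2)[OF tot[OF xl el], of d] xe
        mvs.subspace_scale[OF lie_subalgebraD(1)[OF total_subalgebra] tot[OF xl el]]
      by (simp add: lie_bracket_linear)
  qed
  then have wv: "w = v" using w(1) by simp
  have "v = 0"
  proof (rule \<gamma>_separates[OF w(2)])
    fix y assume y: "y \<in> l"
    have "\<gamma> (lie_bracket v y) = 0" using rad l_total[OF y] \<alpha>\<gamma>[OF Vl[OF w(2) y]] by (simp add: wv)
    then show "\<gamma> (lie_bracket y v) = 0"
      using \<gamma>_neg[OF Vl[OF w(2) y]] lie_bracket_skew[of y v] by simp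
  qed
  then show "w = 0" using wv by simp
qed

lemma not_contact_form_principal:
  assumes \<alpha>: "\<alpha> \<in> dual_space total" and \<alpha>\<gamma>: "\<And>v. v \<in> V \<Longrightarrow> \<alpha> v = \<gamma> v" and s: "eigen (- 1) s"
    and principal: "\<And>y. y \<in> line_stabiliser \<Longrightarrow> \<alpha> (lie_bracket s y) = - \<alpha> y"
    and odd: "odd (mvs.dim total)"
  shows "\<not> contact_form total \<alpha>"
proof
  assume cf: "contact_form total \<alpha>"
  obtain w where w: "w \<in> coadjoint_stabiliser total \<alpha>" "w \<noteq> 0"
    by (rule coadjoint_stabiliser_nonzero[OF total_subalgebra odd \<alpha>])
  \<comment> \<open>Here \<open>s\<close> itself can be taken for \<open>e\<close>, and the factor
    \<open>1 + k\<close> is zero.\<close>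
  have "\<alpha> w = 0" by (rule radical_element[OF \<alpha> \<alpha>\<gamma> s s principal w(1)]) simp_all
  then show False using cf w by (simp add: contact_form_def coadjoint_stabiliser_def)
qed

end

section \<open>The groups acting on an open orbit, and the normaliser of the line\<close>

lemma conj_subgroup:
  assumes "subgroup H (GL :: ('k::field^'n^'n) monoid)" "g \<in> H" "h \<in> H"
  shows "g ** h ** matrix_inv g \<in> H"
  by (intro subgroup_GL_D(3)[OF assms(1)] subgroup_GL_D(4)[OF assms(1)] assms)

lemma lie_subalgebra_Lie:
  fixes H :: "('k::field_char_0^'n^'n) set"
  assumes H: "subgroup H GL" shows "lie_subalgebra (Lie H)"
  unfolding lie_subalgebra_def
proof (intro conjI ballI)
  show "mvs.subspace (Lie H)" by (rule subspace_Lie)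
  show "lie_bracket x y \<in> Lie H" if "x \<in> Lie H" "y \<in> Lie H" for x y
    by (rule lie_bracket_Lie[OF subgroup_GL_D(1,2)[OF H] conj_subgroup[OF H] that])
qed

lemma conj_cancel:
  fixes g x :: "'k::field^'n^'n"
  assumes "invertible g"
  shows "g ** (matrix_inv g ** x ** g) ** matrix_inv g = x" "matrix_inv g ** (g ** x ** matrix_inv g) ** g = x"
proof -
  have "g ** (matrix_inv g ** x ** g) ** matrix_inv g = (g ** matrix_inv g) ** x ** (g ** matrix_inv g)"
    "matrix_inv g ** (g ** x ** matrix_inv g) ** g = (matrix_inv g ** g) ** x ** (matrix_inv g ** g)"
    by (simp_all only: matrix_mul_assoc)
  then show "g ** (matrix_inv g ** x ** g) ** matrix_inv g = x" "matrix_inv g ** (g ** x ** matrix_inv g) ** g = x"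
    by (simp_all add: matrix_inv_works assms)
qed

lemma matrix_inv_inv: "invertible g \<Longrightarrow> matrix_inv (matrix_inv g) = (g :: 'k::field^'n^'n)"
  by (rule matrix_inv_unique) (rule matrix_inv_works, assumption)+

locale semidirect_open_orbit =
  fixes Q L U V :: "('k::{alg_closed_field, field_char_0}^'n^'n) set" and \<gamma> :: "'k^'n^'n \<Rightarrow> 'k"
  assumes semidirect: "algebraic_semidirect_product Q L U"
    and comm: "comm_group (GL\<lparr>carrier := U\<rparr>)" and V_def: "V = Lie U"
    and \<gamma>_dual: "\<gamma> \<in> dual_space V" and orbit: "openin (zariski_dual V) (dual_orbit V L \<gamma>)"
begin

lemma groups: "algebraic_group L" "subgroup Q GL" "subgroup L GL" "subgroup U GL" "L \<subseteq> Q"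
    "normal U (GL\<lparr>carrier := Q\<rparr>)"
  using semidirect unfolding algebraic_semidirect_product_def algebraic_group_def by simp_all

lemmas Q_group = subgroup_GL_D[OF groups(2)]
lemmas L_group = subgroup_GL_D[OF groups(3)]

lemma conj_U: "g \<in> Q \<Longrightarrow> u \<in> U \<Longrightarrow> g ** u ** matrix_inv g \<in> U"
proof -
  assume g: "g \<in> Q" and u: "u \<in> U"
  have grpQ: "group (GL\<lparr>carrier := Q\<rparr>)" by (rule group.subgroup_imp_group[OF group_GL groups(2)])
  have "inv\<^bsub>GL\<lparr>carrier := Q\<rparr>\<^esub> g = matrix_inv g"
    by (rule group.inv_equality[OF grpQ]) (simp_all add: GL_def g Q_group(4) matrix_inv_works(2)[OF Q_group(2)[OF g]])
  then show ?thesis using normal.inv_op_closed2[OF groups(6), of g u] g u by (simp add: GL_def)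
qed

lemma commute_U: "u \<in> U \<Longrightarrow> v \<in> U \<Longrightarrow> u ** v = v ** u"
  using comm_monoid.m_comm[OF comm_group.axioms(1)[OF comm], of u v] by (simp add: GL_def)

lemma subspace_V: "mvs.subspace V" unfolding V_def by (rule subspace_Lie)

lemma conj_V: "g \<in> L \<Longrightarrow> v \<in> V \<Longrightarrow> g ** v ** matrix_inv g \<in> V"
  unfolding V_def by (rule conj_Lie[OF L_group(2) conj_U[OF subsetD[OF groups(5)]]])

lemma conj_V': "g \<in> L \<Longrightarrow> v \<in> V \<Longrightarrow> matrix_inv g ** v ** g \<in> V"
  using conj_V[OF L_group(4), of g v] matrix_inv_inv[OF L_group(2), of g] by simp

lemma conj_L: "g \<in> L \<Longrightarrow> x \<in> Lie L \<Longrightarrow> g ** x ** matrix_inv g \<in> Lie L"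
  by (rule conj_Lie[OF L_group(2) conj_subgroup[OF groups(3)]])

lemma bracket_V: "x \<in> Lie L \<Longrightarrow> v \<in> V \<Longrightarrow> lie_bracket x v \<in> V"
  unfolding V_def by (rule lie_bracket_Lie[OF L_group(1,2) conj_U[OF subsetD[OF groups(5)]]])

text \<open>Derivatives and specialisations are formulated for polynomial functions of matrices, so
  \<gamma> is replaced by a linear form in the entries that agrees with it on
  \<open>V\<close>.\<close>

lemma extension:
  obtains \<Gamma> G where "\<forall>X Y. \<Gamma> (X + Y) = \<Gamma> X + \<Gamma> Y" "\<forall>c X. \<Gamma> (mscale c X) = c * \<Gamma> X" "\<forall>x\<in>V. \<gamma> x = \<Gamma> x"
    "\<forall>X. \<Gamma> X = (\<Sum>i\<in>UNIV. \<Sum>j\<in>UNIV. G i j * X $ i $ j)"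
proof -
  obtain \<Gamma> where \<Gamma>: "(\<forall>X Y. \<Gamma> (X + Y) = \<Gamma> X + \<Gamma> Y) \<and> (\<forall>c X. \<Gamma> (mscale c X) = c * \<Gamma> X) \<and> (\<forall>x\<in>V. \<Gamma> x = \<gamma> x)"
    using dual_space_extend[OF subspace_V \<gamma>_dual] ..
  then have "\<Gamma> (X + Y) = \<Gamma> X + \<Gamma> Y" "\<Gamma> (mscale c X) = c * \<Gamma> X" for X Y c by simp_all
  from linear_coefficients[of \<Gamma>, OF this] obtain G where
    G: "\<forall>X. \<Gamma> X = (\<Sum>i\<in>UNIV. \<Sum>j\<in>UNIV. G i j * X $ i $ j)" ..
  show ?thesis by (rule that[OF _ _ _ G]) (use \<Gamma> in simp_all)
qed

sublocale semidirect_functional "Lie L" V \<gamma>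
proof
  show "lie_subalgebra (Lie L)" by (rule lie_subalgebra_Lie[OF groups(3)])
  show "mvs.subspace V" by (rule subspace_V)
  show "lie_bracket x v \<in> V" if "x \<in> Lie L" "v \<in> V" for x v using that by (rule bracket_V)
  show "lie_bracket v w = 0" if "v \<in> V" "w \<in> V" for v w
    using lie_bracket_Lie_commute[of U v w, OF commute_U] that unfolding V_def by blast
  show "Lie L \<inter> V \<subseteq> {0}" unfolding V_def by (rule Lie_semidirect_product(3)[OF semidirect])
  show "\<gamma> \<in> dual_space V" by (rule \<gamma>_dual)
  fix \<delta> assume \<delta>: "\<delta> \<in> dual_space V"
  obtain \<Gamma> G where \<Gamma>: "\<forall>X Y. \<Gamma> (X + Y) = \<Gamma> X + \<Gamma> Y" "\<forall>c X. \<Gamma> (mscale c X) = c * \<Gamma> X" "\<forall>x\<in>V. \<gamma> x = \<Gamma> x"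
    and G: "\<forall>X. \<Gamma> X = (\<Sum>i\<in>UNIV. \<Sum>j\<in>UNIV. G i j * X $ i $ j)"
    by (rule extension)
  obtain \<xi> where \<xi>: "\<xi> \<in> Lie L" "\<forall>v\<in>V. \<Gamma> (lie_bracket \<xi> v) = \<delta> v"
    using open_orbit_tangent[OF groups(1) subspace_V conj_V bracket_V G[rule_format] \<gamma>_dual \<Gamma>(3)[rule_format] orbit \<delta>] ..
  then show "\<exists>\<xi>\<in>Lie L. \<forall>v\<in>V. \<gamma> (lie_bracket \<xi> v) = \<delta> v"
    using \<Gamma>(3) bracket_V by (intro bexI[of _ \<xi>]) simp_all
qed

lemma total_eq: "total = Lie Q"
  unfolding total_def Lie_semidirect_product(2)[OF semidirect] V_def[symmetric] ..

abbreviation "A \<equiv> line_normaliser V L \<gamma>"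

lemma line_normaliser_iff: "g \<in> A \<longleftrightarrow> g \<in> L \<and> (\<exists>c. \<forall>v\<in>V. \<gamma> (matrix_inv g ** v ** g) = c * \<gamma> v)"
proof -
  have "dual_act V g \<gamma> = (\<lambda>v. c * \<gamma> v) \<longleftrightarrow> (\<forall>v\<in>V. \<gamma> (matrix_inv g ** v ** g) = c * \<gamma> v)" for c
    using dual_space_D(3)[OF \<gamma>_dual] by (auto simp: dual_act_def fun_eq_iff)
  then show ?thesis unfolding line_normaliser_def by simp
qed

lemma line_normaliser_L: "A \<subseteq> L" by (auto simp: line_normaliser_def)

lemma line_normaliser_invertible: "g \<in> A \<Longrightarrow> invertible g"
  using L_group(2) line_normaliser_L by blast

lemma line_normaliser_1: "mat 1 \<in> A"
  unfolding line_normaliser_iff using L_group(1) by (intro conjI exI[of _ 1]) simp_all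

lemma Lie_line_normaliser_subset: "Lie A \<subseteq> line_stabiliser"
proof
  fix x assume x: "x \<in> Lie A"
  have xL: "x \<in> Lie L" using Lie_mono[OF line_normaliser_L] x by (rule subsetD)
  show "x \<in> line_stabiliser"
  proof (cases "\<exists>w\<in>V. \<gamma> w \<noteq> 0")
    case False
    then have "eigen 0 x" using xL bracket_V by (simp add: eigen_def)
    then show ?thesis by (rule eigen_line_stabiliser)
  next
    case True
    then obtain w where w: "w \<in> V" "\<gamma> w \<noteq> 0" by (elim bexE)
    obtain \<Gamma> G where \<Gamma>: "\<forall>X Y. \<Gamma> (X + Y) = \<Gamma> X + \<Gamma> Y" "\<forall>c X. \<Gamma> (mscale c X) = c * \<Gamma> X" "\<forall>x\<in>V. \<gamma> x = \<Gamma> x"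
      and "\<forall>X. \<Gamma> X = (\<Sum>i\<in>UNIV. \<Sum>j\<in>UNIV. G i j * X $ i $ j)"
      by (rule extension)
    note \<Gamma>\<gamma> = \<Gamma>(3)[rule_format]
    note \<Gamma>_fun = linear_fun_alg[of \<Gamma>, OF \<Gamma>(1,2)[rule_format]]
    have "\<gamma> (lie_bracket x v) = \<gamma> (lie_bracket x w) / \<gamma> w * \<gamma> v" if v: "v \<in> V" for v
    proof -
      \<comment> \<open>A 2 by 2 minor: it expresses that the translate of \<gamma> is proportional
        to \<gamma> without naming the factor, and it is regular in \<open>g\<close>.\<close>
      define f where "f g = \<Gamma> w * \<Gamma> (matrix_inv g ** v ** g) - \<Gamma> v * \<Gamma> (matrix_inv g ** w ** g)" for g
      have 0: "f g = 0" if g: "g \<in> A" for g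
      proof -
        obtain c where c: "\<forall>v\<in>V. \<gamma> (matrix_inv g ** v ** g) = c * \<gamma> v" using g line_normaliser_iff by blast
        have gL: "g \<in> L" using g line_normaliser_L by blast
        have "\<Gamma> (matrix_inv g ** u ** g) = c * \<Gamma> u" if u: "u \<in> V" for u
          using c u \<Gamma>\<gamma>[OF conj_V'[OF gL u]] \<Gamma>\<gamma>[OF u] by simp
        then show ?thesis using v w by (simp add: f_def)
      qed
      have r: "regular_deriv x (\<lambda>g. c * \<Gamma> (matrix_inv g ** u ** g)) (c * \<Gamma> (lie_bracket u x))" for c u
        using regular_deriv_mult[OF regular_deriv_const[of x c] regular_deriv_conj(2)[OF \<Gamma>_fun(1), of x u]]
        by (simp add: \<Gamma>_fun(2))
      have "regular_deriv x f (\<Gamma> w * \<Gamma> (lie_bracket v x) - \<Gamma> v * \<Gamma> (lie_bracket w x))"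
        unfolding f_def[abs_def] by (rule regular_deriv_diff[OF r r])
      from regular_deriv_vanish[OF x line_normaliser_1 line_normaliser_invertible this 0]
      have "\<Gamma> w * \<Gamma> (lie_bracket v x) - \<Gamma> v * \<Gamma> (lie_bracket w x) = 0" .
      moreover have "\<Gamma> (lie_bracket u x) = - \<gamma> (lie_bracket x u)" if "u \<in> V" for u
        using \<gamma>_neg[OF bracket_V[OF xL that]] \<Gamma>\<gamma>[OF Vl[OF that xL]] lie_bracket_skew[of u x] by simp
      ultimately show ?thesis using v w \<Gamma>\<gamma>[OF v] \<Gamma>\<gamma>[OF w(1)] by (simp add: field_simps)
    qed
    then have "eigen (\<gamma> (lie_bracket x w) / \<gamma> w) x" using xL by (simp add: eigen_def)
    then show ?thesis by (rule eigen_line_stabiliser)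
  qed
qed

lemma Lie_line_normaliser: "Lie A = line_stabiliser"
proof (rule subset_antisym[OF Lie_line_normaliser_subset], rule subsetI)
  fix x assume "x \<in> line_stabiliser"
  then obtain c where xL: "x \<in> Lie L" and c: "\<forall>v\<in>V. \<gamma> (lie_bracket x v) = c * \<gamma> v"
    unfolding line_stabiliser_def eigen_def by blast
  obtain \<Gamma> G where "\<forall>X Y. \<Gamma> (X + Y) = \<Gamma> X + \<Gamma> Y" "\<forall>c X. \<Gamma> (mscale c X) = c * \<Gamma> X" and \<Gamma>: "\<forall>x\<in>V. \<gamma> x = \<Gamma> x"
    and G: "\<forall>X. \<Gamma> X = (\<Sum>i\<in>UNIV. \<Sum>j\<in>UNIV. G i j * X $ i $ j)"
    by (rule extension)
  note \<Gamma>\<gamma> = \<Gamma>[rule_format]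
  show "x \<in> Lie A"
  proof (rule Lie_line_normaliser_superset[OF groups(1) xL subspace_V bracket_V[OF xL] G[rule_format]])
    show "\<Gamma> (lie_bracket x v) = c * \<Gamma> v" if "v \<in> V" for v
      using c that \<Gamma>\<gamma>[OF that] \<Gamma>\<gamma>[OF bracket_V[OF xL that]] by simp
    show "h \<in> A" if h: "h \<in> L" "\<And>v. v \<in> V \<Longrightarrow> \<Gamma> (matrix_inv h ** v ** h) = e * \<Gamma> v" for h e
      unfolding line_normaliser_iff
    proof (intro conjI exI[of _ e] ballI)
      show "\<gamma> (matrix_inv h ** v ** h) = e * \<gamma> v" if "v \<in> V" for v
        using h(2)[OF that] \<Gamma>\<gamma>[OF conj_V'[OF h(1) that]] \<Gamma>\<gamma>[OF that] by simp
    qed (rule h(1))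
  qed
qed

text \<open>The definition of \<open>line_normaliser\<close> admits the factor zero; for an
  invertible \<open>g\<close> this would force \<gamma> to vanish.\<close>

lemma line_normaliser_inv:
  assumes g: "g \<in> A" and \<gamma>0: "\<exists>u\<in>V. \<gamma> u \<noteq> 0"
  shows "\<exists>c. c \<noteq> 0 \<and> (\<forall>v\<in>V. c * \<gamma> (g ** v ** matrix_inv g) = \<gamma> v)" "matrix_inv g \<in> A"
proof -
  have gL: "g \<in> L" using g line_normaliser_L by blast
  note gi = line_normaliser_invertible[OF g]
  obtain c where c: "\<forall>v\<in>V. \<gamma> (matrix_inv g ** v ** g) = c * \<gamma> v" using g line_normaliser_iff by blast
  have c': "c * \<gamma> (g ** v ** matrix_inv g) = \<gamma> v" if "v \<in> V" for v
    using c[rule_format, OF conj_V[OF gL that]] by (simp add: conj_cancel gi)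
  then have c0: "c \<noteq> 0" using \<gamma>0 by force
  show "\<exists>c. c \<noteq> 0 \<and> (\<forall>v\<in>V. c * \<gamma> (g ** v ** matrix_inv g) = \<gamma> v)" using c' c0 by blast
  show "matrix_inv g \<in> A"
    unfolding line_normaliser_iff matrix_inv_inv[OF gi]
  proof (intro conjI exI[of _ "1 / c"] ballI)
    show "matrix_inv g \<in> L" by (rule L_group(4)[OF gL])
    show "\<gamma> (g ** v ** matrix_inv g) = 1 / c * \<gamma> v" if "v \<in> V" for v
      using c'[OF that] c0 by (simp add: field_simps)
  qed
qed

text \<open>Elements of \<open>A\<close> rescale \<gamma>, which does not affect the eigenvalue of
  \<gamma> as an eigenvector.\<close>

lemma eigen_conj:
  assumes g: "g \<in> A" and \<gamma>0: "\<exists>u\<in>V. \<gamma> u \<noteq> 0" and x: "eigen k x"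
  shows "eigen k (g ** x ** matrix_inv g)"
proof -
  have gL: "g \<in> L" using g line_normaliser_L by blast
  note gi = line_normaliser_invertible[OF g]
  obtain c where c0: "c \<noteq> 0" and c: "\<forall>v\<in>V. c * \<gamma> (g ** v ** matrix_inv g) = \<gamma> v"
    using line_normaliser_inv(1)[OF g \<gamma>0] by blast
  have xL: "x \<in> Lie L" using x by (rule eigen_l)
  have "\<gamma> (lie_bracket (g ** x ** matrix_inv g) v) = k * \<gamma> v" if v: "v \<in> V" for v
  proof -
    define v' where "v' = matrix_inv g ** v ** g"
    have v': "v' \<in> V" unfolding v'_def by (rule conj_V'[OF gL v])
    have vv': "g ** v' ** matrix_inv g = v" unfolding v'_def by (rule conj_cancel(1)[OF gi])
    have "c * \<gamma> (lie_bracket (g ** x ** matrix_inv g) v) = c * \<gamma> (g ** lie_bracket x v' ** matrix_inv g)"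
      using conj_lie_bracket[OF matrix_inv_works[OF gi], of x v'] by (simp add: vv')
    also have "\<dots> = k * \<gamma> v'" using c[rule_format, OF bracket_V[OF xL v']] x v' by (simp add: eigen_def)
    also have "\<dots> = c * (k * \<gamma> v)" using c[rule_format, OF v'] by (simp add: vv' mult_ac)
    finally show ?thesis using c0 by simp
  qed
  then show ?thesis using conj_L[OF gL xL] by (simp add: eigen_def)
qed

lemma eigen_conj':
  assumes g: "g \<in> A" and \<gamma>0: "\<exists>u\<in>V. \<gamma> u \<noteq> 0" and x: "eigen k x"
  shows "eigen k (matrix_inv g ** x ** g)"
  using eigen_conj[OF line_normaliser_inv(2)[OF g \<gamma>0] \<gamma>0 x]
  by (simp only: matrix_inv_inv[OF line_normaliser_invertible[OF g]])

end

section \<open>Transport of functionals, principal elements and contact forms\<close>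

locale semidirect_open_orbit_nonzero = semidirect_open_orbit Q L U V \<gamma>
  for Q L U V :: "('k::{alg_closed_field, field_char_0}^'n^'n) set" and \<gamma> :: "'k^'n^'n \<Rightarrow> 'k" +
  assumes \<gamma>_nonzero: "\<exists>u\<in>V. \<gamma> u \<noteq> 0"
begin

abbreviation "a \<equiv> line_stabiliser"

lemmas a_sub = lie_subalgebraD[OF line_stabiliser_subalgebra]

lemma conj_a:
  assumes "g \<in> A" "x \<in> a" shows "g ** x ** matrix_inv g \<in> a" "matrix_inv g ** x ** g \<in> a"
proof -
  obtain k where k: "eigen k x" using assms(2) unfolding line_stabiliser_def by blast
  show "g ** x ** matrix_inv g \<in> a" by (rule eigen_line_stabiliser[OF eigen_conj[OF assms(1) \<gamma>_nonzero k]])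
  show "matrix_inv g ** x ** g \<in> a" by (rule eigen_line_stabiliser[OF eigen_conj'[OF assms(1) \<gamma>_nonzero k]])
qed

lemma dual_act_a: "y \<in> a \<Longrightarrow> dual_act a g \<phi> y = \<phi> (matrix_inv g ** y ** g)"
  by (simp add: dual_act_def)

lemma dual_act_dual_space:
  assumes "g \<in> A" "\<phi> \<in> dual_space a" shows "dual_act a g \<phi> \<in> dual_space a"
  unfolding dual_act_def
  by (rule dual_space_restrict)
    (simp_all add: matrix_add_mult matrix_add_ldistrib mscale_mult_left mscale_mult_right
      dual_space_D[OF assms(2)] conj_a(2)[OF assms(1)] a_sub(1))

lemma dual_act_bracket:
  assumes "g \<in> A" "x \<in> a" "y \<in> a"
  shows "dual_act a g \<phi> (lie_bracket x (g ** y ** matrix_inv g)) = \<phi> (lie_bracket (matrix_inv g ** x ** g) y)"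
proof -
  note gi = line_normaliser_invertible[OF assms(1)]
  have "lie_bracket x (g ** y ** matrix_inv g) \<in> a" by (intro a_sub(2) conj_a(1) assms)
  then show ?thesis
    using conj_lie_bracket[OF matrix_inv_works(2,1)[OF gi], of x "g ** y ** matrix_inv g"]
    by (simp add: dual_act_a conj_cancel(2)[OF gi])
qed

definition nondegenerate :: "('k^'n^'n \<Rightarrow> 'k) \<Rightarrow> bool" where
  "nondegenerate \<phi> \<longleftrightarrow> (\<forall>x\<in>a. (\<forall>y\<in>a. \<phi> (lie_bracket x y) = 0) \<longrightarrow> x = 0)"

text \<open>The equation \<open>ad_star a t \<phi> = \<phi>\<close> tested on \<open>a\<close>, with
  the sign moved to the other side.\<close>

definition principal :: "('k^'n^'n \<Rightarrow> 'k) \<Rightarrow> 'k^'n^'n \<Rightarrow> bool" where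
  "principal \<phi> t \<longleftrightarrow> t \<in> a \<and> (\<forall>y\<in>a. \<phi> (lie_bracket t y) = - \<phi> y)"

lemma nondegenerate_act:
  assumes g: "g \<in> A" and \<phi>: "nondegenerate \<phi>" shows "nondegenerate (dual_act a g \<phi>)"
  unfolding nondegenerate_def
proof (intro ballI impI)
  fix x assume x: "x \<in> a" and 0: "\<forall>y\<in>a. dual_act a g \<phi> (lie_bracket x y) = 0"
  have "\<phi> (lie_bracket (matrix_inv g ** x ** g) y) = 0" if "y \<in> a" for y
    using dual_act_bracket[OF g x that, of \<phi>] 0 conj_a(1)[OF g that] by simp
  then have "matrix_inv g ** x ** g = 0" using \<phi> conj_a(2)[OF g x] unfolding nondegenerate_def by blast
  then have "g ** 0 ** matrix_inv g = x"
    using conj_cancel(1)[OF line_normaliser_invertible[OF g], of x] by simp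
  moreover have "g ** 0 ** matrix_inv g = 0" by (simp add: vec_eq_iff matrix_matrix_mult_def)
  ultimately show "x = 0" by simp
qed

lemma principal_back:
  assumes g: "g \<in> A" and t: "principal (dual_act a g \<phi>) t"
  shows "principal \<phi> (matrix_inv g ** t ** g)"
  unfolding principal_def
proof (intro conjI ballI)
  have ta: "t \<in> a" using t by (simp add: principal_def)
  show "matrix_inv g ** t ** g \<in> a" by (rule conj_a(2)[OF g ta])
  fix y assume y: "y \<in> a"
  have "\<phi> (lie_bracket (matrix_inv g ** t ** g) y) = - dual_act a g \<phi> (g ** y ** matrix_inv g)"
    using dual_act_bracket[OF g ta y, of \<phi>] t conj_a(1)[OF g y] by (simp add: principal_def)
  then show "\<phi> (lie_bracket (matrix_inv g ** t ** g) y) = - \<phi> y"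
    by (simp add: dual_act_a[OF conj_a(1)[OF g y]] conj_cancel(2)[OF line_normaliser_invertible[OF g]])
qed

lemma principal_act:
  assumes g: "g \<in> A" and t: "principal \<phi> t"
  shows "principal (dual_act a g \<phi>) (g ** t ** matrix_inv g)"
  unfolding principal_def
proof (intro conjI ballI)
  note gi = line_normaliser_invertible[OF g]
  have ta: "t \<in> a" using t by (simp add: principal_def)
  show gta: "g ** t ** matrix_inv g \<in> a" by (rule conj_a(1)[OF g ta])
  fix y assume y: "y \<in> a"
  have "dual_act a g \<phi> (lie_bracket (g ** t ** matrix_inv g) y) = \<phi> (lie_bracket t (matrix_inv g ** y ** g))"
    using dual_act_bracket[OF g gta conj_a(2)[OF g y], of \<phi>] by (simp add: conj_cancel[OF gi])
  also have "\<dots> = - \<phi> (matrix_inv g ** y ** g)" using t conj_a(2)[OF g y] by (simp add: principal_def)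
  finally show "dual_act a g \<phi> (lie_bracket (g ** t ** matrix_inv g) y) = - dual_act a g \<phi> y"
    by (simp add: dual_act_a[OF y])
qed

lemma extend_to_total:
  assumes \<eta>: "\<eta> \<in> dual_space a"
  obtains \<alpha> where "\<alpha> \<in> dual_space total" "\<forall>x\<in>a. \<alpha> x = \<eta> x" "\<forall>v\<in>V. \<alpha> v = \<gamma> v"
proof -
  have a_total: "a \<subseteq> total" using line_stabiliser_l l_total by blast
  have V_tot: "V \<subseteq> total" using V_total by blast
  have "a \<inter> V \<subseteq> {0}" using disj line_stabiliser_l by blast
  then show ?thesis
    by (rule dual_space_extend2[OF a_sub(1) subspace_V _ \<eta> \<gamma>_dual lie_subalgebraD(1)[OF total_subalgebra] a_total V_tot])
      (rule that)
qed

lemma conj_total: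
  assumes "g \<in> Q" "x \<in> total" shows "g ** x ** matrix_inv g \<in> total"
  using assms unfolding total_eq by (intro conj_Lie Q_group(2) conj_subgroup[OF groups(2)])

lemma contact_form_conj:
  assumes g: "g \<in> Q" and \<alpha>: "contact_form total \<alpha>"
  shows "contact_form total (\<lambda>y. if y \<in> total then \<alpha> (g ** y ** matrix_inv g) else 0)"
  unfolding contact_form_def
proof (intro ballI impI)
  note gi = Q_group(2)[OF g]
  fix z assume z: "z \<in> total"
    and rad: "\<forall>y\<in>total. (if lie_bracket z y \<in> total then \<alpha> (g ** lie_bracket z y ** matrix_inv g) else 0) = 0"
    and 0: "(if z \<in> total then \<alpha> (g ** z ** matrix_inv g) else 0) = 0"
  note sub = lie_subalgebraD(2)[OF total_subalgebra]
  have "\<alpha> (lie_bracket (g ** z ** matrix_inv g) y) = 0" if y: "y \<in> total" for y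
  proof -
    have y': "matrix_inv g ** y ** g \<in> total"
      using conj_total[OF Q_group(4)[OF g] y] by (simp only: matrix_inv_inv[OF gi])
    have "lie_bracket (g ** z ** matrix_inv g) y = g ** lie_bracket z (matrix_inv g ** y ** g) ** matrix_inv g"
      using conj_lie_bracket[OF matrix_inv_works[OF gi], of z "matrix_inv g ** y ** g"]
      by (simp only: conj_cancel(1)[OF gi])
    then show ?thesis using rad[rule_format, OF y'] sub[OF z y'] by simp
  qed
  then have "g ** z ** matrix_inv g = 0"
    using \<alpha> conj_total[OF g z] 0 z unfolding contact_form_def by simp
  then have "matrix_inv g ** 0 ** g = z" using conj_cancel(2)[OF gi, of z] by simp
  moreover have "matrix_inv g ** 0 ** g = 0" by (simp add: vec_eq_iff matrix_matrix_mult_def)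
  ultimately show "z = 0" by simp
qed

lemma restriction_fun_alg:
  assumes "P \<in> fun_alg (evaluations W)" "W \<subseteq> total"
  shows "(\<lambda>\<alpha>. P (\<lambda>v. if v \<in> W then \<alpha> v else 0)) \<in> fun_alg (evaluations total)"
proof (rule fun_alg_comp[OF assms(1)])
  fix e :: "('k^'n^'n \<Rightarrow> 'k) \<Rightarrow> 'k" assume "e \<in> evaluations W"
  then obtain v where v: "e = (\<lambda>\<phi>. \<phi> v)" "v \<in> W" by (rule imageE)
  have "(\<lambda>\<phi>. \<phi> v) \<in> evaluations total" using v(2) assms(2) by (intro imageI) (rule subsetD)
  then show "(\<lambda>\<alpha>. e (\<lambda>v. if v \<in> W then \<alpha> v else 0)) \<in> fun_alg (evaluations total)"
    using v by (simp add: fun_alg.gen)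
qed

lemma restriction_dual_space:
  assumes "\<alpha> \<in> dual_space total" "mvs.subspace W" "W \<subseteq> total"
  shows "(\<lambda>v. if v \<in> W then \<alpha> v else 0) \<in> dual_space W"
  by (rule dual_space_restrict) (use assms(2,3) dual_space_D[OF assms(1)] in \<open>simp_all add: subset_iff\<close>)

lemma open_nonvanishing:
  assumes "openin (zariski_dual W) S" "\<phi> \<in> S"
  obtains f where "f \<in> fun_alg (evaluations W)" "f \<phi> \<noteq> 0" "\<forall>\<psi>\<in>dual_space W. f \<psi> \<noteq> 0 \<longrightarrow> \<psi> \<in> S"
proof -
  have "\<exists>f\<in>fun_alg (evaluations W). f \<phi> \<noteq> 0 \<and> (\<forall>y\<in>dual_space W. f y \<noteq> 0 \<longrightarrow> y \<in> S)"
    using assms unfolding zariski_dual_def openin_zariski by simp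
  then obtain f where "f \<in> fun_alg (evaluations W)" "f \<phi> \<noteq> 0 \<and> (\<forall>y\<in>dual_space W. f y \<noteq> 0 \<longrightarrow> y \<in> S)" by (rule bexE)
  then show ?thesis by (intro that[of f]) simp_all
qed

lemma dual_orbit_self: "\<gamma> \<in> dual_orbit V L \<gamma>"
proof -
  have "dual_act V (mat 1) \<gamma> = \<gamma>" using dual_space_D(3)[OF \<gamma>_dual] by (auto simp: dual_act_def fun_eq_iff)
  then show ?thesis unfolding dual_orbit_def using L_group(1) by (metis imageI)
qed

text \<open>Contact forms are a dense open set, so there is one whose restriction to \<open>V\<close> is in the open orbit
  of \<open>\<gamma>\<close>; conjugation by an element of \<open>L\<close> moves this restriction to \<open>\<gamma>\<close>.\<close>

lemma contact_form_over_\<gamma>: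
  assumes odd: "odd (mvs.dim total)" and \<alpha>: "\<alpha> \<in> dual_space total" "contact_form total \<alpha>"
    and \<alpha>': "\<alpha>' \<in> dual_space total" "\<And>v. v \<in> V \<Longrightarrow> \<alpha>' v = \<gamma> v"
  shows "\<exists>\<alpha>\<in>dual_space total. contact_form total \<alpha> \<and> (\<forall>v\<in>V. \<alpha> v = \<gamma> v)"
proof -
  have Vt: "V \<subseteq> total" by (rule subsetI) (rule V_total)
  obtain F where F: "F \<in> fun_alg (evaluations total)" "F \<alpha> \<noteq> 0"
    "\<forall>\<alpha>'\<in>dual_space total. F \<alpha>' \<noteq> 0 \<longrightarrow> contact_form total \<alpha>'"
    by (rule contact_form_poly[OF total_subalgebra odd \<alpha>])
  obtain f where f: "f \<in> fun_alg (evaluations V)" "f \<gamma> \<noteq> 0"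
    "\<forall>\<psi>\<in>dual_space V. f \<psi> \<noteq> 0 \<longrightarrow> \<psi> \<in> dual_orbit V L \<gamma>"
    by (rule open_nonvanishing[OF orbit dual_orbit_self])
  \<comment> \<open>The functional \<alpha>' shows that the open condition on the restriction to
    \<open>V\<close> can be satisfied; the line from \<alpha> to \<alpha>' then contains a contact
    form that satisfies it.\<close>
  have "(\<lambda>v. if v \<in> V then \<alpha>' v else 0) = \<gamma>"
    using \<alpha>'(2) dual_space_D(3)[OF \<gamma>_dual] by (simp add: fun_eq_iff)
  then have "f (\<lambda>v. if v \<in> V then \<alpha>' v else 0) \<noteq> 0" using f(2) by simp
  then obtain t where t: "F (\<lambda>v. \<alpha> v + t * (\<alpha>' v - \<alpha> v)) \<noteq> 0"
    "f (\<lambda>v. if v \<in> V then \<alpha> v + t * (\<alpha>' v - \<alpha> v) else 0) \<noteq> 0"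
    by (rule evaluations_common_nonzero[OF F(1,2) restriction_fun_alg[OF f(1) Vt]])
  define \<alpha>1 where "\<alpha>1 = (\<lambda>v. \<alpha> v + t * (\<alpha>' v - \<alpha> v))"
  have \<alpha>1: "\<alpha>1 \<in> dual_space total" "contact_form total \<alpha>1"
    unfolding \<alpha>1_def using dual_space_convex[OF \<alpha>(1) \<alpha>'(1)] F(3) t(1) by simp_all
  have "(\<lambda>v. if v \<in> V then \<alpha>1 v else 0) \<in> dual_orbit V L \<gamma>"
    using f(3)[rule_format, OF restriction_dual_space[OF \<alpha>1(1) subspace_V Vt]] t(2) unfolding \<alpha>1_def by (rule meta_mp)
  then obtain g where g: "g \<in> L" "(\<lambda>v. if v \<in> V then \<alpha>1 v else 0) = dual_act V g \<gamma>"
    unfolding dual_orbit_def by (elim imageE)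
  have gQ: "g \<in> Q" using g(1) groups(5) by (rule subsetD[rotated])
  have \<alpha>1\<gamma>: "\<alpha>1 v = \<gamma> (matrix_inv g ** v ** g)" if "v \<in> V" for v
    using fun_cong[OF g(2), of v] that by (simp add: dual_act_def)
  let ?\<alpha> = "\<lambda>y. if y \<in> total then \<alpha>1 (g ** y ** matrix_inv g) else 0"
  have "?\<alpha> \<in> dual_space total"
    by (rule dual_space_restrict)
      (simp_all add: matrix_add_mult matrix_add_ldistrib mscale_mult_left mscale_mult_right
        dual_space_D[OF \<alpha>1(1)] conj_total[OF gQ] lie_subalgebraD(1)[OF total_subalgebra])
  moreover have "contact_form total ?\<alpha>" by (rule contact_form_conj[OF gQ \<alpha>1(2)])
  moreover have "?\<alpha> v = \<gamma> v" if "v \<in> V" for v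
    using \<alpha>1\<gamma>[OF conj_V[OF g(1) that]] V_total[OF that] by (simp add: conj_cancel(2)[OF L_group(2)[OF g(1)]])
  ultimately show ?thesis by (intro bexI[of _ ?\<alpha>]) simp_all
qed

text \<open>For \<open>k = - 1\<close> a contact form is perturbed twice: once to make its
  restriction to \<open>V\<close> equal to \<gamma> after a conjugation, and once more to put its
  restriction to \<open>a\<close> into the open orbit of \<beta>. There a conjugate of
  \<open>s\<close> is principal, against \<open>not_contact_form_principal\<close>.\<close>

lemma contact_total_iff:
  assumes odd: "odd (mvs.dim total)"
    and \<beta>: "\<beta> \<in> dual_space a" "nondegenerate \<beta>" "openin (zariski_dual a) (dual_orbit a A \<beta>)"
    and g1: "g1 \<in> A" and s: "principal (dual_act a g1 \<beta>) s" "eigen k s"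
  shows "contact total \<longleftrightarrow> k \<noteq> - 1"
proof -
  define \<eta> where "\<eta> = dual_act a g1 \<beta>"
  have \<eta>: "\<eta> \<in> dual_space a" "nondegenerate \<eta>" "principal \<eta> s"
    unfolding \<eta>_def using dual_act_dual_space[OF g1 \<beta>(1)] nondegenerate_act[OF g1 \<beta>(2)] s(1) by simp_all
  obtain \<alpha> where \<alpha>: "\<alpha> \<in> dual_space total" "\<forall>x\<in>a. \<alpha> x = \<eta> x" "\<forall>v\<in>V. \<alpha> v = \<gamma> v"
    by (rule extend_to_total[OF \<eta>(1)])
  note \<alpha> = \<alpha>(1) \<alpha>(2)[rule_format] \<alpha>(3)[rule_format]
  have sa: "s \<in> a" using s(1) by (simp add: principal_def)
  have at: "a \<subseteq> total" by (intro subsetI l_total line_stabiliser_l)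
  have "contact_form total \<alpha>" if "k \<noteq> - 1"
  proof (rule contact_form_principal[OF \<alpha>(1,3) s(2) _ _ that])
    show "\<alpha> (lie_bracket s y) = - \<alpha> y" if "y \<in> a" for y
      using \<eta>(3) that \<alpha>(2)[OF a_sub(2)[OF sa that]] \<alpha>(2)[OF that] by (simp add: principal_def)
    show "x = 0" if x: "x \<in> a" and 0: "\<And>y. y \<in> a \<Longrightarrow> \<alpha> (lie_bracket x y) = 0" for x
      using \<eta>(2) x 0 \<alpha>(2)[OF a_sub(2)[OF x]] by (simp add: nondegenerate_def)
  qed
  moreover have "k \<noteq> - 1" if "contact total"
  proof
    assume k: "k = - 1"
    obtain \<alpha>0 where \<alpha>0: "\<alpha>0 \<in> dual_space total" "contact_form total \<alpha>0"
      using \<open>contact total\<close> contact_iff[OF total_subalgebra] by auto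
    obtain \<alpha>2 where \<alpha>2: "\<alpha>2 \<in> dual_space total" "contact_form total \<alpha>2" "\<forall>v\<in>V. \<alpha>2 v = \<gamma> v"
      using contact_form_over_\<gamma>[OF odd \<alpha>0 \<alpha>(1,3)] by auto
    obtain F where F: "F \<in> fun_alg (evaluations total)" "F \<alpha>2 \<noteq> 0"
      "\<forall>\<alpha>'\<in>dual_space total. F \<alpha>' \<noteq> 0 \<longrightarrow> contact_form total \<alpha>'"
      by (rule contact_form_poly[OF total_subalgebra odd \<alpha>2(1,2)])
    have "\<eta> \<in> dual_orbit a A \<beta>" unfolding \<eta>_def dual_orbit_def using g1 by (rule imageI)
    then obtain f where f: "f \<in> fun_alg (evaluations a)" "f \<eta> \<noteq> 0"
      "\<forall>\<psi>\<in>dual_space a. f \<psi> \<noteq> 0 \<longrightarrow> \<psi> \<in> dual_orbit a A \<beta>"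
      by (rule open_nonvanishing[OF \<beta>(3)])
    have "(\<lambda>v. if v \<in> a then \<alpha> v else 0) = \<eta>"
      using \<alpha>(2) dual_space_D(3)[OF \<eta>(1)] by (simp add: fun_eq_iff)
    then have "f (\<lambda>v. if v \<in> a then \<alpha> v else 0) \<noteq> 0" using f(2) by simp
    \<comment> \<open>Both ends of the line restrict to \<gamma> on \<open>V\<close>, so this
      restriction is not lost again.\<close>
    then obtain t where t: "F (\<lambda>v. \<alpha>2 v + t * (\<alpha> v - \<alpha>2 v)) \<noteq> 0"
      "f (\<lambda>v. if v \<in> a then \<alpha>2 v + t * (\<alpha> v - \<alpha>2 v) else 0) \<noteq> 0"
      by (rule evaluations_common_nonzero[OF F(1,2) restriction_fun_alg[OF f(1) at]])
    define \<alpha>3 where "\<alpha>3 = (\<lambda>v. \<alpha>2 v + t * (\<alpha> v - \<alpha>2 v))"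
    have \<alpha>3: "\<alpha>3 \<in> dual_space total" "contact_form total \<alpha>3"
      unfolding \<alpha>3_def using dual_space_convex[OF \<alpha>2(1) \<alpha>(1)] F(3) t(1) by simp_all
    have \<alpha>3\<gamma>: "\<alpha>3 v = \<gamma> v" if "v \<in> V" for v using \<alpha>2(3) \<alpha>(3) that by (simp add: \<alpha>3_def)
    have "(\<lambda>v. if v \<in> a then \<alpha>3 v else 0) \<in> dual_orbit a A \<beta>"
      using f(3)[rule_format, OF restriction_dual_space[OF \<alpha>3(1) a_sub(1) at]] t(2) unfolding \<alpha>3_def by (rule meta_mp)
    then obtain g2 where g2: "g2 \<in> A" "(\<lambda>v. if v \<in> a then \<alpha>3 v else 0) = dual_act a g2 \<beta>"
      unfolding dual_orbit_def by (elim imageE)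
    have \<alpha>3a: "\<alpha>3 v = dual_act a g2 \<beta> v" if "v \<in> a" for v
      using fun_cong[OF g2(2), of v] that by simp
    \<comment> \<open>From \<open>s\<close>, principal for \<eta>, back to \<beta> by
      \<open>g1\<close> and on to the restriction of \<alpha>3 by \<open>g2\<close>; both
      conjugations preserve the eigenvalue.\<close>
    define s' where "s' = g2 ** (matrix_inv g1 ** s ** g1) ** matrix_inv g2"
    have s': "principal (dual_act a g2 \<beta>) s'"
      unfolding s'_def by (rule principal_act[OF g2(1) principal_back[OF g1 s(1)]])
    have es: "eigen (- 1) s'"
      unfolding s'_def by (rule eigen_conj[OF g2(1) \<gamma>_nonzero eigen_conj'[OF g1 \<gamma>_nonzero s(2)[unfolded k]]])
    have pr: "\<alpha>3 (lie_bracket s' y) = - \<alpha>3 y" if "y \<in> a" for y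
    proof -
      have "s' \<in> a" using s' by (simp add: principal_def)
      then show ?thesis using s' \<alpha>3a[OF a_sub(2)[OF _ that]] \<alpha>3a[OF that] that by (simp add: principal_def)
    qed
    have "\<not> contact_form total \<alpha>3"
      by (rule not_contact_form_principal[OF \<alpha>3(1) _ es _ odd]) (fact \<alpha>3\<gamma>, fact pr)
    then show False using \<alpha>3(2) by simp
  qed
  ultimately show ?thesis using contact_iff[OF total_subalgebra] odd \<alpha>(1) by auto
qed

end

theorem proposition2p9:
  fixes Q L U V :: "('k::{alg_closed_field, field_char_0} ^ 'n ^ 'n) set"
    and \<gamma> :: "'k ^ 'n ^ 'n \<Rightarrow> 'k"
    and s :: "'k ^ 'n ^ 'n"
  assumes "connected_algebraic_group Q"
    and "algebraic_semidirect_product Q L U"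
    and "comm_group (GL\<lparr>carrier := U\<rparr>)"
    and "\<forall>u\<in>U. unipotent u"
    and "V = Lie U"
    and "lie_index (Lie Q) = 1"
    and "\<gamma> \<in> dual_space V"
    and "openin (zariski_dual V) (dual_orbit V L \<gamma>)"
    and "contact (Lie (stabiliser V L \<gamma>))"
    and "lie_index (Lie (line_normaliser V L \<gamma>)) = 0"
    and "principal_element (line_normaliser V L \<gamma>) s"
  shows "contact (Lie Q) \<longleftrightarrow> ad_star V s \<gamma> \<noteq> \<gamma>"
proof -
  interpret semidirect_open_orbit Q L U V \<gamma>
    by (rule semidirect_open_orbit.intro[OF assms(2,3,5,7,8)])
  \<comment> \<open>The index 1 is the dimension of a coadjoint stabiliser, whose parity is that of
    the algebra.\<close>
  have odd: "odd (mvs.dim total)"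
  proof -
    obtain \<phi> where "\<phi> \<in> dual_space (Lie Q)" "mvs.dim (coadjoint_stabiliser (Lie Q) \<phi>) = lie_index (Lie Q)"
      by (rule lie_index_attained)
    then show ?thesis
      using coadjoint_stabiliser_parity[OF lie_subalgebra_Lie[OF groups(2)]] assms(6) unfolding total_eq by simp
  qed
  let ?a = line_stabiliser
  obtain \<beta> g1 where \<beta>: "\<beta> \<in> dual_space ?a" "coadjoint_stabiliser ?a \<beta> = {0}"
      "openin (zariski_dual ?a) (dual_orbit ?a A \<beta>)"
      and g1: "g1 \<in> A" and s: "s \<in> ?a" "ad_star ?a s (dual_act ?a g1 \<beta>) = dual_act ?a g1 \<beta>"
    using assms(11) unfolding principal_element_def Lie_line_normaliser dual_orbit_def by auto
  \<comment> \<open>If \<gamma> were zero, \<open>\<gamma>_separates\<close> would give V = 0, and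
    the line stabiliser would be the whole algebra. This has odd dimension, while a trivial
    stabiliser of \<beta> makes the dimension even.\<close>
  have nz: "\<exists>u\<in>V. \<gamma> u \<noteq> 0"
  proof (rule ccontr)
    assume "\<not> ?thesis"
    then have 0: "\<gamma> v = 0" if "v \<in> V" for v using that by simp
    have V0: "v = 0" if v: "v \<in> V" for v by (rule \<gamma>_separates[OF v 0[OF bracket_V[OF _ v]]])
    have "?a = total"
    proof (intro subset_antisym subsetI)
      show "x \<in> total" if "x \<in> ?a" for x by (rule l_total[OF line_stabiliser_l[OF that]])
      fix w assume "w \<in> total"
      then obtain x v where "w = x + v" "x \<in> Lie L" "v \<in> V" by (rule totalE)
      with V0[of v] have "w \<in> Lie L" by simp
      then have "eigen 0 w" using 0 bracket_V by (simp add: eigen_def)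
      then show "w \<in> ?a" by (rule eigen_line_stabiliser)
    qed
    moreover have "mvs.dim {0 :: 'k^'n^'n} = 0"
      using mvs.dim_span_eq_card_independent[OF mvs.independent_empty] by simp
    ultimately show False
      using coadjoint_stabiliser_parity[OF line_stabiliser_subalgebra \<beta>(1)] odd \<beta>(2) by simp
  qed
  interpret semidirect_open_orbit_nonzero Q L U V \<gamma> by unfold_locales (rule nz)
  obtain k where k: "eigen k s" using s(1) by (auto simp: line_stabiliser_def)
  have "nondegenerate \<beta>"
    using \<beta>(2) unfolding nondegenerate_def coadjoint_stabiliser_def by blast
  moreover have "principal (dual_act ?a g1 \<beta>) s"
    unfolding principal_def
  proof (intro conjI ballI)
    show "s \<in> ?a" by (rule s(1))
    fix y assume "y \<in> ?a"
    then have "- dual_act ?a g1 \<beta> (lie_bracket s y) = dual_act ?a g1 \<beta> y"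
      using fun_cong[OF s(2), of y] by (simp add: ad_star_def)
    then show "dual_act ?a g1 \<beta> (lie_bracket s y) = - dual_act ?a g1 \<beta> y" by (simp add: minus_equation_iff)
  qed
  ultimately have "contact total \<longleftrightarrow> k \<noteq> - 1"
    by (intro contact_total_iff[OF odd \<beta>(1) _ \<beta>(3) g1 _ k])
  moreover have "ad_star V s \<gamma> = \<gamma> \<longleftrightarrow> k = - 1"
  proof
    assume *: "ad_star V s \<gamma> = \<gamma>"
    obtain u where u: "u \<in> V" "\<gamma> u \<noteq> 0" using nz by (elim bexE)
    have "- (k * \<gamma> u) = \<gamma> u" using fun_cong[OF *, of u] u(1) k by (simp add: ad_star_def eigen_def)
    then have "(k + 1) * \<gamma> u = 0" by (simp add: neg_eq_iff_add_eq_0 distrib_right)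
    then show "k = - 1" using u(2) by (simp add: eq_neg_iff_add_eq_0)
  next
    assume "k = - 1"
    then show "ad_star V s \<gamma> = \<gamma>"
      using k dual_space_D(3)[OF assms(7)] by (auto simp: ad_star_def eigen_def fun_eq_iff)
  qed
  ultimately show ?thesis by (simp add: total_eq)
qed

end
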